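(* Let $K=l_0\,p\,\|b\|_\infty$, let $g\in L^\infty(U)$ satisfy $\|g\|_\infty<\frac1{l_0}\left(\frac1{2^pK}\right)^{\frac1{p-1}}$, choose $0<c_0<1$ and set $\varepsilon_0:=\left(\frac{(1-c_0)^p}{2^pK}\right)^{\frac1{p-1}}$. Let $\mathcal{A}$ be the admissible set for $X$ and, for $\omega\in\mathcal{A}$, let $u_\omega(x)=u(x,\omega)$ be the corresponding solution (both defined in the context). Let $m\in\mathbb{N}$ and suppose that $$\sum_{j=1}^\infty\frac{(m+j-1)!}{(m-1)!\,j!}\,(l_0\|f\|_\infty)^j\ \mathbb{E}_{\mathcal{A}}\big[\,|\mu_\omega|^j\,\big]<+\infty .$$ Then $\mathbb{E}_{\mathcal{A}}[|u|^m(x,\omega)]\in L^\infty(U)$ and $$\mathbb{E}_{\mathcal{A}}\left[\big\||u|^m(\cdot,\omega)\big\|_{L^\infty(U)}\right]<\infty .$$ In particular, $\mathbb{E}_{\mathcal{A}}[u(x,\omega)]\in L^\infty(U)$.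
   Context: Let $n\ge3$, $p>1$, and let $U\subset\mathbb{R}^n$ be a bounded domain with diameter $d_U$; put $l_0:=\frac{d_U^2}{2(n-2)}$. $(\Omega,\mathcal{F},\mathbb{P})$ is a complete probability space. $\mathcal{M}(U)$ is the space of (signed) Radon measures on $U$ of finite total variation, with total variation norm denoted $|\mu|$ and its Borel $\sigma$-algebra. $X:\Omega\to\mathcal{M}(U)$ is a (Borel) random variable, $\mu_\omega:=X(\omega)$. $f\in BC(\mathbb{R}^n)$ (bounded continuous real functions) and $b\in L^\infty(U)$ are fixed, both nonzero, with $\|f\|_\infty:=\sup_{\mathbb{R}^n}|f|$ and $\|\cdot\|_\infty$ the essential supremum norm on $L^\infty(U)$. The random potential is $V_\omega(x):=\int_U f(x-y)\,d\mu_\omega(y)$, $x\in U$. The problem considered is $$-\Delta u+V_\omega(x)u=b(x)u|u|^{p-1}+g(x)\ \text{ in }U,\qquad u=0\ \text{ on }\partial U.$$ $G$ is the Green function of $-\Delta$ in $U$ with zero Dirichlet boundary condition, which satisfies $0\le G(x,y)\le\frac{1}{n\alpha_n(n-2)}|x-y|^{2-n}$ ($\alpha_n$ = volume of the unit ball of $\mathbb{R}^n$), and $H(\varphi)(x):=\int_U G(x,y)\varphi(y)\,dy$ for $\varphi\in L^\infty(U)$. An integral solution of the problem is a function $u\in L^\infty(U)$ satisfying $u=H(g)-H(V_\omega u)+H(bu|u|^{p-1})$. Set $\tau_\omega:=l_0\|f\|_\infty|\mu_\omega|$. Basic existence result: if $\varepsilon>0$ satisfies $0\le\tau_\omega<1$,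 $\frac{2^pK\varepsilon^{p-1}}{(1-\tau_\omega)^{p-1}}+\tau_\omega<1$ and $\|g\|_\infty\le\varepsilon/l_0$, then there is a unique integral solution $u_\omega$ with $\|u_\omega\|_\infty\le\frac{2\varepsilon}{1-\tau_\omega}$. The admissible set $\mathcal{A}$ for $X$ is the set of $\omega\in\Omega$ for which the problem has a unique solution $u(\cdot,\omega)$ given by this existence result with $\varepsilon=\varepsilon_0$, i.e. the set of $\omega$ for which its hypotheses hold with $\varepsilon=\varepsilon_0$; $u(\cdot,\omega)$ is then that unique solution. For a measurable $A\subset\Omega$, $\mathbb{E}_A[Y]:=\int_A Y(\omega)\,d\mathbb{P}(\omega)$; for real $Y$ this is the usual integral, and for $Y$ with values in the Banach space $L^\infty(U)$ (such as $\omega\mapsto u(\cdot,\omega)$ and $\omega\mapsto|u|^m(\cdot,\omega)=|u(\cdot,\omega)|^m$) it is the Bochner integral. *)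

theory Defs
  imports "HOL-Probability.Probability"
begin

section \<open>The space \<open>L\<^sup>\<infinity>(U)\<close>\<close>

text \<open>Elements of \<open>L\<^sup>\<infinity>(U)\<close> are represented by functions on the whole space of which only the
  values on \<open>U\<close> matter, up to null sets; equality in \<open>L\<^sup>\<infinity>(U)\<close> is equality almost everywhere
  on \<open>U\<close>, and all notions below are invariant under it.\<close>

definition Linf :: "'a::euclidean_space set \<Rightarrow> ('a \<Rightarrow> real) set" where
  "Linf U = {\<phi> \<in> borel_measurable (lebesgue_on U). esssup (lebesgue_on U) (\<lambda>x. ereal \<bar>\<phi> x\<bar>) < \<infinity>}"

definition Linf_norm :: "'a::euclidean_space set \<Rightarrow> ('a \<Rightarrow> real) \<Rightarrow> real" where
  "Linf_norm U \<phi> = real_of_ereal (esssup (lebesgue_on U) (\<lambda>x. ereal \<bar>\<phi> x\<bar>))"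

section \<open>Bochner integral with values in \<open>L\<^sup>\<infinity>(U)\<close>\<close>

text \<open>The Bochner integral of the library is restricted to second countable spaces, which excludes
  \<open>L\<^sup>\<infinity>(U)\<close>. The definitions below are the usual ones, for a finite measure \<open>M\<close>.\<close>

definition Linf_simple :: "'w measure \<Rightarrow> 'a::euclidean_space set \<Rightarrow> ('w \<Rightarrow> 'a \<Rightarrow> real) \<Rightarrow> bool" where
  "Linf_simple M U s \<longleftrightarrow> simple_function M s \<and> s \<in> space M \<rightarrow> Linf U"

definition Linf_simple_integral :: "'w measure \<Rightarrow> ('w \<Rightarrow> 'a::euclidean_space \<Rightarrow> real) \<Rightarrow> 'a \<Rightarrow> real" where
  "Linf_simple_integral M s = (\<lambda>x. \<Sum>\<phi>\<in>s ` space M. measure M (s -` {\<phi>} \<inter> space M) * \<phi> x)"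

definition Linf_strongly_measurable ::
    "'w measure \<Rightarrow> 'a::euclidean_space set \<Rightarrow> ('w \<Rightarrow> 'a \<Rightarrow> real) \<Rightarrow> bool" where
  "Linf_strongly_measurable M U F \<longleftrightarrow> F \<in> space M \<rightarrow> Linf U \<and>
    (\<exists>s. (\<forall>i::nat. Linf_simple M U (s i)) \<and>
      (AE \<omega> in M. (\<lambda>i. Linf_norm U (\<lambda>x. F \<omega> x - s i \<omega> x)) \<longlonglongrightarrow> 0))"

definition has_Linf_bochner_integral ::
    "'w measure \<Rightarrow> 'a::euclidean_space set \<Rightarrow> ('w \<Rightarrow> 'a \<Rightarrow> real) \<Rightarrow> ('a \<Rightarrow> real) \<Rightarrow> bool" where
  "has_Linf_bochner_integral M U F h \<longleftrightarrow> Linf_strongly_measurable M U F \<and> h \<in> Linf U \<and>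
    (\<exists>s. (\<forall>i::nat. Linf_simple M U (s i)) \<and>
      (\<lambda>i. \<integral>\<^sup>+\<omega>. ennreal (Linf_norm U (\<lambda>x. F \<omega> x - s i \<omega> x)) \<partial>M) \<longlonglongrightarrow> 0 \<and>
      (\<lambda>i. Linf_norm U (\<lambda>x. h x - Linf_simple_integral M (s i) x)) \<longlonglongrightarrow> 0)"

section \<open>Signed Radon measures on \<open>U\<close>\<close>

text \<open>A signed measure on \<open>U\<close> is a countably additive real set function on the Borel subsets of
  \<open>U\<close>, extended by \<open>0\<close> to all other sets so that equal measures are equal functions.\<close>

definition variation_sums :: "('a::euclidean_space set \<Rightarrow> real) \<Rightarrow> 'a set \<Rightarrow> real set" where
  "variation_sums \<mu> A = {\<Sum>B\<in>D. \<bar>\<mu> B\<bar> | D. finite D \<and> partition_on A D \<and> D \<subseteq> sets borel}"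

definition variation :: "('a::euclidean_space set \<Rightarrow> real) \<Rightarrow> 'a set \<Rightarrow> real" where
  "variation \<mu> A = Sup (variation_sums \<mu> A)"

definition signed_radon :: "'a::euclidean_space set \<Rightarrow> ('a set \<Rightarrow> real) set" where
  "signed_radon U = {\<mu>.
     (\<forall>A. A \<notin> sets (restrict_space borel U) \<longrightarrow> \<mu> A = 0) \<and>
     (\<forall>A::nat \<Rightarrow> 'a set. range A \<subseteq> sets (restrict_space borel U) \<and> disjoint_family A \<longrightarrow>
        (\<lambda>i. \<mu> (A i)) sums \<mu> (\<Union>i. A i)) \<and>
     bdd_above (variation_sums \<mu> U) \<and>
     (\<forall>A \<in> sets (restrict_space borel U). \<forall>e>0.
        \<exists>C. compact C \<and> C \<subseteq> A \<and> variation \<mu> (A - C) < e)}"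

abbreviation (input) tv_norm :: "'a::euclidean_space set \<Rightarrow> ('a set \<Rightarrow> real) \<Rightarrow> real" where
  "tv_norm U \<mu> \<equiv> variation \<mu> U"

text \<open>Metric spaces in the library require a distance that is nonnegative everywhere, hence the
  default value off the space.\<close>

definition tv_dist :: "'a::euclidean_space set \<Rightarrow> ('a set \<Rightarrow> real) \<Rightarrow> ('a set \<Rightarrow> real) \<Rightarrow> real" where
  "tv_dist U \<mu> \<nu> = (if \<mu> \<in> signed_radon U \<and> \<nu> \<in> signed_radon U
                     then tv_norm U (\<lambda>A. \<mu> A - \<nu> A) else 0)"

lemma Metric_space_signed_radon:
  assumes U: "U \<in> sets borel"
  shows "Metric_space (signed_radon U) (tv_dist U)"
proof -
  define Q where "Q = {D. finite D \<and> partition_on U D \<and> D \<subseteq> sets borel}"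
  have vs: "variation_sums \<mu> U = (\<lambda>D. \<Sum>B\<in>D. \<bar>\<mu> B\<bar>) ` Q" for \<mu>
    unfolding variation_sums_def Q_def by auto
  have Qne: "Q \<noteq> {}"
  proof (cases "U = {}")
    case True
    then have "{} \<in> Q" by (simp add: Q_def partition_on_def)
    then show ?thesis by auto
  next
    case False
    then have "{U} \<in> Q" using U by (simp add: Q_def partition_on_def)
    then show ?thesis by auto
  qed
  have up: "(\<Sum>B\<in>D. \<bar>\<mu> B\<bar>) \<le> tv_norm U \<mu>" if "D \<in> Q" "bdd_above (variation_sums \<mu> U)" for D \<mu>
    unfolding variation_def using that by (intro cSup_upper) (auto simp: vs)
  have least: "tv_norm U \<mu> \<le> c" if "\<And>D. D \<in> Q \<Longrightarrow> (\<Sum>B\<in>D. \<bar>\<mu> B\<bar>) \<le> c" for c \<mu>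
    unfolding variation_def vs using that Qne by (intro cSUP_least) auto
  have bdd: "bdd_above (variation_sums \<mu> U)" if "\<mu> \<in> signed_radon U" for \<mu>
    using that by (simp add: signed_radon_def)
  have tri: "bdd_above (variation_sums (\<lambda>A. \<alpha> A + \<beta> A) U) \<and>
      tv_norm U (\<lambda>A. \<alpha> A + \<beta> A) \<le> tv_norm U \<alpha> + tv_norm U \<beta>"
    if a: "bdd_above (variation_sums \<alpha> U)" and b: "bdd_above (variation_sums \<beta> U)" for \<alpha> \<beta>
  proof -
    have *: "(\<Sum>B\<in>D. \<bar>\<alpha> B + \<beta> B\<bar>) \<le> tv_norm U \<alpha> + tv_norm U \<beta>" if "D \<in> Q" for D
    proof -
      have "(\<Sum>B\<in>D. \<bar>\<alpha> B + \<beta> B\<bar>) \<le> (\<Sum>B\<in>D. \<bar>\<alpha> B\<bar> + \<bar>\<beta> B\<bar>)"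
        by (intro sum_mono) simp
      with up[OF that a] up[OF that b] show ?thesis by (simp add: sum.distrib)
    qed
    have "bdd_above (variation_sums (\<lambda>A. \<alpha> A + \<beta> A) U)"
      unfolding vs using * by (intro bdd_aboveI) auto
    with least[OF *] show ?thesis by blast
  qed
  have neg: "variation_sums (\<lambda>A. \<alpha> A - \<beta> A) U = variation_sums (\<lambda>A. \<beta> A - \<alpha> A) U" for \<alpha> \<beta>
    unfolding vs by (simp add: abs_minus_commute)
  have negb: "bdd_above (variation_sums (\<lambda>A. - \<beta> A) U)" if "bdd_above (variation_sums \<beta> U)" for \<beta>
    using that unfolding vs by simp
  have dbdd: "bdd_above (variation_sums (\<lambda>A. \<mu> A - \<nu> A) U)"
    if "\<mu> \<in> signed_radon U" "\<nu> \<in> signed_radon U" for \<mu> \<nu>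
    using tri[OF bdd[OF that(1)] negb[OF bdd[OF that(2)]]] by simp
  have Qsum: "0 \<le> (\<Sum>B\<in>D. \<bar>\<alpha> B\<bar>)" for D and \<alpha> :: "'a set \<Rightarrow> real"
    by (intro sum_nonneg) simp
  show ?thesis
  proof
    fix \<mu> \<nu> :: "'a set \<Rightarrow> real"
    show "tv_dist U \<mu> \<nu> = tv_dist U \<nu> \<mu>"
      unfolding tv_dist_def variation_def using neg[of \<mu> \<nu>] by auto
  next
    fix \<mu> \<nu> \<xi> assume m: "\<mu> \<in> signed_radon U" "\<nu> \<in> signed_radon U" "\<xi> \<in> signed_radon U"
    show "tv_dist U \<mu> \<xi> \<le> tv_dist U \<mu> \<nu> + tv_dist U \<nu> \<xi>"
      using tri[OF dbdd[OF m(1,2)] dbdd[OF m(2,3)]] m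
      by (simp add: tv_dist_def)
  next
    fix \<mu> \<nu> :: "'a set \<Rightarrow> real"
    show "0 \<le> tv_dist U \<mu> \<nu>"
    proof (cases "\<mu> \<in> signed_radon U \<and> \<nu> \<in> signed_radon U")
      case True
      obtain D where "D \<in> Q" using Qne by blast
      with up[of D "\<lambda>A. \<mu> A - \<nu> A"] dbdd[of \<mu> \<nu>] True Qsum[of "\<lambda>A. \<mu> A - \<nu> A" D] show ?thesis
        unfolding tv_dist_def by (simp del: sum_abs_ge_zero)
    qed (auto simp: tv_dist_def)
  next
    fix \<mu> \<nu> assume m: "\<mu> \<in> signed_radon U" "\<nu> \<in> signed_radon U"
    show "tv_dist U \<mu> \<nu> = 0 \<longleftrightarrow> \<mu> = \<nu>"
    proof
      assume "\<mu> = \<nu>"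
      then show "tv_dist U \<mu> \<nu> = 0"
        using Qne by (simp add: tv_dist_def variation_def vs)
    next
      assume z: "tv_dist U \<mu> \<nu> = 0"
      show "\<mu> = \<nu>"
      proof
        fix A
        show "\<mu> A = \<nu> A"
        proof (cases "A \<in> sets (restrict_space borel U) \<and> A \<noteq> {}")
          case True
          then have A: "A \<in> sets borel" "A \<subseteq> U" "A \<noteq> {}"
            using U by (auto simp: sets_restrict_space_iff)
          define D where "D = {A, U - A} - {{}}"
          have "D \<in> Q" using A U by (auto simp: Q_def D_def partition_on_def disjoint_def)
          from up[OF this dbdd[OF m]] z m have "(\<Sum>B\<in>D. \<bar>\<mu> B - \<nu> B\<bar>) \<le> 0"
            by (simp add: tv_dist_def)
          moreover have "\<bar>\<mu> A - \<nu> A\<bar> \<le> (\<Sum>B\<in>D. \<bar>\<mu> B - \<nu> B\<bar>)"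
            using A by (intro member_le_sum) (auto simp: D_def)
          ultimately show ?thesis by simp
        next
          case False
          have "\<kappa> {} = 0" if "\<kappa> \<in> signed_radon U" for \<kappa>
          proof -
            have "(\<lambda>i::nat. \<kappa> {}) sums \<kappa> (\<Union>i::nat. {})"
              using that unfolding signed_radon_def
              by (auto simp: disjoint_family_on_def dest!: spec[of _ "\<lambda>_. {}"])
            then have "(\<lambda>i::nat. \<kappa> {}) \<longlonglongrightarrow> 0" by (intro summable_LIMSEQ_zero sums_summable)
            then show ?thesis by (simp add: LIMSEQ_const_iff)
          qed
          from this[OF m(1)] this[OF m(2)] False m show ?thesis by (auto simp: signed_radon_def)
        qed
      qed
    qed
  qed
qed

definition borel_signed_radon :: "'a::euclidean_space set \<Rightarrow> ('a set \<Rightarrow> real) measure" where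
  "borel_signed_radon U =
     sigma (signed_radon U) {S. openin (Metric_space.mtopology (signed_radon U) (tv_dist U)) S}"

text \<open>Integration against \<open>\<mu>\<close> via the Jordan decomposition \<open>\<mu>\<^sup>\<plusminus> = (\<bar>\<mu>\<bar> \<plusminus> \<mu>) / 2\<close>.\<close>

definition pos_variation :: "'a::euclidean_space set \<Rightarrow> ('a set \<Rightarrow> real) \<Rightarrow> 'a measure" where
  "pos_variation U \<mu> = measure_of U (sets (restrict_space borel U))
     (\<lambda>A. ennreal ((variation \<mu> A + \<mu> A) / 2))"

definition neg_variation :: "'a::euclidean_space set \<Rightarrow> ('a set \<Rightarrow> real) \<Rightarrow> 'a measure" where
  "neg_variation U \<mu> = measure_of U (sets (restrict_space borel U))
     (\<lambda>A. ennreal ((variation \<mu> A - \<mu> A) / 2))"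

definition signed_integral ::
    "'a::euclidean_space set \<Rightarrow> ('a set \<Rightarrow> real) \<Rightarrow> ('a \<Rightarrow> real) \<Rightarrow> real" where
  "signed_integral U \<mu> \<phi> = (\<integral>y. \<phi> y \<partial>pos_variation U \<mu>) - (\<integral>y. \<phi> y \<partial>neg_variation U \<mu>)"

section \<open>The Dirichlet Green function\<close>

text \<open>Fundamental solution of \<open>-\<Delta>\<close> in dimension at least 3; the value at \<open>0\<close> is irrelevant.\<close>

definition fund_sol :: "'a::euclidean_space \<Rightarrow> real" where
  "fund_sol z = 1 / (real DIM('a) * unit_ball_vol (real DIM('a)) * (real DIM('a) - 2))
                  * (1 / norm z ^ (DIM('a) - 2))"

definition subharmonic_on :: "'a::euclidean_space set \<Rightarrow> ('a \<Rightarrow> real) \<Rightarrow> bool" where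
  "subharmonic_on U v \<longleftrightarrow> continuous_on U v \<and>
     (\<forall>a r. 0 < r \<and> cball a r \<subseteq> U \<longrightarrow>
        v a \<le> (\<integral>y. v y \<partial>lebesgue_on (cball a r)) / measure lebesgue (cball a r))"

text \<open>Perron solution of \<open>\<Delta>h = 0\<close> in \<open>U\<close>, \<open>h = \<psi>\<close> on the boundary. No boundary regularity of
  \<open>U\<close> is assumed, so the Dirichlet problem need not be classically solvable; when it is, the
  Perron solution is the classical one.\<close>

definition perron_solution :: "'a::euclidean_space set \<Rightarrow> ('a \<Rightarrow> real) \<Rightarrow> 'a \<Rightarrow> real" where
  "perron_solution U \<psi> y =
     (SUP v \<in> {v. continuous_on (closure U) v \<and> subharmonic_on U v \<and> (\<forall>z\<in>frontier U. v z \<le> \<psi> z)}. v y)"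

definition green :: "'a::euclidean_space set \<Rightarrow> 'a \<Rightarrow> 'a \<Rightarrow> real" where
  "green U x y = fund_sol (y - x) - perron_solution U (\<lambda>z. fund_sol (z - x)) y"

definition green_op :: "'a::euclidean_space set \<Rightarrow> ('a \<Rightarrow> real) \<Rightarrow> 'a \<Rightarrow> real" where
  "green_op U \<phi> x = (\<integral>y. green U x y * \<phi> y \<partial>lebesgue_on U)"

section \<open>The random problem\<close>

definition l0 :: "'a::euclidean_space set \<Rightarrow> real" where
  "l0 U = (diameter U)\<^sup>2 / (2 * (real DIM('a) - 2))"

definition potential ::
    "'a::euclidean_space set \<Rightarrow> ('a \<Rightarrow>\<^sub>C real) \<Rightarrow> ('a set \<Rightarrow> real) \<Rightarrow> 'a \<Rightarrow> real" where
  "potential U f \<mu> x = signed_integral U \<mu> (\<lambda>y. apply_bcontfun f (x - y))"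

definition integral_solution ::
    "'a::euclidean_space set \<Rightarrow> real \<Rightarrow> ('a \<Rightarrow> real) \<Rightarrow> ('a \<Rightarrow> real) \<Rightarrow> ('a \<Rightarrow> real) \<Rightarrow> ('a \<Rightarrow> real) \<Rightarrow> bool"
  where
  "integral_solution U p b g V u \<longleftrightarrow> u \<in> Linf U \<and>
     (AE x in lebesgue_on U. u x = green_op U g x - green_op U (\<lambda>y. V y * u y) x
                                   + green_op U (\<lambda>y. b y * u y * \<bar>u y\<bar> powr (p - 1)) x)"

definition tau :: "'a::euclidean_space set \<Rightarrow> ('a \<Rightarrow>\<^sub>C real) \<Rightarrow> ('a set \<Rightarrow> real) \<Rightarrow> real" where
  "tau U f \<mu> = l0 U * norm f * tv_norm U \<mu>"

definition admissible_set ::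
    "'w measure \<Rightarrow> ('w \<Rightarrow> 'a::euclidean_space set \<Rightarrow> real) \<Rightarrow> 'a set \<Rightarrow> real \<Rightarrow> ('a \<Rightarrow>\<^sub>C real) \<Rightarrow>
     real \<Rightarrow> ('a \<Rightarrow> real) \<Rightarrow> real \<Rightarrow> 'w set" where
  "admissible_set P X U p f K g \<epsilon> = {\<omega> \<in> space P.
     0 \<le> tau U f (X \<omega>) \<and> tau U f (X \<omega>) < 1 \<and>
     2 powr p * K * \<epsilon> powr (p - 1) / (1 - tau U f (X \<omega>)) powr (p - 1) + tau U f (X \<omega>) < 1 \<and>
     Linf_norm U g \<le> \<epsilon> / l0 U}"

end

theory Submission
  imports Defs
begin

text \<open>On the admissible set the choice of \<open>\<epsilon>\<^sub>0\<close> forces \<open>\<tau> < c\<^sub>0\<close>, hence \<open>\<parallel>u\<parallel>\<^sub>\<infinity> \<le> 2 \<epsilon>\<^sub>0 / (1 - c\<^sub>0)\<close>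
  uniformly in \<open>\<omega>\<close>, so only strong measurability of \<open>\<omega> \<mapsto> u(\<cdot>, \<omega>)\<close> is at stake. The space of
  measures is not separable, but \<open>u\<close> depends on \<open>\<mu>\<close> only through the potential \<open>f * \<mu>\<close>: the
  fixed point equation, a contraction with constant \<open>(1 + c\<^sub>0) / 2\<close>, makes \<open>u\<close> a Lipschitz function
  of the potential for the sup norm, and the potentials of bounded variation norm form an
  equicontinuous, hence totally bounded, family. So \<open>u\<close> and \<open>\<bar>u\<bar>\<^sup>m\<close> are uniform limits of simple
  functions. The contraction constant rests on \<open>0 \<le> G(x, y) \<le> \<Phi>(y - x)\<close> for the Perron Green function,
  obtained by comparing a subfunction \<open>v\<close> with \<open>\<Phi> + \<eta> (R\<^sup>2 - \<bar>y - x\<bar>\<^sup>2)\<close>, whose Laplacian is negative.\<close>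

section \<open>The space \<open>L\<^sup>\<infinity>(U)\<close> and uniform limits of simple functions\<close>

text \<open>The constants are tuned to each other. With
  \<open>R = 2 * \<epsilon>\<^sub>0 / (1 - c\<^sub>0)\<close> the choice of
  \<open>\<epsilon>\<^sub>0\<close> gives \<open>K * R powr (p - 1) = (1 - c\<^sub>0) / 2\<close>.
  This is the Lipschitz constant of the nonlinear term after the Green operator is applied; the
  linear term contributes \<tau>, and the sum is the contraction constant. \<open>l0 U\<close>
  enters because it bounds the integral of \<Phi>(y - x) over U, hence the Green operator on bounded
  functions. The solutions are handed over by the hypotheses, so two given solutions are compared
  directly and no iteration is run. Elements of the target space are functions compared almost
  everywhere, so the integral is assembled as an a.e. limit; uniform approximation keeps the number
  of exceptional null sets countable. Integration against \<mu> is not visibly linear in \<mu>,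
  since the variation of a difference is not the difference of the variations. Without boundary
  regularity the harmonic part of G is only a supremum of continuous subfunctions: it is lower
  semicontinuous off the pole, which gives measurability.\<close>

lemma AE_abs_le_Linf_norm:
  assumes "\<phi> \<in> Linf U"
  shows "AE x in lebesgue_on U. \<bar>\<phi> x\<bar> \<le> Linf_norm U \<phi>"
  using esssup_AE[of "\<lambda>x. ereal \<bar>\<phi> x\<bar>" "lebesgue_on U"]
proof eventually_elim
  case (elim x)
  \<comment> \<open>Finiteness keeps \<open>real_of_ereal\<close> faithful, which would send
    \<open>\<infinity>\<close> to 0. The value \<open>-\<infinity>\<close> contradicts the pointwise
    bound.\<close>
  moreover have "esssup (lebesgue_on U) (\<lambda>x. ereal \<bar>\<phi> x\<bar>) < \<infinity>"
    using assms by (simp add: Linf_def)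
  ultimately show ?case
    unfolding Linf_norm_def by (cases "esssup (lebesgue_on U) (\<lambda>x. ereal \<bar>\<phi> x\<bar>)") auto
qed

text \<open>On a null set the essential supremum can be \<open>-\<infinity>\<close>, and then
  \<open>Linf_norm\<close> is 0; this is the case where \<open>0 \<le> c\<close> enters the norm
  bound.\<close>

lemma
  assumes "\<phi> \<in> borel_measurable (lebesgue_on U)" "AE x in lebesgue_on U. \<bar>\<phi> x\<bar> \<le> c" "0 \<le> c"
  shows LinfI: "\<phi> \<in> Linf U" and Linf_norm_le: "Linf_norm U \<phi> \<le> c"
proof -
  have *: "esssup (lebesgue_on U) (\<lambda>x. ereal \<bar>\<phi> x\<bar>) \<le> ereal c"
    using assms by (intro esssup_I) auto
  then have "esssup (lebesgue_on U) (\<lambda>x. ereal \<bar>\<phi> x\<bar>) < \<infinity>"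
    by (rule order.strict_trans1) simp
  then show "\<phi> \<in> Linf U" using assms by (simp add: Linf_def)
  show "Linf_norm U \<phi> \<le> c"
    unfolding Linf_norm_def using * assms(3)
    by (cases "esssup (lebesgue_on U) (\<lambda>x. ereal \<bar>\<phi> x\<bar>)") auto
qed

text \<open>A negative essential supremum bounds a nonnegative function only if almost no point
  exists, so it is \<open>-\<infinity>\<close>; for a nonmeasurable function it is
  \<open>\<infinity>\<close>. Both become 0 under \<open>real_of_ereal\<close>, so the inequality is
  available for every function.\<close>

lemma Linf_norm_nonneg: "0 \<le> Linf_norm U \<phi>"
proof (cases "(\<lambda>x. ereal \<bar>\<phi> x\<bar>) \<in> borel_measurable (lebesgue_on U)")
  case True
  let ?E = "esssup (lebesgue_on U) (\<lambda>x. ereal \<bar>\<phi> x\<bar>)"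
  show ?thesis
  proof (cases "?E < 0")
    case neg: True
    have "AE x in lebesgue_on U. ereal \<bar>\<phi> x\<bar> \<le> ?E" by (rule esssup_AE)
    then have "AE x in lebesgue_on U. ereal \<bar>\<phi> x\<bar> \<le> -\<infinity>"
    proof eventually_elim
      case (elim x)
      moreover have "0 \<le> ereal \<bar>\<phi> x\<bar>" by simp
      ultimately show ?case using neg by (meson leD order.trans)
    qed
    then have "?E \<le> -\<infinity>" using True by (intro esssup_I)
    then show ?thesis by (simp add: Linf_norm_def)
  qed (simp add: Linf_norm_def real_of_ereal_pos)
qed (simp add: Linf_norm_def esssup_non_measurable top_ereal_def)

lemma Linf_diff:
  assumes "\<phi> \<in> Linf U" "\<psi> \<in> Linf U"
  shows "(\<lambda>x. \<phi> x - \<psi> x) \<in> Linf U"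
proof (rule LinfI)
  show "(\<lambda>x. \<phi> x - \<psi> x) \<in> borel_measurable (lebesgue_on U)"
    using assms by (auto simp: Linf_def)
  show "AE x in lebesgue_on U. \<bar>\<phi> x - \<psi> x\<bar> \<le> Linf_norm U \<phi> + Linf_norm U \<psi>"
    using AE_abs_le_Linf_norm[OF assms(1)] AE_abs_le_Linf_norm[OF assms(2)]
    by eventually_elim auto
qed (simp add: Linf_norm_nonneg)

lemma Linf_norm_diff_commute: "Linf_norm U (\<lambda>x. \<phi> x - \<psi> x) = Linf_norm U (\<lambda>x. \<psi> x - \<phi> x)"
  by (simp add: Linf_norm_def abs_minus_commute)

lemma Linf_norm_triangle:
  assumes "\<phi> \<in> Linf U" "\<psi> \<in> Linf U"
  shows "Linf_norm U \<phi> \<le> Linf_norm U \<psi> + Linf_norm U (\<lambda>x. \<phi> x - \<psi> x)"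
proof (rule Linf_norm_le)
  show "\<phi> \<in> borel_measurable (lebesgue_on U)"
    using assms by (auto simp: Linf_def)
  show "AE x in lebesgue_on U. \<bar>\<phi> x\<bar> \<le> Linf_norm U \<psi> + Linf_norm U (\<lambda>x. \<phi> x - \<psi> x)"
    using AE_abs_le_Linf_norm[OF assms(2)] AE_abs_le_Linf_norm[OF Linf_diff[OF assms]]
    by eventually_elim auto
qed (simp add: Linf_norm_nonneg)

section \<open>Integrals of simple functions and their uniform limits\<close>

lemma Linf_simple_integral_eq_integral:
  assumes "finite_measure M" "Linf_simple M U s"
  shows "integrable M (\<lambda>\<omega>. s \<omega> x)" "Linf_simple_integral M s x = (\<integral>\<omega>. s \<omega> x \<partial>M)"
proof -
  interpret finite_measure M by fact
  have sf: "simple_function M s" using assms by (simp add: Linf_simple_def)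
  then have fin: "finite (s ` space M)" by (rule simple_functionD)
  have ms: "s -` {\<phi>} \<inter> space M \<in> sets M" for \<phi> using sf by (rule simple_functionD)
  \<comment> \<open>Exactly one summand survives at each \<open>\<omega>\<close>. The resulting
    identity with the scalar integral holds at every \<open>x\<close>, not just almost
    everywhere.\<close>
  have eq: "s \<omega> x = (\<Sum>\<phi>\<in>s ` space M. \<phi> x * indicator (s -` {\<phi>} \<inter> space M) \<omega>)"
    if "\<omega> \<in> space M" for \<omega>
  proof -
    have "(\<Sum>\<phi>\<in>s ` space M. \<phi> x * indicator (s -` {\<phi>} \<inter> space M) \<omega>) =
        (\<Sum>\<phi>\<in>s ` space M. if \<phi> = s \<omega> then \<phi> x else 0)"
      using that by (intro sum.cong) (auto simp: indicator_def)
    also have "\<dots> = s \<omega> x" using fin that by simp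
    finally show ?thesis by simp
  qed
  have int: "integrable M (\<lambda>\<omega>. \<Sum>\<phi>\<in>s ` space M. \<phi> x * indicator (s -` {\<phi>} \<inter> space M) \<omega>)"
    using ms by (intro Bochner_Integration.integrable_sum integrable_mult_right
        integrable_real_indicator) (auto simp: less_top[symmetric])
  then show "integrable M (\<lambda>\<omega>. s \<omega> x)"
    by (subst Bochner_Integration.integrable_cong[OF refl eq])
  have "(\<integral>\<omega>. s \<omega> x \<partial>M) =
      (\<integral>\<omega>. (\<Sum>\<phi>\<in>s ` space M. \<phi> x * indicator (s -` {\<phi>} \<inter> space M) \<omega>) \<partial>M)"
    by (intro Bochner_Integration.integral_cong eq refl)
  also have "\<dots> = (\<Sum>\<phi>\<in>s ` space M. \<phi> x * measure M (s -` {\<phi>} \<inter> space M))"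
    using ms by (subst Bochner_Integration.integral_sum)
      (auto simp: less_top[symmetric] Int_absorb2)
  finally show "Linf_simple_integral M s x = (\<integral>\<omega>. s \<omega> x \<partial>M)"
    by (simp add: Linf_simple_integral_def mult.commute)
qed

lemma Linf_simple_integral_in_Linf:
  assumes "Linf_simple M U s"
  shows "Linf_simple_integral M s \<in> Linf U"
proof (rule LinfI)
  have sL: "\<phi> \<in> Linf U" if "\<phi> \<in> s ` space M" for \<phi>
    using assms that by (auto simp: Linf_simple_def)
  have fin: "finite (s ` space M)"
    using assms by (auto simp: Linf_simple_def dest: simple_functionD)
  show "Linf_simple_integral M s \<in> borel_measurable (lebesgue_on U)"
    unfolding Linf_simple_integral_def
    using sL by (intro borel_measurable_sum borel_measurable_times) (auto simp: Linf_def)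
  have "AE x in lebesgue_on U. \<forall>\<phi>\<in>s ` space M. \<bar>\<phi> x\<bar> \<le> Linf_norm U \<phi>"
    using fin sL AE_abs_le_Linf_norm by (intro AE_finite_allI) auto
  then show "AE x in lebesgue_on U. \<bar>Linf_simple_integral M s x\<bar> \<le>
      (\<Sum>\<phi>\<in>s ` space M. measure M (s -` {\<phi>} \<inter> space M) * Linf_norm U \<phi>)"
  proof eventually_elim
    case (elim x)
    then show ?case unfolding Linf_simple_integral_def
      by (intro order.trans[OF sum_abs] sum_mono) (auto simp: abs_mult intro!: mult_left_mono)
  qed
qed (auto intro!: sum_nonneg mult_nonneg_nonneg simp: Linf_norm_nonneg)

text \<open>Only finitely many pairs \<open>(s \<omega>, t \<omega>)\<close> occur, so a single null
  set in \<open>x\<close> serves all \<open>\<omega>\<close> at once; off it the scalar integrals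
  can be compared for fixed \<open>x\<close>.\<close>

lemma Linf_simple_integral_diff_le:
  assumes M: "finite_measure M" and s: "Linf_simple M U s" "Linf_simple M U t"
    and st: "\<And>\<omega>. \<omega> \<in> space M \<Longrightarrow> Linf_norm U (\<lambda>x. s \<omega> x - t \<omega> x) \<le> e"
  shows "AE x in lebesgue_on U.
    \<bar>Linf_simple_integral M s x - Linf_simple_integral M t x\<bar> \<le> e * measure M (space M)"
proof -
  interpret finite_measure M by fact
  have fin: "finite ((\<lambda>\<omega>. (s \<omega>, t \<omega>)) ` space M)"
    using s by (intro simple_functionD(1) simple_function_Pair) (auto simp: Linf_simple_def)
  have "AE x in lebesgue_on U. \<forall>q\<in>(\<lambda>\<omega>. (s \<omega>, t \<omega>)) ` space M. \<bar>fst q x - snd q x\<bar> \<le> e"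
  proof (intro AE_finite_allI fin)
    fix q assume "q \<in> (\<lambda>\<omega>. (s \<omega>, t \<omega>)) ` space M"
    then obtain \<omega> where \<omega>: "\<omega> \<in> space M" "q = (s \<omega>, t \<omega>)" by auto
    then have "(\<lambda>x. s \<omega> x - t \<omega> x) \<in> Linf U"
      using s by (intro Linf_diff) (auto simp: Linf_simple_def)
    from AE_abs_le_Linf_norm[OF this] st[OF \<omega>(1)]
    show "AE x in lebesgue_on U. \<bar>fst q x - snd q x\<bar> \<le> e"
      by (auto simp: \<omega>(2))
  qed
  then show ?thesis
  proof eventually_elim
    case (elim x)
    have i: "integrable M (\<lambda>\<omega>. s \<omega> x)" "integrable M (\<lambda>\<omega>. t \<omega> x)"
      using Linf_simple_integral_eq_integral(1)[OF M] s by blast+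
    have "\<bar>\<integral>\<omega>. s \<omega> x - t \<omega> x \<partial>M\<bar> \<le> (\<integral>\<omega>. \<bar>s \<omega> x - t \<omega> x\<bar> \<partial>M)"
      by (rule integral_abs_bound)
    also have "\<dots> \<le> (\<integral>\<omega>. e \<partial>M)"
      using i elim by (intro integral_mono) auto
    finally show ?case
      using i by (simp add: Linf_simple_integral_eq_integral(2)[OF M s(1)]
          Linf_simple_integral_eq_integral(2)[OF M s(2)] mult.commute)
  qed
qed

text \<open>Completeness in the form used below: the Cauchy bound holds off one null set with an
  explicit rate, so letting \<open>j\<close> tend to infinity keeps the rate \<open>e i\<close> for
  the limit.\<close>

lemma Linf_Cauchy_AE_imp_limit:
  assumes I: "\<And>i::nat. I i \<in> Linf U"
    and C: "AE x in lebesgue_on U. \<forall>i j. \<bar>I i x - I j x\<bar> \<le> e i + e j"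
    and e: "e \<longlonglongrightarrow> 0"
  shows "\<exists>h\<in>Linf U. (\<lambda>i. Linf_norm U (\<lambda>x. h x - I i x)) \<longlonglongrightarrow> 0"
proof -
  define h where "h x = lim (\<lambda>i. I i x)" for x
  have Im: "I i \<in> borel_measurable (lebesgue_on U)" for i using I by (auto simp: Linf_def)
  have hm: "h \<in> borel_measurable (lebesgue_on U)"
    unfolding h_def using Im by (intro borel_measurable_lim_metric) auto
  have conv: "AE x in lebesgue_on U. \<forall>i. \<bar>h x - I i x\<bar> \<le> e i"
    using C
  proof eventually_elim
    case (elim x)
    have "Cauchy (\<lambda>i. I i x)"
    proof (rule metric_CauchyI)
      fix r :: real assume "r > 0"
      then have "\<forall>\<^sub>F i in sequentially. e i < r / 2"
        using order_tendstoD(2)[OF e, of "r/2"] by simp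
      then obtain N where N: "\<And>i. i \<ge> N \<Longrightarrow> e i < r / 2" by (auto simp: eventually_sequentially)
      show "\<exists>N. \<forall>m\<ge>N. \<forall>n\<ge>N. dist (I m x) (I n x) < r"
      proof (intro exI allI impI)
        fix m n assume "N \<le> m" "N \<le> n"
        with N[of m] N[of n] elim[rule_format, of m n] show "dist (I m x) (I n x) < r"
          by (auto simp: dist_real_def)
      qed
    qed
    then have L: "(\<lambda>i. I i x) \<longlonglongrightarrow> h x"
      unfolding h_def by (simp add: Cauchy_convergent_iff convergent_LIMSEQ_iff)
    show ?case
    proof
      fix i
      have "(\<lambda>j. \<bar>I j x - I i x\<bar>) \<longlonglongrightarrow> \<bar>h x - I i x\<bar>"
        by (intro tendsto_intros L)
      moreover have "(\<lambda>j. e j + e i) \<longlonglongrightarrow> 0 + e i"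
        by (intro tendsto_intros e)
      ultimately have "\<bar>h x - I i x\<bar> \<le> 0 + e i"
        using elim by (intro LIMSEQ_le[of _ _ _ "0 + e i"]) auto
      then show "\<bar>h x - I i x\<bar> \<le> e i" by simp
    qed
  qed
  \<comment> \<open>The maximum with 0 covers a null \<open>U\<close>, where the hypothesis says
    nothing about the sign of \<open>e i\<close>.\<close>
  have le: "Linf_norm U (\<lambda>x. h x - I i x) \<le> max 0 (e i)" for i
    using conv Im hm by (intro Linf_norm_le) (auto elim!: eventually_mono simp: le_max_iff_disj)
  have "h \<in> Linf U"
  proof (rule LinfI[OF hm])
    show "AE x in lebesgue_on U. \<bar>h x\<bar> \<le> Linf_norm U (I 0) + max 0 (e 0)"
      using conv AE_abs_le_Linf_norm[OF I[of 0]]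
    proof eventually_elim
      case (elim x)
      from elim(2) elim(1)[rule_format, of 0] show ?case by linarith
    qed
  qed (simp add: Linf_norm_nonneg)
  moreover have "(\<lambda>i. Linf_norm U (\<lambda>x. h x - I i x)) \<longlonglongrightarrow> 0"
  proof (rule tendsto_sandwich[OF _ _ tendsto_const])
    show "(\<lambda>i. max 0 (e i)) \<longlonglongrightarrow> 0" using tendsto_max[OF tendsto_const e, of 0] by simp
  qed (use le in \<open>auto simp: Linf_norm_nonneg\<close>)
  ultimately show ?thesis by blast
qed

text \<open>Since the measure is finite, a uniform error \<open>e i\<close> costs at most
  \<open>e i * measure M (space M)\<close> both in the mean and between the integrals of two
  approximants. The latter form a Cauchy sequence whose limit is the Bochner integral.\<close>

lemma
  assumes M: "finite_measure M" and F: "F \<in> space M \<rightarrow> Linf U"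
    and approx: "\<And>e. 0 < e \<Longrightarrow>
      \<exists>s. Linf_simple M U s \<and> (\<forall>\<omega>\<in>space M. Linf_norm U (\<lambda>x. F \<omega> x - s \<omega> x) \<le> e)"
  shows has_Linf_bochner_integral_uniform_limit:
      "\<exists>h\<in>Linf U. has_Linf_bochner_integral M U F h"
    and Linf_norm_measurable_uniform_limit:
      "(\<lambda>\<omega>. Linf_norm U (F \<omega>)) \<in> borel_measurable M"
proof -
  interpret finite_measure M by fact
  define e where "e i = 1 / real (Suc i)" for i
  have e0: "e \<longlonglongrightarrow> 0" unfolding e_def using LIMSEQ_inverse_real_of_nat
    by (simp add: inverse_eq_divide)
  have "\<forall>i. \<exists>s. Linf_simple M U s \<and> (\<forall>\<omega>\<in>space M. Linf_norm U (\<lambda>x. F \<omega> x - s \<omega> x) \<le> e i)"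
    by (intro allI approx) (simp add: e_def)
  then obtain s where s: "\<And>i. Linf_simple M U (s i)"
    and Fs: "\<And>i \<omega>. \<omega> \<in> space M \<Longrightarrow> Linf_norm U (\<lambda>x. F \<omega> x - s i \<omega> x) \<le> e i"
    by metis
  have sL: "s i \<omega> \<in> Linf U" if "\<omega> \<in> space M" for i \<omega>
    using s that by (auto simp: Linf_simple_def)
  have lim: "(\<lambda>i. Linf_norm U (\<lambda>x. F \<omega> x - s i \<omega> x)) \<longlonglongrightarrow> 0" if "\<omega> \<in> space M" for \<omega>
    by (rule tendsto_sandwich[OF _ _ tendsto_const e0]) (use Fs that in \<open>auto simp: Linf_norm_nonneg\<close>)
  have strong: "Linf_strongly_measurable M U F"
    unfolding Linf_strongly_measurable_def using F s lim by (auto intro!: exI[of _ s] AE_I2)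
  have nn: "(\<lambda>i. \<integral>\<^sup>+\<omega>. ennreal (Linf_norm U (\<lambda>x. F \<omega> x - s i \<omega> x)) \<partial>M) \<longlonglongrightarrow> 0"
  proof (rule tendsto_sandwich[OF _ _ tendsto_const])
    have "(\<lambda>i. ennreal (e i * measure M (space M))) \<longlonglongrightarrow> ennreal (0 * measure M (space M))"
      using e0 by (intro tendsto_ennrealI tendsto_mult_right) auto
    then show "(\<lambda>i. ennreal (e i * measure M (space M))) \<longlonglongrightarrow> 0" by simp
    show "\<forall>\<^sub>F i in sequentially. (\<integral>\<^sup>+\<omega>. ennreal (Linf_norm U (\<lambda>x. F \<omega> x - s i \<omega> x)) \<partial>M)
        \<le> ennreal (e i * measure M (space M))"
    proof (intro always_eventually allI)
      fix i
      have "(\<integral>\<^sup>+\<omega>. ennreal (Linf_norm U (\<lambda>x. F \<omega> x - s i \<omega> x)) \<partial>M) \<le> (\<integral>\<^sup>+\<omega>. ennreal (e i) \<partial>M)"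
        using Fs by (intro nn_integral_mono ennreal_leI)
      also have "\<dots> = ennreal (e i * measure M (space M))"
        using ennreal_mult[of "e i" "measure M (space M)"]
        by (simp add: emeasure_eq_measure e_def del: ennreal_mult'')
      finally show "(\<integral>\<^sup>+\<omega>. ennreal (Linf_norm U (\<lambda>x. F \<omega> x - s i \<omega> x)) \<partial>M)
        \<le> ennreal (e i * measure M (space M))" .
    qed
  qed auto
  have ss: "Linf_norm U (\<lambda>x. s i \<omega> x - s j \<omega> x) \<le> e i + e j" if \<omega>: "\<omega> \<in> space M" for i j \<omega>
  proof (rule Linf_norm_le)
    have L: "(\<lambda>x. F \<omega> x - s i \<omega> x) \<in> Linf U" for i
      using F \<omega> sL by (intro Linf_diff) auto
    show "AE x in lebesgue_on U. \<bar>s i \<omega> x - s j \<omega> x\<bar> \<le> e i + e j"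
      using AE_abs_le_Linf_norm[OF L[of i]] AE_abs_le_Linf_norm[OF L[of j]]
    proof eventually_elim
      case (elim x)
      with Fs[OF \<omega>, of i] Fs[OF \<omega>, of j] show ?case by linarith
    qed
  qed (use sL[OF \<omega>] in \<open>auto simp: Linf_def e_def intro!: borel_measurable_diff\<close>)
  have "AE x in lebesgue_on U. \<forall>i j. \<bar>Linf_simple_integral M (s i) x - Linf_simple_integral M (s j) x\<bar>
      \<le> e i * measure M (space M) + e j * measure M (space M)"
    unfolding AE_all_countable
  proof (intro allI)
    fix i j
    show "AE x in lebesgue_on U. \<bar>Linf_simple_integral M (s i) x - Linf_simple_integral M (s j) x\<bar>
      \<le> e i * measure M (space M) + e j * measure M (space M)"
      using Linf_simple_integral_diff_le[OF M s s ss] by (simp add: distrib_right)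
  qed
  moreover have "(\<lambda>i. e i * measure M (space M)) \<longlonglongrightarrow> 0"
    using tendsto_mult_right[OF e0, of "measure M (space M)"] by simp
  ultimately obtain h where "h \<in> Linf U"
    "(\<lambda>i. Linf_norm U (\<lambda>x. h x - Linf_simple_integral M (s i) x)) \<longlonglongrightarrow> 0"
    using Linf_Cauchy_AE_imp_limit[of "\<lambda>i. Linf_simple_integral M (s i)" U
        "\<lambda>i. e i * measure M (space M)"]
      Linf_simple_integral_in_Linf[OF s] by blast
  with strong nn s show "\<exists>h\<in>Linf U. has_Linf_bochner_integral M U F h"
    unfolding has_Linf_bochner_integral_def by blast
  show "(\<lambda>\<omega>. Linf_norm U (F \<omega>)) \<in> borel_measurable M"
  \<comment> \<open>Any map composed with a simple function is simple, so \<open>Linf_norm\<close>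
    of the approximants is measurable; the reverse triangle inequality transfers this to the
    limit.\<close>
  proof (rule borel_measurable_LIMSEQ_real)
    show "(\<lambda>\<omega>. Linf_norm U (s i \<omega>)) \<in> borel_measurable M" for i
      using simple_function_compose[of M "s i" "Linf_norm U"] s[of i]
      by (intro borel_measurable_simple_function) (auto simp: Linf_simple_def comp_def)
    fix \<omega> assume \<omega>: "\<omega> \<in> space M"
    have "\<bar>Linf_norm U (s i \<omega>) - Linf_norm U (F \<omega>)\<bar> \<le> Linf_norm U (\<lambda>x. F \<omega> x - s i \<omega> x)" for i
      using Linf_norm_triangle[OF funcset_mem[OF F \<omega>] sL[OF \<omega>, of i]]
        Linf_norm_triangle[OF sL[OF \<omega>, of i] funcset_mem[OF F \<omega>]]
      by (auto simp: Linf_norm_diff_commute[of U "s i \<omega>"])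
    then have "(\<lambda>i. Linf_norm U (s i \<omega>) - Linf_norm U (F \<omega>)) \<longlonglongrightarrow> 0"
      by (intro tendsto_rabs_zero_cancel[OF tendsto_sandwich[OF _ _ tendsto_const lim[OF \<omega>]]]) auto
    then show "(\<lambda>i. Linf_norm U (s i \<omega>)) \<longlonglongrightarrow> Linf_norm U (F \<omega>)"
      by (simp add: LIM_zero_iff)
  qed
qed

text \<open>\<open>F\<close> is frozen at one representative point of each cell of \<open>c\<close>.
  A discretisation of \<open>\<omega>\<close> by arbitrary finite labels thus becomes a simple
  function with values in \<open>Linf U\<close>.\<close>

lemma Linf_simple_approx_of_cells:
  assumes F: "F \<in> space M \<rightarrow> Linf U" and c: "simple_function M c"
    and cells: "\<And>\<omega> \<omega>'. \<omega> \<in> space M \<Longrightarrow> \<omega>' \<in> space M \<Longrightarrow> c \<omega> = c \<omega>' \<Longrightarrow>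
      Linf_norm U (\<lambda>x. F \<omega> x - F \<omega>' x) \<le> e"
  shows "\<exists>s. Linf_simple M U s \<and> (\<forall>\<omega>\<in>space M. Linf_norm U (\<lambda>x. F \<omega> x - s \<omega> x) \<le> e)"
proof (intro exI conjI ballI)
  define r where "r q = (SOME \<omega>. \<omega> \<in> space M \<and> c \<omega> = q)" for q
  have r: "r (c \<omega>) \<in> space M \<and> c (r (c \<omega>)) = c \<omega>" if "\<omega> \<in> space M" for \<omega>
    unfolding r_def using that by (intro someI[where P="\<lambda>\<omega>'. \<omega>' \<in> space M \<and> c \<omega>' = c \<omega>"]) auto
  show "Linf_simple M U ((\<lambda>q. F (r q)) \<circ> c)"
    unfolding Linf_simple_def using F r by (auto intro!: simple_function_compose[OF c])
  show "Linf_norm U (\<lambda>x. F \<omega> x - ((\<lambda>q. F (r q)) \<circ> c) \<omega> x) \<le> e" if "\<omega> \<in> space M" for \<omega>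
    using cells[OF that] r[OF that] by auto
qed

section \<open>Total variation and the Jordan decomposition\<close>

lemma signed_radon_empty:
  assumes "\<mu> \<in> signed_radon U"
  shows "\<mu> {} = 0"
proof -
  have "(\<lambda>i::nat. \<mu> {}) sums \<mu> (\<Union>i::nat. {})"
    using assms unfolding signed_radon_def
    by (auto simp: disjoint_family_on_def dest!: spec[of _ "\<lambda>_. {}"])
  then have "(\<lambda>i::nat. \<mu> {}) \<longlonglongrightarrow> 0" by (intro summable_LIMSEQ_zero sums_summable)
  then show ?thesis by (simp add: LIMSEQ_const_iff)
qed

lemma signed_radon_sums:
  assumes "\<mu> \<in> signed_radon U" "\<And>i::nat. A i \<in> sets (restrict_space borel U)" "disjoint_family A"
  shows "(\<lambda>i. \<mu> (A i)) sums \<mu> (\<Union>i. A i)"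
  using assms unfolding signed_radon_def by blast

section \<open>Countable additivity of the variation\<close>

lemma partition_on_trivial: "partition_on A ({A} - {{}})"
  by (auto simp: partition_on_def disjoint_def)

lemma variation_least:
  assumes "A \<in> sets borel"
    and "\<And>D. finite D \<Longrightarrow> partition_on A D \<Longrightarrow> D \<subseteq> sets borel \<Longrightarrow> (\<Sum>B\<in>D. \<bar>\<mu> B\<bar>) \<le> c"
  shows "variation \<mu> A \<le> c"
  unfolding variation_def
proof (rule cSup_least)
  show "variation_sums \<mu> A \<noteq> {}"
    using assms(1) partition_on_trivial[of A]
    by (auto simp: variation_sums_def intro!: exI[of _ "{A} - {{}}"])
qed (use assms(2) in \<open>auto simp: variation_sums_def\<close>)

text \<open>A partition of \<open>A\<close> becomes one of \<open>U\<close> once the remainder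
  \<open>U - A\<close> is added, and this can only increase the sum.\<close>

lemma bdd_above_variation_sums_subset:
  assumes "bdd_above (variation_sums \<mu> U)" "A \<in> sets borel" "U \<in> sets borel" "A \<subseteq> U"
  shows "bdd_above (variation_sums \<mu> A)"
proof -
  obtain c where c: "\<And>s. s \<in> variation_sums \<mu> U \<Longrightarrow> s \<le> c"
    using assms(1) by (auto simp: bdd_above_def)
  have "(\<Sum>B\<in>D. \<bar>\<mu> B\<bar>) \<le> c" if D: "finite D" "partition_on A D" "D \<subseteq> sets borel" for D
  proof -
    define D' where "D' = D \<union> ({U - A} - {{}})"
    have "partition_on U D'"
    proof (rule partition_onI)
      show "\<Union>D' = U" using D(2) assms(4) by (auto simp: D'_def partition_on_def)
      show "{} \<notin> D'" using D(2) by (auto simp: D'_def partition_on_def)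
      fix p q assume "p \<in> D'" "q \<in> D'" "p \<noteq> q"
      then consider "p \<in> D" "q \<in> D" | "p \<subseteq> A" "q = U - A" | "p = U - A" "q \<subseteq> A"
        using D(2) by (auto simp: D'_def partition_on_def)
      then show "disjnt p q"
        using D(2) \<open>p \<noteq> q\<close> by cases (auto simp: partition_on_def disjnt_def disjoint_def)
    qed
    then have "(\<Sum>B\<in>D'. \<bar>\<mu> B\<bar>) \<le> c"
      using D assms by (intro c) (auto simp: variation_sums_def D'_def intro!: exI[of _ D'])
    moreover have "(\<Sum>B\<in>D. \<bar>\<mu> B\<bar>) \<le> (\<Sum>B\<in>D'. \<bar>\<mu> B\<bar>)"
      using D by (intro sum_mono2) (auto simp: D'_def)
    ultimately show ?thesis by simp
  qed
  then show ?thesis by (intro bdd_aboveI[of _ c]) (auto simp: variation_sums_def)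
qed

text \<open>A disjoint family is more flexible than a partition: members may be empty, and they need
  not cover \<open>A\<close>. Empty members contribute \<open>\<mu> {} = 0\<close>, and the
  uncovered rest is added as one more cell.\<close>

lemma sum_abs_le_variation:
  assumes "bdd_above (variation_sums \<mu> U)" "\<mu> {} = 0" and U: "U \<in> sets borel"
    and A: "A \<in> sets borel" "A \<subseteq> U"
    and I: "finite I" "disjoint_family_on B I" "\<And>i. i \<in> I \<Longrightarrow> B i \<in> sets borel \<and> B i \<subseteq> A"
  shows "(\<Sum>i\<in>I. \<bar>\<mu> (B i)\<bar>) \<le> variation \<mu> A"
proof -
  define J where "J = {i\<in>I. B i \<noteq> {}}"
  define D where "D = B ` J \<union> ({A - (\<Union>i\<in>I. B i)} - {{}})"
  have J: "finite J" "J \<subseteq> I" using I by (auto simp: J_def)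
  have inj: "inj_on B J"
    using I(2) by (fastforce simp: inj_on_def disjoint_family_on_def J_def)
  have "partition_on A D"
  proof (rule partition_onI)
    have "\<Union>(B ` J) = (\<Union>i\<in>I. B i)" by (auto simp: J_def)
    moreover have "\<Union>({A - W} - {{}}) = A - W" for W by auto
    ultimately have "\<Union>D = (\<Union>i\<in>I. B i) \<union> (A - (\<Union>i\<in>I. B i))"
      by (simp only: D_def Union_Un_distrib)
    moreover have "(\<Union>i\<in>I. B i) \<subseteq> A" using I(3) by blast
    ultimately show "\<Union>D = A" by (simp only: Un_Diff_cancel Un_absorb1)
    show "{} \<notin> D" by (auto simp: D_def J_def)
    fix p q assume "p \<in> D" "q \<in> D" "p \<noteq> q"
    moreover have "(\<exists>i\<in>I. p = B i) \<or> p = A - (\<Union>i\<in>I. B i)" if "p \<in> D" for p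
      using that J(2) unfolding D_def by blast
    ultimately consider i j where "i \<in> I" "j \<in> I" "i \<noteq> j" "p = B i" "q = B j"
      | i where "i \<in> I" "p = B i" "q = A - (\<Union>i\<in>I. B i)"
      | j where "j \<in> I" "q = B j" "p = A - (\<Union>i\<in>I. B i)"
      by metis
    then show "disjnt p q"
    proof cases
      case 1
      then show ?thesis using I(2) by (auto simp: disjnt_def disjoint_family_on_def)
    next
      case 2
      then show ?thesis by (auto simp: disjnt_def)
    next
      case 3
      then show ?thesis by (auto simp: disjnt_def)
    qed
  qed
  moreover have "D \<subseteq> sets borel"
  proof -
    have "(\<Union>i\<in>I. B i) \<in> sets borel" using I by (intro sets.finite_UN) auto
    then have "A - (\<Union>i\<in>I. B i) \<in> sets borel" using A(1) by (rule sets.Diff[rotated])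
    moreover have "B ` J \<subseteq> sets borel" using I(3) J(2) by blast
    ultimately show ?thesis unfolding D_def by blast
  qed
  moreover have "finite D" using J by (simp add: D_def)
  ultimately have "(\<Sum>B\<in>D. \<bar>\<mu> B\<bar>) \<in> variation_sums \<mu> A"
    unfolding variation_sums_def by blast
  then have "(\<Sum>B\<in>D. \<bar>\<mu> B\<bar>) \<le> variation \<mu> A"
    unfolding variation_def using bdd_above_variation_sums_subset[OF assms(1) A(1) U A(2)]
    by (rule cSup_upper)
  moreover have "(\<Sum>i\<in>I. \<bar>\<mu> (B i)\<bar>) = (\<Sum>i\<in>J. \<bar>\<mu> (B i)\<bar>)"
    using I assms(2) by (intro sum.mono_neutral_right) (auto simp: J_def)
  moreover have "\<dots> = (\<Sum>B\<in>B ` J. \<bar>\<mu> B\<bar>)"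
    using inj by (simp add: sum.reindex)
  moreover have "\<dots> \<le> (\<Sum>B\<in>D. \<bar>\<mu> B\<bar>)"
    using J by (intro sum_mono2) (auto simp: D_def)
  ultimately show ?thesis by simp
qed

lemma abs_le_variation:
  assumes "bdd_above (variation_sums \<mu> U)" "\<mu> {} = 0" "U \<in> sets borel" "A \<in> sets borel" "A \<subseteq> U"
  shows "\<bar>\<mu> A\<bar> \<le> variation \<mu> A"
  using sum_abs_le_variation[OF assms, of "{()}" "\<lambda>_. A"] assms
  by (auto simp: disjoint_family_on_def)

text \<open>Partitions of \<open>A\<close> and of \<open>B\<close> together partition
  \<open>A \<union> B\<close>. The two suprema are taken one after the other, with the other
  partition held fixed.\<close>

lemma variation_superadditive:
  assumes bd: "bdd_above (variation_sums \<mu> U)" and e: "\<mu> {} = 0" and U: "U \<in> sets borel"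
    and A: "A \<in> sets borel" "A \<subseteq> U" and B: "B \<in> sets borel" "B \<subseteq> U" and "A \<inter> B = {}"
  shows "variation \<mu> A + variation \<mu> B \<le> variation \<mu> (A \<union> B)"
proof -
  have *: "(\<Sum>C\<in>D. \<bar>\<mu> C\<bar>) + (\<Sum>C\<in>E. \<bar>\<mu> C\<bar>) \<le> variation \<mu> (A \<union> B)"
    if D: "finite D" "partition_on A D" "D \<subseteq> sets borel"
      and E: "finite E" "partition_on B E" "E \<subseteq> sets borel" for D E
  proof -
    have d: "D \<inter> E = {}"
    proof (rule ccontr)
      assume "D \<inter> E \<noteq> {}"
      then obtain C where "C \<in> D" "C \<in> E" by auto
      then have "C \<noteq> {}" "C \<subseteq> A" "C \<subseteq> B" using D E by (auto simp: partition_on_def)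
      then show False using assms(8) by auto
    qed
    have sub: "\<Union>D = A" "\<Union>E = B" using D E by (auto simp: partition_on_def)
    have dis: "disjoint D" "disjoint E" using D E by (auto simp: partition_on_def)
    have "disjoint_family_on (\<lambda>C. C) (D \<union> E)"
      unfolding disjoint_family_on_def
    proof (intro ballI impI)
      fix C C' assume C: "C \<in> D \<union> E" "C' \<in> D \<union> E" "C \<noteq> C'"
      consider "C \<in> D" "C' \<in> D" | "C \<in> E" "C' \<in> E" | "C \<subseteq> A" "C' \<subseteq> B" | "C \<subseteq> B" "C' \<subseteq> A"
        using C sub by auto
      then show "C \<inter> C' = {}" using dis C(3) assms(8) by cases (auto simp: disjoint_def)
    qed
    then have "(\<Sum>C\<in>D \<union> E. \<bar>\<mu> C\<bar>) \<le> variation \<mu> (A \<union> B)"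
      using D E sub A B by (intro sum_abs_le_variation[OF bd e U]) auto
    then show ?thesis using D E d by (simp add: sum.union_disjoint)
  qed
  have "variation \<mu> A \<le> variation \<mu> (A \<union> B) - variation \<mu> B"
  proof (rule variation_least[OF A(1)])
    fix D assume D: "finite D" "partition_on A D" "D \<subseteq> sets borel"
    have "variation \<mu> B \<le> variation \<mu> (A \<union> B) - (\<Sum>C\<in>D. \<bar>\<mu> C\<bar>)"
      using *[OF D] by (intro variation_least[OF B(1)]) (simp add: algebra_simps)
    then show "(\<Sum>C\<in>D. \<bar>\<mu> C\<bar>) \<le> variation \<mu> (A \<union> B) - variation \<mu> B" by simp
  qed
  then show ?thesis by simp
qed

text \<open>Superadditivity and monotonicity give one inequality through finite unions. For the
  other, every cell \<open>B\<close> of a partition is cut by the sets \<open>A i\<close>; countable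
  additivity of \<open>\<mu>\<close> expands \<open>\<mu> B\<close>, and the finite sum over cells
  is exchanged with the series.\<close>

lemma variation_sums_Union:
  assumes \<mu>: "\<mu> \<in> signed_radon U" and U: "U \<in> sets borel"
    and A: "range A \<subseteq> sets (restrict_space borel U)" "disjoint_family A"
  shows "(\<lambda>i::nat. variation \<mu> (A i)) sums variation \<mu> (\<Union>i. A i)"
proof -
  have bd: "bdd_above (variation_sums \<mu> U)" and e: "\<mu> {} = 0"
    using \<mu> signed_radon_empty[OF \<mu>] by (auto simp: signed_radon_def)
  have Ai: "A i \<in> sets borel" "A i \<subseteq> U" for i
    using A(1)[THEN subsetD, OF rangeI, of i] U by (auto simp: sets_restrict_space_iff)
  then have UA: "(\<Union>i. A i) \<in> sets borel" "(\<Union>i. A i) \<subseteq> U" by auto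
  note absv = abs_le_variation[OF bd e U]
  have nn: "0 \<le> variation \<mu> B" if "B \<in> sets borel" "B \<subseteq> U" for B
    using absv[OF that] by simp
  have mono: "variation \<mu> B \<le> variation \<mu> C" if "B \<in> sets borel" "C \<in> sets borel" "B \<subseteq> C" "C \<subseteq> U" for B C
  proof -
    have "B \<subseteq> U" "C - B \<subseteq> U" "B \<union> (C - B) = C" using that by auto
    then show ?thesis
      using variation_superadditive[OF bd e U that(1) _ sets.Diff[OF that(2,1)]] nn[of "C - B"] that
      by auto
  qed
  have fin: "(\<Sum>i<n. variation \<mu> (A i)) \<le> variation \<mu> (\<Union>i<n. A i)" for n
  proof (induction n)
    case 0
    then show ?case using nn[of "{}"] by simp
  next
    case (Suc n)
    have "A i \<inter> A n = {}" if "i < n" for i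
      using A(2) that by (intro disjoint_family_onD[OF A(2)]) auto
    then have "(\<Union>i<n. A i) \<inter> A n = {}" by blast
    then have "variation \<mu> (\<Union>i<n. A i) + variation \<mu> (A n) \<le> variation \<mu> ((\<Union>i<n. A i) \<union> A n)"
      using Ai by (intro variation_superadditive[OF bd e U]) auto
    also have "(\<Union>i<n. A i) \<union> A n = (\<Union>i<Suc n. A i)"
      by (auto simp: less_Suc_eq)
    finally show ?case using Suc by simp
  qed
  have le: "(\<Sum>i<n. variation \<mu> (A i)) \<le> variation \<mu> (\<Union>i. A i)" for n
    using Ai UA by (intro order.trans[OF fin mono]) auto
  have sm: "summable (\<lambda>i. variation \<mu> (A i))"
    by (rule bounded_imp_summable[where B="variation \<mu> (\<Union>i. A i)"])
      (use nn Ai le[of "Suc _"] in \<open>auto simp: lessThan_Suc_atMost\<close>)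
  have "variation \<mu> (\<Union>i. A i) \<le> (\<Sum>i. variation \<mu> (A i))"
  proof (rule variation_least[OF UA(1)])
    fix D assume D: "finite D" "partition_on (\<Union>i. A i) D" "D \<subseteq> sets borel"
    have sub: "B \<subseteq> (\<Union>i. A i)" "B \<in> sets borel" if "B \<in> D" for B
      using D that by (auto simp: partition_on_def)
    have smB: "summable (\<lambda>i. \<bar>\<mu> (B \<inter> A i)\<bar>)" if "B \<in> D" for B
    proof (rule summable_comparison_test'[OF sm])
      fix i
      have "\<bar>\<mu> (B \<inter> A i)\<bar> \<le> variation \<mu> (B \<inter> A i)"
        using Ai sub(2)[OF that] by (intro absv) auto
      also have "\<dots> \<le> variation \<mu> (A i)"
        using Ai sub(2)[OF that] by (intro mono) auto
      finally show "norm \<bar>\<mu> (B \<inter> A i)\<bar> \<le> variation \<mu> (A i)" by simp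
    qed
    have "(\<Sum>B\<in>D. \<bar>\<mu> B\<bar>) \<le> (\<Sum>B\<in>D. \<Sum>i. \<bar>\<mu> (B \<inter> A i)\<bar>)"
    proof (rule sum_mono)
      fix B assume B: "B \<in> D"
      have "(\<lambda>i. \<mu> (B \<inter> A i)) sums \<mu> (\<Union>i. B \<inter> A i)"
      proof -
        have "B \<inter> A i \<in> sets (restrict_space borel U)" for i
          using Ai[of i] sub(2)[OF B] U by (auto simp: sets_restrict_space_iff)
        moreover have "disjoint_family (\<lambda>i. B \<inter> A i)"
          using A(2) unfolding disjoint_family_on_def by blast
        ultimately show ?thesis by (rule signed_radon_sums[OF \<mu>])
      qed
      moreover have "(\<Union>i. B \<inter> A i) = B" using sub(1)[OF B] by auto
      ultimately have "\<mu> B = (\<Sum>i. \<mu> (B \<inter> A i))" by (simp add: sums_iff)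
      then show "\<bar>\<mu> B\<bar> \<le> (\<Sum>i. \<bar>\<mu> (B \<inter> A i)\<bar>)"
        using summable_rabs[OF smB[OF B]] by simp
    qed
    also have "\<dots> = (\<Sum>i. \<Sum>B\<in>D. \<bar>\<mu> (B \<inter> A i)\<bar>)"
      using smB by (intro suminf_sum[symmetric])
    also have "\<dots> \<le> (\<Sum>i. variation \<mu> (A i))"
    proof (rule suminf_le[OF _ summable_sum[OF smB] sm])
      fix i
      show "(\<Sum>B\<in>D. \<bar>\<mu> (B \<inter> A i)\<bar>) \<le> variation \<mu> (A i)"
      proof (rule sum_abs_le_variation[OF bd e U Ai D(1)])
        show "disjoint_family_on (\<lambda>B. B \<inter> A i) D"
          using D(2) unfolding disjoint_family_on_def partition_on_def disjoint_def by blast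
      qed (use sub(2) Ai in auto)
    qed
    finally show "(\<Sum>B\<in>D. \<bar>\<mu> B\<bar>) \<le> (\<Sum>i. variation \<mu> (A i))" .
  qed
  moreover have "(\<Sum>i. variation \<mu> (A i)) \<le> variation \<mu> (\<Union>i. A i)"
    using sm le by (intro suminf_le_const)
  ultimately show ?thesis using sm by (simp add: sums_iff)
qed

text \<open>\<open>\<bar>\<mu> A\<bar> \<le> variation \<mu> A\<close> makes both set functions
  nonnegative, so \<open>ennreal\<close> truncates nothing, and they inherit countable additivity;
  \<open>measure_of\<close> then keeps the prescribed values instead of collapsing to 0. The factor
  \<open>k\<close>, equal to 1 or -1, treats both parts at once.\<close>

lemma
  fixes U :: "'a::euclidean_space set"
  assumes \<mu>: "\<mu> \<in> signed_radon U" and U: "U \<in> sets borel"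
  shows sets_pos_variation: "sets (pos_variation U \<mu>) = sets (restrict_space borel U)"
    and sets_neg_variation: "sets (neg_variation U \<mu>) = sets (restrict_space borel U)"
    and emeasure_pos_variation: "A \<in> sets (restrict_space borel U) \<Longrightarrow>
      emeasure (pos_variation U \<mu>) A = ennreal ((variation \<mu> A + \<mu> A) / 2)"
    and emeasure_neg_variation: "A \<in> sets (restrict_space borel U) \<Longrightarrow>
      emeasure (neg_variation U \<mu>) A = ennreal ((variation \<mu> A - \<mu> A) / 2)"
proof -
  let ?R = "sets (restrict_space borel U)"
  have bd: "bdd_above (variation_sums \<mu> U)" and e: "\<mu> {} = 0"
    using \<mu> signed_radon_empty[OF \<mu>] by (auto simp: signed_radon_def)
  have sa: "sigma_algebra U ?R"
    using sets.sigma_algebra_axioms[of "restrict_space borel U"] by (simp add: space_restrict_space)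
  have Pow: "?R \<subseteq> Pow U" using U by (auto simp: sets_restrict_space_iff)
  show "sets (pos_variation U \<mu>) = ?R" "sets (neg_variation U \<mu>) = ?R"
    unfolding pos_variation_def neg_variation_def
    using sigma_algebra.sigma_sets_eq[OF sa] Pow by (simp_all add: sets_measure_of)
  have av: "\<bar>\<mu> B\<bar> \<le> variation \<mu> B" if "B \<in> ?R" for B
    using that U by (intro abs_le_variation[OF bd e U]) (auto simp: sets_restrict_space_iff)
  have "variation \<mu> {} \<le> 0"
  proof (rule variation_least)
    fix D :: "'a set set" assume "partition_on {} D"
    then have "D = {}" by (auto simp: partition_on_def)
    then show "(\<Sum>B\<in>D. \<bar>\<mu> B\<bar>) \<le> 0" by simp
  qed simp
  then have v0: "variation \<mu> {} = 0" using av[of "{}"] by simp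
  have ca: "countably_additive ?R (\<lambda>A. ennreal ((variation \<mu> A + k * \<mu> A) / 2))"
    if k: "\<bar>k\<bar> = 1" for k :: real
  proof (rule countably_additiveI)
    fix A :: "nat \<Rightarrow> _" assume A: "range A \<subseteq> ?R" "disjoint_family A" "(\<Union>i. A i) \<in> ?R"
    have "(\<lambda>i. \<mu> (A i)) sums \<mu> (\<Union>i. A i)" using A by (intro signed_radon_sums[OF \<mu>]) auto
    then have "(\<lambda>i. (variation \<mu> (A i) + k * \<mu> (A i)) / 2) sums
        ((variation \<mu> (\<Union>i. A i) + k * \<mu> (\<Union>i. A i)) / 2)"
      by (intro sums_divide sums_add variation_sums_Union[OF \<mu> U A(1,2)] sums_mult)
    moreover have "0 \<le> (variation \<mu> (A i) + k * \<mu> (A i)) / 2" for i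
    proof -
      have "\<bar>k * \<mu> (A i)\<bar> \<le> variation \<mu> (A i)" using av[of "A i"] A(1) k by (auto simp: abs_mult)
      then have "- (k * \<mu> (A i)) \<le> variation \<mu> (A i)" by (rule abs_le_D2)
      then show ?thesis by simp
    qed
    ultimately show "(\<Sum>i. ennreal ((variation \<mu> (A i) + k * \<mu> (A i)) / 2)) =
        ennreal ((variation \<mu> (\<Union>i. A i) + k * \<mu> (\<Union>i. A i)) / 2)"
      by (intro suminf_ennreal_eq)
  qed
  show "emeasure (pos_variation U \<mu>) A = ennreal ((variation \<mu> A + \<mu> A) / 2)" if "A \<in> ?R"
    unfolding pos_variation_def using ca[of 1] that
    by (intro emeasure_measure_of_sigma[OF sa]) (auto simp: positive_def v0 e)
  show "emeasure (neg_variation U \<mu>) A = ennreal ((variation \<mu> A - \<mu> A) / 2)" if "A \<in> ?R"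
    unfolding neg_variation_def using ca[of "-1"] that
    by (intro emeasure_measure_of_sigma[OF sa]) (auto simp: positive_def v0 e)
qed

section \<open>Integration against a signed measure\<close>

lemma
  assumes \<mu>: "\<mu> \<in> signed_radon U" and U: "U \<in> sets borel"
  shows space_pos_variation: "space (pos_variation U \<mu>) = U"
    and space_neg_variation: "space (neg_variation U \<mu>) = U"
    and finite_measure_pos_variation: "finite_measure (pos_variation U \<mu>)"
    and finite_measure_neg_variation: "finite_measure (neg_variation U \<mu>)"
    and measure_pos_variation: "A \<in> sets (restrict_space borel U) \<Longrightarrow>
      measure (pos_variation U \<mu>) A = (variation \<mu> A + \<mu> A) / 2"
    and measure_neg_variation: "A \<in> sets (restrict_space borel U) \<Longrightarrow>
      measure (neg_variation U \<mu>) A = (variation \<mu> A - \<mu> A) / 2"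
proof -
  have bd: "bdd_above (variation_sums \<mu> U)" and e: "\<mu> {} = 0"
    using \<mu> signed_radon_empty[OF \<mu>] by (auto simp: signed_radon_def)
  show sp: "space (pos_variation U \<mu>) = U" "space (neg_variation U \<mu>) = U"
    using sets_eq_imp_space_eq[OF sets_pos_variation[OF assms]]
      sets_eq_imp_space_eq[OF sets_neg_variation[OF assms]] by (auto simp: space_restrict_space)
  have UR: "U \<in> sets (restrict_space borel U)" using U by (simp add: sets_restrict_space_iff)
  show "finite_measure (pos_variation U \<mu>)" "finite_measure (neg_variation U \<mu>)"
    using emeasure_pos_variation[OF assms UR] emeasure_neg_variation[OF assms UR] sp
    by (auto intro!: finite_measureI)
  have av: "\<bar>\<mu> B\<bar> \<le> variation \<mu> B" if "B \<in> sets (restrict_space borel U)" for B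
    using that U by (intro abs_le_variation[OF bd e U]) (auto simp: sets_restrict_space_iff)
  show "measure (pos_variation U \<mu>) A = (variation \<mu> A + \<mu> A) / 2"
    if "A \<in> sets (restrict_space borel U)"
    using emeasure_pos_variation[OF assms that] av[OF that] by (simp add: measure_def)
  show "measure (neg_variation U \<mu>) A = (variation \<mu> A - \<mu> A) / 2"
    if "A \<in> sets (restrict_space borel U)"
    using emeasure_neg_variation[OF assms that] av[OF that] by (simp add: measure_def)
qed

lemma
  assumes \<mu>: "\<mu> \<in> signed_radon U" and U: "U \<in> sets borel"
    and \<phi>: "\<phi> \<in> borel_measurable borel" "\<And>y. y \<in> U \<Longrightarrow> \<bar>\<phi> y\<bar> \<le> B"
  shows integrable_pos_variation: "integrable (pos_variation U \<mu>) \<phi>"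
    and integrable_neg_variation: "integrable (neg_variation U \<mu>) \<phi>"
    and abs_signed_integral_le: "\<bar>signed_integral U \<mu> \<phi>\<bar> \<le> B * variation \<mu> U"
proof -
  interpret p: finite_measure "pos_variation U \<mu>" by (rule finite_measure_pos_variation[OF \<mu> U])
  interpret n: finite_measure "neg_variation U \<mu>" by (rule finite_measure_neg_variation[OF \<mu> U])
  have UR: "U \<in> sets (restrict_space borel U)" using U by (simp add: sets_restrict_space_iff)
  have m: "\<phi> \<in> borel_measurable (pos_variation U \<mu>)" "\<phi> \<in> borel_measurable (neg_variation U \<mu>)"
    using measurable_restrict_space1[OF \<phi>(1), of U]
    by (simp_all add: measurable_cong_sets[OF sets_pos_variation[OF \<mu> U] refl]
        measurable_cong_sets[OF sets_neg_variation[OF \<mu> U] refl])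
  show ip: "integrable (pos_variation U \<mu>) \<phi>"
    using m \<phi> by (intro p.integrable_const_bound[of _ B]) (auto simp: space_pos_variation[OF \<mu> U])
  show "integrable (neg_variation U \<mu>) \<phi>"
    using m \<phi> by (intro n.integrable_const_bound[of _ B]) (auto simp: space_neg_variation[OF \<mu> U])
  note in' = this
  have "\<bar>\<integral>y. \<phi> y \<partial>pos_variation U \<mu>\<bar> \<le> (\<integral>y. B \<partial>pos_variation U \<mu>)"
    using ip \<phi> by (intro order.trans[OF integral_abs_bound] integral_mono)
      (auto simp: space_pos_variation[OF \<mu> U])
  also have "\<dots> = B * ((variation \<mu> U + \<mu> U) / 2)"
    using measure_pos_variation[OF \<mu> U UR] by (simp add: space_pos_variation[OF \<mu> U] mult.commute)
  finally have 1: "\<bar>\<integral>y. \<phi> y \<partial>pos_variation U \<mu>\<bar> \<le> B * ((variation \<mu> U + \<mu> U) / 2)" .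
  have "\<bar>\<integral>y. \<phi> y \<partial>neg_variation U \<mu>\<bar> \<le> (\<integral>y. B \<partial>neg_variation U \<mu>)"
    using in' \<phi> by (intro order.trans[OF integral_abs_bound] integral_mono)
      (auto simp: space_neg_variation[OF \<mu> U])
  also have "\<dots> = B * ((variation \<mu> U - \<mu> U) / 2)"
    using measure_neg_variation[OF \<mu> U UR] by (simp add: space_neg_variation[OF \<mu> U] mult.commute)
  finally have 2: "\<bar>\<integral>y. \<phi> y \<partial>neg_variation U \<mu>\<bar> \<le> B * ((variation \<mu> U - \<mu> U) / 2)" .
  \<comment> \<open>The masses of the two Jordan parts add up to the total variation, so no factor 2
    is lost.\<close>
  have "B * ((variation \<mu> U + \<mu> U) / 2) + B * ((variation \<mu> U - \<mu> U) / 2) = B * variation \<mu> U"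
    by (simp add: field_simps)
  with 1 2 show "\<bar>signed_integral U \<mu> \<phi>\<bar> \<le> B * variation \<mu> U"
    unfolding signed_integral_def by linarith
qed

lemma signed_integral_diff_le:
  assumes \<mu>: "\<mu> \<in> signed_radon U" and U: "U \<in> sets borel"
    and \<phi>: "\<phi> \<in> borel_measurable borel" "\<And>y. y \<in> U \<Longrightarrow> \<bar>\<phi> y\<bar> \<le> B"
    and \<psi>: "\<psi> \<in> borel_measurable borel" "\<And>y. y \<in> U \<Longrightarrow> \<bar>\<psi> y\<bar> \<le> C"
    and e: "\<And>y. y \<in> U \<Longrightarrow> \<bar>\<phi> y - \<psi> y\<bar> \<le> e"
  shows "\<bar>signed_integral U \<mu> \<phi> - signed_integral U \<mu> \<psi>\<bar> \<le> e * variation \<mu> U"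
proof -
  have "signed_integral U \<mu> \<phi> - signed_integral U \<mu> \<psi> = signed_integral U \<mu> (\<lambda>y. \<phi> y - \<psi> y)"
    unfolding signed_integral_def
    using integrable_pos_variation[OF \<mu> U \<phi>] integrable_pos_variation[OF \<mu> U \<psi>]
      integrable_neg_variation[OF \<mu> U \<phi>] integrable_neg_variation[OF \<mu> U \<psi>] by simp
  moreover have "\<bar>\<dots>\<bar> \<le> e * variation \<mu> U"
    using \<phi>(1) \<psi>(1) e by (intro abs_signed_integral_le[OF \<mu> U]) auto
  ultimately show ?thesis by simp
qed

text \<open>The variation terms of the two Jordan parts cancel on each level set. What remains is
  manifestly linear in \<open>\<mu>\<close>, which the definition of \<open>signed_integral\<close>
  is not.\<close>

lemma signed_integral_step:
  assumes \<mu>: "\<mu> \<in> signed_radon U" and U: "U \<in> sets borel"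
    and J: "finite J" and k: "k \<in> measurable borel (count_space UNIV)" "\<And>y. y \<in> U \<Longrightarrow> k y \<in> J"
  shows "signed_integral U \<mu> (\<lambda>y. c (k y)) = (\<Sum>j\<in>J. c j * \<mu> {y\<in>U. k y = j})"
proof -
  interpret p: finite_measure "pos_variation U \<mu>" by (rule finite_measure_pos_variation[OF \<mu> U])
  interpret n: finite_measure "neg_variation U \<mu>" by (rule finite_measure_neg_variation[OF \<mu> U])
  define E where "E j = {y\<in>U. k y = j}" for j
  have E: "E j \<in> sets (restrict_space borel U)" for j
  proof -
    have "E j = U \<inter> (k -` {j} \<inter> space borel)" by (auto simp: E_def)
    then show ?thesis using U measurable_sets[OF k(1), of "{j}"]
      by (auto simp: sets_restrict_space_iff)
  qed
  have eq: "c (k y) = (\<Sum>j\<in>J. c j * indicator (E j) y)" if "y \<in> U" for y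
  proof -
    have "(\<Sum>j\<in>J. c j * indicator (E j) y) = (\<Sum>j\<in>J. if j = k y then c j else 0)"
      using that by (intro sum.cong) (auto simp: E_def indicator_def)
    then show ?thesis using J k(2)[OF that] by simp
  qed
  have Un: "E j \<inter> U = E j" for j by (auto simp: E_def)
  have "(\<integral>y. c (k y) \<partial>pos_variation U \<mu>) = (\<integral>y. (\<Sum>j\<in>J. c j * indicator (E j) y) \<partial>pos_variation U \<mu>)"
    by (intro Bochner_Integration.integral_cong eq) (auto simp: space_pos_variation[OF \<mu> U])
  also have "\<dots> = (\<Sum>j\<in>J. c j * ((variation \<mu> (E j) + \<mu> (E j)) / 2))"
    using E by (subst Bochner_Integration.integral_sum)
      (auto simp: sets_pos_variation[OF \<mu> U] measure_pos_variation[OF \<mu> U] space_pos_variation[OF \<mu> U]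
        Un less_top[symmetric] intro!: integrable_mult_right integrable_real_indicator)
  finally have 1: "(\<integral>y. c (k y) \<partial>pos_variation U \<mu>) = (\<Sum>j\<in>J. c j * ((variation \<mu> (E j) + \<mu> (E j)) / 2))" .
  have "(\<integral>y. c (k y) \<partial>neg_variation U \<mu>) = (\<integral>y. (\<Sum>j\<in>J. c j * indicator (E j) y) \<partial>neg_variation U \<mu>)"
    by (intro Bochner_Integration.integral_cong eq) (auto simp: space_neg_variation[OF \<mu> U])
  also have "\<dots> = (\<Sum>j\<in>J. c j * ((variation \<mu> (E j) - \<mu> (E j)) / 2))"
    using E by (subst Bochner_Integration.integral_sum)
      (auto simp: sets_neg_variation[OF \<mu> U] measure_neg_variation[OF \<mu> U] space_neg_variation[OF \<mu> U]
        Un less_top[symmetric] intro!: integrable_mult_right integrable_real_indicator)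
  finally have 2: "(\<integral>y. c (k y) \<partial>neg_variation U \<mu>) = (\<Sum>j\<in>J. c j * ((variation \<mu> (E j) - \<mu> (E j)) / 2))" .
  show ?thesis
    unfolding signed_integral_def 1 2 sum_subtractf[symmetric] E_def[symmetric]
    by (intro sum.cong) (auto simp: field_simps)
qed

lemma bdd_above_variation_sums_diff:
  assumes "bdd_above (variation_sums \<mu> U)" "bdd_above (variation_sums \<nu> U)"
  shows "bdd_above (variation_sums (\<lambda>A. \<mu> A - \<nu> A) U)"
proof -
  obtain c d where c: "\<And>s. s \<in> variation_sums \<mu> U \<Longrightarrow> s \<le> c" "\<And>s. s \<in> variation_sums \<nu> U \<Longrightarrow> s \<le> d"
    using assms by (auto simp: bdd_above_def)
  show ?thesis
  proof (rule bdd_aboveI[of _ "c + d"])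
    fix s assume "s \<in> variation_sums (\<lambda>A. \<mu> A - \<nu> A) U"
    then obtain D where D: "finite D" "partition_on U D" "D \<subseteq> sets borel" and s: "s = (\<Sum>B\<in>D. \<bar>\<mu> B - \<nu> B\<bar>)"
      by (auto simp: variation_sums_def)
    have "s \<le> (\<Sum>B\<in>D. \<bar>\<mu> B\<bar> + \<bar>\<nu> B\<bar>)" unfolding s by (intro sum_mono) simp
    also have "\<dots> \<le> c + d"
      unfolding sum.distrib using D by (intro add_mono c) (auto simp: variation_sums_def)
    finally show "s \<le> c + d" .
  qed
qed

lemma variation_triangle:
  assumes "bdd_above (variation_sums \<mu> U)" "bdd_above (variation_sums \<nu> U)" "U \<in> sets borel"
  shows "variation \<mu> U \<le> variation \<nu> U + variation (\<lambda>A. \<mu> A - \<nu> A) U"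
proof (rule variation_least[OF assms(3)])
  fix D assume D: "finite D" "partition_on U D" "D \<subseteq> sets borel"
  have "(\<Sum>B\<in>D. \<bar>\<mu> B\<bar>) \<le> (\<Sum>B\<in>D. \<bar>\<nu> B\<bar> + \<bar>\<mu> B - \<nu> B\<bar>)"
    by (intro sum_mono) simp
  also have "\<dots> \<le> variation \<nu> U + variation (\<lambda>A. \<mu> A - \<nu> A) U"
    unfolding sum.distrib variation_def
    using D assms(2) bdd_above_variation_sums_diff[OF assms(1,2)]
    by (intro add_mono cSup_upper) (auto simp: variation_sums_def)
  finally show "(\<Sum>B\<in>D. \<bar>\<mu> B\<bar>) \<le> variation \<nu> U + variation (\<lambda>A. \<mu> A - \<nu> A) U" .
qed

text \<open>Rounding \<open>\<phi>\<close> down to multiples of \<open>e\<close> reduces the claim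
  to step functions, where the difference is a finite sum of values of \<open>\<mu> - \<nu>\<close>
  on disjoint level sets; then \<open>e\<close> tends to 0. Only bounded variation of
  \<open>\<mu> - \<nu>\<close> is used, so its Jordan decomposition never has to be formed.\<close>

lemma signed_integral_Lipschitz:
  assumes \<mu>: "\<mu> \<in> signed_radon U" and \<nu>: "\<nu> \<in> signed_radon U" and U: "U \<in> sets borel"
    and \<phi>: "\<phi> \<in> borel_measurable borel" "\<And>y. \<bar>\<phi> y\<bar> \<le> B"
  shows "\<bar>signed_integral U \<mu> \<phi> - signed_integral U \<nu> \<phi>\<bar> \<le> B * tv_dist U \<mu> \<nu>"
proof -
  let ?\<kappa> = "\<lambda>A. \<mu> A - \<nu> A"
  have bd: "bdd_above (variation_sums \<mu> U)" "bdd_above (variation_sums \<nu> U)"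
    and e: "\<mu> {} = 0" "\<nu> {} = 0"
    using \<mu> \<nu> signed_radon_empty[OF \<mu>] signed_radon_empty[OF \<nu>] by (auto simp: signed_radon_def)
  note bk = bdd_above_variation_sums_diff[OF bd]
  have B0: "0 \<le> B" using \<phi>(2)[of undefined] by simp
  have est: "\<bar>signed_integral U \<mu> \<phi> - signed_integral U \<nu> \<phi>\<bar> \<le>
      B * variation ?\<kappa> U + e * (variation ?\<kappa> U + variation \<mu> U + variation \<nu> U)"
    if e0: "e > 0" for e :: real
  proof -
    define k where "k y = \<lfloor>\<phi> y / e\<rfloor>" for y
    \<comment> \<open>Boundedness of \<open>\<phi>\<close> leaves finitely many labels; rounding
      down can push a value below \<open>- B\<close> by at most \<open>e\<close>, whence the bound
      \<open>B + e\<close>.\<close>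
    define J where "J = {\<lfloor>- B / e\<rfloor>..\<lfloor>B / e\<rfloor>}"
    define s where "s y = e * real_of_int (k y)" for y
    have k: "k \<in> measurable borel (count_space UNIV)"
      unfolding k_def using \<phi>(1) by measurable
    have kJ: "k y \<in> J" for y
    proof -
      have "- B / e \<le> \<phi> y / e" "\<phi> y / e \<le> B / e"
        using \<phi>(2)[of y] e0 by (auto simp: field_simps abs_le_iff)
      then show ?thesis unfolding k_def J_def by (auto intro: floor_mono)
    qed
    have sm: "s \<in> borel_measurable borel"
      unfolding s_def k_def using \<phi>(1) by measurable
    have diff: "\<bar>\<phi> y - s y\<bar> \<le> e" for y
    proof -
      have "real_of_int (k y) \<le> \<phi> y / e" "\<phi> y / e < real_of_int (k y) + 1"
        unfolding k_def by linarith+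
      then have "s y \<le> \<phi> y" "\<phi> y \<le> s y + e"
        using e0 by (auto simp: s_def field_simps)
      then show ?thesis by simp
    qed
    have s_bd: "\<bar>s y\<bar> \<le> B + e" for y using diff[of y] \<phi>(2)[of y] by linarith
    have J_bd: "\<bar>e * real_of_int j\<bar> \<le> B + e" if "j \<in> J" for j
    proof -
      have "real_of_int \<lfloor>- B / e\<rfloor> \<le> j" "j \<le> real_of_int \<lfloor>B / e\<rfloor>"
        using that by (auto simp: J_def)
      then have "- B / e - 1 \<le> j" "j \<le> B / e" by linarith+
      then have "- B - e \<le> e * j" "e * j \<le> B" using e0 by (auto simp: field_simps)
      then show ?thesis using e0 by linarith
    qed
    define E where "E j = {y\<in>U. k y = j}" for j
    have E: "E j \<in> sets borel" for j
    proof -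
      have "E j = U \<inter> (k -` {j} \<inter> space borel)" by (auto simp: E_def)
      then show ?thesis using U measurable_sets[OF k, of "{j}"] by auto
    qed
    have "signed_integral U \<mu> s - signed_integral U \<nu> s = (\<Sum>j\<in>J. e * real_of_int j * ?\<kappa> (E j))"
      using signed_integral_step[OF \<mu> U _ k kJ, of "\<lambda>j. e * real_of_int j"]
        signed_integral_step[OF \<nu> U _ k kJ, of "\<lambda>j. e * real_of_int j"]
      by (simp add: J_def s_def[abs_def] E_def sum_subtractf[symmetric] right_diff_distrib)
    also have "\<bar>\<dots>\<bar> \<le> (\<Sum>j\<in>J. (B + e) * \<bar>?\<kappa> (E j)\<bar>)"
      by (intro order.trans[OF sum_abs] sum_mono) (auto simp only: abs_mult[of _ "?\<kappa> _"] intro!: mult_right_mono J_bd)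
    also have "\<dots> = (B + e) * (\<Sum>j\<in>J. \<bar>?\<kappa> (E j)\<bar>)" by (simp add: sum_distrib_left)
    also have "(\<Sum>j\<in>J. \<bar>?\<kappa> (E j)\<bar>) \<le> variation ?\<kappa> U"
      using U E by (intro sum_abs_le_variation[OF bk _ U U])
        (auto simp: e J_def disjoint_family_on_def E_def)
    finally have 1: "\<bar>signed_integral U \<mu> s - signed_integral U \<nu> s\<bar> \<le> (B + e) * variation ?\<kappa> U"
      using B0 e0 by (simp add: mult_left_mono)
    have 2: "\<bar>signed_integral U \<mu> \<phi> - signed_integral U \<mu> s\<bar> \<le> e * variation \<mu> U"
      using \<phi> s_bd diff by (intro signed_integral_diff_le[OF \<mu> U _ _ sm]) auto
    have 3: "\<bar>signed_integral U \<nu> \<phi> - signed_integral U \<nu> s\<bar> \<le> e * variation \<nu> U"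
      using \<phi> s_bd diff by (intro signed_integral_diff_le[OF \<nu> U _ _ sm]) auto
    from 1 2 3 show ?thesis by (simp add: algebra_simps)
  qed
  have "\<bar>signed_integral U \<mu> \<phi> - signed_integral U \<nu> \<phi>\<bar> \<le> B * variation ?\<kappa> U"
  proof (rule tendsto_lowerbound)
    let ?g = "\<lambda>e. B * variation ?\<kappa> U + e * (variation ?\<kappa> U + variation \<mu> U + variation \<nu> U)"
    have "(?g \<longlongrightarrow> B * variation ?\<kappa> U + 0 * (variation ?\<kappa> U + variation \<mu> U + variation \<nu> U)) (at_right 0)"
      by (intro tendsto_intros)
    then show "(?g \<longlongrightarrow> B * variation ?\<kappa> U) (at_right 0)" by simp
    show "\<forall>\<^sub>F e in at_right 0. \<bar>signed_integral U \<mu> \<phi> - signed_integral U \<nu> \<phi>\<bar> \<le> ?g e"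
      using eventually_at_right_less by (rule eventually_mono) (rule est)
  qed simp
  then show ?thesis using \<mu> \<nu> by (simp add: tv_dist_def)
qed

section \<open>The random potential\<close>

lemma
  fixes f :: "'a::euclidean_space \<Rightarrow>\<^sub>C real"
  assumes U: "U \<in> sets borel" and \<mu>: "\<mu> \<in> signed_radon U"
  shows abs_potential_le: "\<bar>potential U f \<mu> x\<bar> \<le> norm f * tv_norm U \<mu>"
    and potential_diff_le: "(\<And>y. y \<in> U \<Longrightarrow> \<bar>apply_bcontfun f (x - y) - apply_bcontfun f (x' - y)\<bar> \<le> e) \<Longrightarrow>
      \<bar>potential U f \<mu> x - potential U f \<mu> x'\<bar> \<le> e * tv_norm U \<mu>"
    and potential_Lipschitz: "\<nu> \<in> signed_radon U \<Longrightarrow>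
      \<bar>potential U f \<mu> x - potential U f \<nu> x\<bar> \<le> norm f * tv_dist U \<mu> \<nu>"
proof -
  have "continuous_on UNIV (\<lambda>y. apply_bcontfun f (z - y))" for z
    by (rule continuous_on_compose2[OF continuous_on_apply_bcontfun[of UNIV f]])
      (auto intro!: continuous_intros)
  then have m: "(\<lambda>y. apply_bcontfun f (z - y)) \<in> borel_measurable borel" for z
    by (rule borel_measurable_continuous_onI)
  have b: "\<bar>apply_bcontfun f (z - y)\<bar> \<le> norm f" for z y
    using norm_bounded[of f "z - y"] by simp
  show "\<bar>potential U f \<mu> x\<bar> \<le> norm f * tv_norm U \<mu>"
    unfolding potential_def by (rule abs_signed_integral_le[OF \<mu> U m b])
  show "\<bar>potential U f \<mu> x - potential U f \<mu> x'\<bar> \<le> e * tv_norm U \<mu>"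
    if "\<And>y. y \<in> U \<Longrightarrow> \<bar>apply_bcontfun f (x - y) - apply_bcontfun f (x' - y)\<bar> \<le> e"
    unfolding potential_def by (rule signed_integral_diff_le[OF \<mu> U m b m b that])
  show "\<bar>potential U f \<mu> x - potential U f \<nu> x\<bar> \<le> norm f * tv_dist U \<mu> \<nu>" if "\<nu> \<in> signed_radon U"
    unfolding potential_def by (rule signed_integral_Lipschitz[OF \<mu> that U m b])
qed

text \<open>All differences \<open>x - y\<close> of points of \<open>U\<close> lie in the compact
  ball of radius \<open>2 * R\<close>, where \<open>f\<close> is uniformly continuous. The resulting
  \<open>d\<close> depends on \<open>f\<close>, \<open>U\<close> and \<open>e\<close> but not on
  \<open>\<mu>\<close>.\<close>

lemma potential_equicontinuous:
  fixes f :: "'a::euclidean_space \<Rightarrow>\<^sub>C real"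
  assumes U: "U \<in> sets borel" "bounded U" and e: "0 < e"
  shows "\<exists>d>0. \<forall>\<mu>\<in>signed_radon U. \<forall>x\<in>U. \<forall>x'\<in>U. dist x x' < d \<longrightarrow>
    \<bar>potential U f \<mu> x - potential U f \<mu> x'\<bar> \<le> e * tv_norm U \<mu>"
proof -
  obtain R where R: "\<And>x. x \<in> U \<Longrightarrow> norm x \<le> R" using U(2) by (auto simp: bounded_iff)
  have "uniformly_continuous_on (cball 0 (2 * R)) (apply_bcontfun f)"
    by (intro compact_uniformly_continuous continuous_on_apply_bcontfun) auto
  then obtain d where d: "d > 0"
    "\<And>z z'. z \<in> cball 0 (2 * R) \<Longrightarrow> z' \<in> cball 0 (2 * R) \<Longrightarrow> dist z' z < d \<Longrightarrow>
      dist (apply_bcontfun f z') (apply_bcontfun f z) < e"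
    using e by (fastforce simp: uniformly_continuous_on_def)
  have "\<bar>potential U f \<mu> x - potential U f \<mu> x'\<bar> \<le> e * tv_norm U \<mu>"
    if \<mu>: "\<mu> \<in> signed_radon U" and x: "x \<in> U" "x' \<in> U" "dist x x' < d" for \<mu> x x'
  proof (rule potential_diff_le[OF U(1) \<mu>])
    fix y assume y: "y \<in> U"
    have "norm (x - y) \<le> 2 * R" "norm (x' - y) \<le> 2 * R"
      using norm_triangle_ineq4[of x y] norm_triangle_ineq4[of x' y] R[OF x(1)] R[OF x(2)] R[OF y]
      by linarith+
    then have "dist (apply_bcontfun f (x - y)) (apply_bcontfun f (x' - y)) < e"
      using x(3) by (intro d(2)) (auto simp: dist_norm norm_minus_commute)
    then show "\<bar>apply_bcontfun f (x - y) - apply_bcontfun f (x' - y)\<bar> \<le> e"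
      by (simp add: dist_real_def)
  qed
  with d(1) show ?thesis by blast
qed

lemma continuous_on_potential:
  fixes f :: "'a::euclidean_space \<Rightarrow>\<^sub>C real"
  assumes U: "U \<in> sets borel" "bounded U" and \<mu>: "\<mu> \<in> signed_radon U"
  shows "continuous_on U (potential U f \<mu>)"
  unfolding continuous_on_iff
proof (intro ballI allI impI)
  fix x and e :: real assume x: "x \<in> U" and e: "0 < e"
  \<comment> \<open>Adding 1 keeps the divisor positive and makes the final inequality
    strict.\<close>
  let ?v = "\<bar>tv_norm U \<mu>\<bar> + 1"
  obtain d where d: "d > 0" "\<And>x'. x' \<in> U \<Longrightarrow> dist x x' < d \<Longrightarrow>
      \<bar>potential U f \<mu> x - potential U f \<mu> x'\<bar> \<le> e / ?v * tv_norm U \<mu>"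
    using potential_equicontinuous[OF U, of "e / ?v" f] e \<mu> x by auto
  have "e / ?v * tv_norm U \<mu> < e" using e by (simp add: field_simps) (smt (verit) mult_less_cancel_left)
  with d show "\<exists>d>0. \<forall>x'\<in>U. dist x' x < d \<longrightarrow> dist (potential U f \<mu> x') (potential U f \<mu> x) < e"
    by (intro exI[of _ d]) (force simp: dist_real_def dist_commute)
qed

text \<open>Superlevel sets of a continuous function are open, and every norm-open set is among the
  generators; separability plays no part in this direction.\<close>

lemma Lipschitz_measurable_borel_signed_radon:
  assumes U: "U \<in> sets borel" and L: "0 \<le> L"
    and F: "\<And>\<mu> \<nu>. \<mu> \<in> signed_radon U \<Longrightarrow> \<nu> \<in> signed_radon U \<Longrightarrow> \<bar>F \<mu> - F \<nu>\<bar> \<le> L * tv_dist U \<mu> \<nu>"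
  shows "F \<in> borel_measurable (borel_signed_radon U)"
proof -
  interpret Metric_space "signed_radon U" "tv_dist U" by (rule Metric_space_signed_radon[OF U])
  have sub: "{S. openin mtopology S} \<subseteq> Pow (signed_radon U)"
    using openin_subset[of mtopology] by auto
  have "openin mtopology {\<mu> \<in> signed_radon U. a < F \<mu>}" for a :: real
    unfolding openin_mtopology
  proof (intro conjI allI impI)
    fix \<mu> assume "\<mu> \<in> {\<mu> \<in> signed_radon U. a < F \<mu>}"
    then have \<mu>: "\<mu> \<in> signed_radon U" "a < F \<mu>" by auto
    \<comment> \<open>The denominator \<open>L + 1\<close> gives a valid radius also for
      \<open>L = 0\<close>.\<close>
    have "\<nu> \<in> {\<mu> \<in> signed_radon U. a < F \<mu>}" if "\<nu> \<in> mball \<mu> ((F \<mu> - a) / (L + 1))" for \<nu>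
    proof -
      have \<nu>: "\<nu> \<in> signed_radon U" "tv_dist U \<mu> \<nu> < (F \<mu> - a) / (L + 1)" using that by auto
      have "L * tv_dist U \<mu> \<nu> \<le> (L + 1) * tv_dist U \<mu> \<nu>" using L by (intro mult_right_mono) auto
      also have "\<dots> < F \<mu> - a" using \<nu>(2) L by (simp add: field_simps)
      finally show ?thesis using F[OF \<mu>(1) \<nu>(1)] \<nu>(1) by auto
    qed
    then show "\<exists>r>0. mball \<mu> r \<subseteq> {\<mu> \<in> signed_radon U. a < F \<mu>}"
      using \<mu> L by (intro exI[of _ "(F \<mu> - a) / (L + 1)"]) auto
  qed auto
  then show ?thesis
    unfolding borel_measurable_iff_greater borel_signed_radon_def
    using sub by (auto simp: space_measure_of_conv sets_measure_of intro!: sigma_sets.Basic)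
qed

lemma space_borel_signed_radon: "space (borel_signed_radon U) = signed_radon U"
  by (simp add: borel_signed_radon_def space_measure_of_conv)

lemma potential_measurable:
  fixes f :: "'a::euclidean_space \<Rightarrow>\<^sub>C real"
  assumes "U \<in> sets borel"
  shows "(\<lambda>\<mu>. potential U f \<mu> x) \<in> borel_measurable (borel_signed_radon U)"
  using potential_Lipschitz[OF assms]
  by (intro Lipschitz_measurable_borel_signed_radon[OF assms, of "norm f"]) auto

lemma tv_norm_measurable:
  assumes U: "U \<in> sets borel"
  shows "tv_norm U \<in> borel_measurable (borel_signed_radon U)"
proof (rule Lipschitz_measurable_borel_signed_radon[OF assms, of 1])
  fix \<mu> \<nu> assume m: "\<mu> \<in> signed_radon U" "\<nu> \<in> signed_radon U"
  then have bd: "bdd_above (variation_sums \<mu> U)" "bdd_above (variation_sums \<nu> U)"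
    by (auto simp: signed_radon_def)
  have "variation (\<lambda>A. \<mu> A - \<nu> A) U = variation (\<lambda>A. \<nu> A - \<mu> A) U"
    by (simp add: variation_def variation_sums_def abs_minus_commute)
  then show "\<bar>tv_norm U \<mu> - tv_norm U \<nu>\<bar> \<le> 1 * tv_dist U \<mu> \<nu>"
    using variation_triangle[OF bd U] variation_triangle[OF bd(2,1) U] m by (simp add: tv_dist_def)
qed simp

section \<open>Second order symmetric polynomials on a ball\<close>

lemma integral_lborel_uminus:
  fixes F :: "'a::euclidean_space \<Rightarrow> real"
  assumes "F \<in> borel_measurable borel"
  shows "(\<integral>h. F (- h) \<partial>lborel) = (\<integral>h. F h \<partial>lborel)"
proof -
  have "lborel = distr lborel borel (\<lambda>x::'a. - x)"
    using lborel_affine[of "-1" "0::'a"] by (simp add: density_1)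
  then have "(\<integral>h. F h \<partial>lborel) = (\<integral>h. F h \<partial>distr lborel borel (\<lambda>x::'a. - x))" by simp
  also have "\<dots> = (\<integral>h. F (- h) \<partial>lborel)"
    using assms by (intro integral_distr) auto
  finally show ?thesis by simp
qed

lemma integral_ball_odd:
  fixes F :: "'a::euclidean_space \<Rightarrow> real"
  assumes "F \<in> borel_measurable borel" "\<And>h. F (- h) = - F h"
  shows "(\<integral>h. indicator (cball 0 r) h * F h \<partial>lborel) = 0"
proof -
  have "(\<integral>h. indicator (cball 0 r) h * F h \<partial>lborel) =
      (\<integral>h. indicator (cball 0 r) (- h) * F (- h) \<partial>lborel)"
    using assms(1) by (intro integral_lborel_uminus[symmetric] borel_measurable_times
        borel_measurable_indicator) auto
  also have "\<dots> = - (\<integral>h. indicator (cball 0 r) h * F h \<partial>lborel)"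
    by (simp add: assms(2) indicator_def)
  finally show ?thesis by simp
qed

text \<open>Reflection of the coordinate \<open>i\<close> preserves Lebesgue measure and the ball
  but flips the sign of the product.\<close>

lemma integral_ball_mixed_moment:
  fixes i j :: "'a::euclidean_space"
  assumes "i \<in> Basis" "j \<in> Basis" "i \<noteq> j"
  shows "(\<integral>h. indicator (cball 0 r) h * ((h \<bullet> i) * (h \<bullet> j)) \<partial>lborel) = 0"
proof -
  define c where "c b = (if b = i then -1 else 1 :: real)" for b :: 'a
  define T where "T x = (\<Sum>b\<in>Basis. (c b * (x \<bullet> b)) *\<^sub>R b)" for x :: 'a
  have "(\<Prod>b\<in>Basis. \<bar>c b\<bar>) = 1" by (intro prod.neutral) (auto simp: c_def)
  then have lT: "lborel = distr lborel borel T"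
    using lborel_affine_euclidean[of c 0] by (simp add: c_def T_def[abs_def] density_1)
  have Tb: "T x \<bullet> b = c b * (x \<bullet> b)" if "b \<in> Basis" for x b
    using that by (simp add: T_def inner_sum_left inner_Basis if_distrib[where f="\<lambda>z. _ * z"] cong: if_cong)
  have nT: "norm (T x) = norm x" for x
  proof -
    have "(T x \<bullet> b)\<^sup>2 = (x \<bullet> b)\<^sup>2" if "b \<in> Basis" for b
      using that by (simp add: Tb c_def)
    then show ?thesis by (simp add: norm_eq_sqrt_inner euclidean_inner[of "T x" "T x"]
          euclidean_inner[of x x] flip: power2_eq_square)
  qed
  have Tm: "T \<in> borel_measurable borel"
    unfolding T_def by measurable
  have "(\<integral>h. indicator (cball 0 r) h * ((h \<bullet> i) * (h \<bullet> j)) \<partial>lborel) =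
      (\<integral>h. indicator (cball 0 r) h * ((h \<bullet> i) * (h \<bullet> j)) \<partial>distr lborel borel T)"
    using lT by simp
  also have "\<dots> = (\<integral>h. indicator (cball 0 r) (T h) * ((T h \<bullet> i) * (T h \<bullet> j)) \<partial>lborel)"
    using Tm by (intro integral_distr borel_measurable_times borel_measurable_indicator
        borel_measurable_power) auto
  also have "\<dots> = - (\<integral>h. indicator (cball 0 r) h * ((h \<bullet> i) * (h \<bullet> j)) \<partial>lborel)"
    using assms by (simp add: Tb nT c_def indicator_def)
  finally show ?thesis by simp
qed

text \<open>Exchange of the coordinates \<open>i\<close> and \<open>j\<close> preserves norms, and
  it preserves Lebesgue measure because the preimage of a box is the box with permuted
  corners.\<close>

lemma integral_ball_square_moment_eq:
  fixes i j :: "'a::euclidean_space"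
  assumes "i \<in> Basis" "j \<in> Basis"
  shows "(\<integral>h. indicator (cball 0 r) h * (h \<bullet> i)\<^sup>2 \<partial>lborel) =
    (\<integral>h. indicator (cball 0 r) h * (h \<bullet> j)\<^sup>2 \<partial>lborel)"
proof -
  define \<pi> where "\<pi> b = (if b = i then j else if b = j then i else b)" for b :: 'a
  have \<pi>: "\<pi> b \<in> Basis" "\<pi> (\<pi> b) = b" if "b \<in> Basis" for b
    using that assms by (auto simp: \<pi>_def)
  have bij: "bij_betw \<pi> Basis Basis"
    by (rule bij_betw_byWitness[where f'=\<pi>]) (use \<pi> in auto)
  define T where "T x = (\<Sum>b\<in>Basis. (x \<bullet> \<pi> b) *\<^sub>R b)" for x :: 'a
  have Tb: "T x \<bullet> b = x \<bullet> \<pi> b" if "b \<in> Basis" for x b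
    using that by (simp add: T_def inner_sum_left inner_Basis if_distrib[where f="\<lambda>z. _ * z"] cong: if_cong)
  have nT: "norm (T x) = norm x" for x
    using sum.reindex_bij_betw[OF bij, of "\<lambda>b. (x \<bullet> b) * (x \<bullet> b)"]
    by (simp add: norm_eq_sqrt_inner euclidean_inner[of "T x" "T x"] euclidean_inner[of x x] Tb)
  have Tm: "T \<in> borel_measurable borel"
    unfolding T_def by measurable
  have lT: "lborel = distr lborel borel T"
  proof (rule lborel_eqI)
    fix l u :: 'a assume le: "\<And>b. b \<in> Basis \<Longrightarrow> l \<bullet> b \<le> u \<bullet> b"
    have "T x \<in> box l u \<longleftrightarrow> x \<in> box (T l) (T u)" for x
    proof -
      have "T x \<in> box l u \<longleftrightarrow> (\<forall>b\<in>Basis. l \<bullet> b < x \<bullet> \<pi> b \<and> x \<bullet> \<pi> b < u \<bullet> b)"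
        by (simp add: mem_box Tb)
      also have "\<dots> \<longleftrightarrow> (\<forall>b\<in>Basis. l \<bullet> \<pi> b < x \<bullet> b \<and> x \<bullet> b < u \<bullet> \<pi> b)"
        using \<pi> by metis
      finally show ?thesis by (simp add: mem_box Tb)
    qed
    then have "T -` box l u \<inter> space lborel = box (T l) (T u)" by auto
    then have "emeasure (distr lborel borel T) (box l u) = emeasure lborel (box (T l) (T u))"
      using Tm by (subst emeasure_distr) auto
    also have "\<dots> = (\<Prod>b\<in>Basis. (T u - T l) \<bullet> b)"
      using le \<pi> by (intro emeasure_lborel_box) (simp add: Tb)
    also have "(\<Prod>b\<in>Basis. (T u - T l) \<bullet> b) = (\<Prod>b\<in>Basis. (u - l) \<bullet> \<pi> b)"
      by (intro prod.cong) (auto simp: inner_diff_left Tb)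
    also have "\<dots> = (\<Prod>b\<in>Basis. (u - l) \<bullet> b)"
      using prod.reindex_bij_betw[OF bij, of "\<lambda>b. (u - l) \<bullet> b"] by simp
    finally show "emeasure (distr lborel borel T) (box l u) = (\<Prod>b\<in>Basis. (u - l) \<bullet> b)" .
  qed simp
  have "(\<integral>h. indicator (cball 0 r) h * (h \<bullet> j)\<^sup>2 \<partial>lborel) =
      (\<integral>h. indicator (cball 0 r) h * (h \<bullet> j)\<^sup>2 \<partial>distr lborel borel T)"
    using lT by simp
  also have "\<dots> = (\<integral>h. indicator (cball 0 r) (T h) * (T h \<bullet> j)\<^sup>2 \<partial>lborel)"
    using Tm by (intro integral_distr borel_measurable_times borel_measurable_indicator
        borel_measurable_power) auto
  also have "\<dots> = (\<integral>h. indicator (cball 0 r) h * (h \<bullet> i)\<^sup>2 \<partial>lborel)"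
    using assms by (simp add: Tb nT indicator_def \<pi>_def)
  finally show ?thesis by simp
qed

lemma integrable_cball_continuous:
  fixes F :: "'a::euclidean_space \<Rightarrow> real"
  assumes "continuous_on (cball a r) F"
  shows "integrable lborel (\<lambda>h. indicator (cball a r) h * F h)"
  using borel_integrable_compact[OF compact_cball assms] by simp

text \<open>In the coordinate expansion the mixed moments vanish and all square moments agree, while
  \<open>(norm h)\<^sup>2\<close> collects \<open>DIM('a)\<close> of them. Hence a trace-free
  quadratic form has mean zero over the ball.\<close>

lemma integral_ball_inner_square:
  fixes a :: "'a::euclidean_space"
  shows "(\<integral>h. indicator (cball 0 r) h * (a \<bullet> h)\<^sup>2 \<partial>lborel) =
    (norm a)\<^sup>2 / DIM('a) * (\<integral>h. indicator (cball (0::'a) r) h * (norm h)\<^sup>2 \<partial>lborel)"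
proof -
  let ?I = "\<lambda>F. \<integral>h. indicator (cball (0::'a) r) h * F h \<partial>lborel"
  have int: "integrable lborel (\<lambda>h::'a. indicator (cball 0 r) h * F h)" if "continuous_on UNIV F" for F :: "'a \<Rightarrow> real"
    by (rule integrable_cball_continuous[OF continuous_on_subset[OF that subset_UNIV]])
  obtain e :: 'a where e: "e \<in> Basis" using nonempty_Basis by blast
  define m where "m = ?I (\<lambda>h. (h \<bullet> e)\<^sup>2)"
  have m: "?I (\<lambda>h. (h \<bullet> b) * (h \<bullet> b)) = m" if "b \<in> Basis" for b
    using integral_ball_square_moment_eq[OF that e] by (simp add: m_def power2_eq_square)
  have "?I (\<lambda>h. (norm h)\<^sup>2) = (\<integral>h. (\<Sum>b\<in>Basis. indicator (cball (0::'a) r) h * ((h \<bullet> b) * (h \<bullet> b))) \<partial>lborel)"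
  proof (intro Bochner_Integration.integral_cong refl)
    fix h :: 'a
    have "(norm h)\<^sup>2 = (\<Sum>b\<in>Basis. (h \<bullet> b) * (h \<bullet> b))"
      unfolding power2_norm_eq_inner by (rule euclidean_inner)
    then show "indicator (cball 0 r) h * (norm h)\<^sup>2 =
        (\<Sum>b\<in>Basis. indicator (cball 0 r) h * ((h \<bullet> b) * (h \<bullet> b)))"
      by (simp only: sum_distrib_left)
  qed
  also have "\<dots> = (\<Sum>b\<in>(Basis :: 'a set). ?I (\<lambda>h. (h \<bullet> b) * (h \<bullet> b)))"
    by (intro Bochner_Integration.integral_sum int) (auto intro!: continuous_intros)
  also have "\<dots> = DIM('a) * m" by (simp add: m)
  finally have S: "?I (\<lambda>h. (norm h)\<^sup>2) = DIM('a) * m" .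
  have "?I (\<lambda>h. (a \<bullet> h)\<^sup>2) = (\<integral>h. (\<Sum>b\<in>Basis. \<Sum>b'\<in>Basis.
      (a \<bullet> b) * (a \<bullet> b') * (indicator (cball (0::'a) r) h * ((h \<bullet> b) * (h \<bullet> b')))) \<partial>lborel)"
  proof (intro Bochner_Integration.integral_cong refl)
    fix h :: 'a
    have "(a \<bullet> h)\<^sup>2 = (\<Sum>b\<in>Basis. \<Sum>b'\<in>Basis. (a \<bullet> b) * (h \<bullet> b) * ((a \<bullet> b') * (h \<bullet> b')))"
      unfolding power2_eq_square by (subst (1 2) euclidean_inner) (rule sum_product)
    then show "indicator (cball 0 r) h * (a \<bullet> h)\<^sup>2 = (\<Sum>b\<in>Basis. \<Sum>b'\<in>Basis.
        (a \<bullet> b) * (a \<bullet> b') * (indicator (cball 0 r) h * ((h \<bullet> b) * (h \<bullet> b'))))"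
      by (simp only: sum_distrib_left) (intro sum.cong refl, simp only: mult_ac)
  qed
  also have "\<dots> = (\<Sum>b\<in>Basis. \<Sum>b'\<in>Basis. (a \<bullet> b) * (a \<bullet> b') * ?I (\<lambda>h. (h \<bullet> b) * (h \<bullet> b')))"
    by (simp add: Bochner_Integration.integral_sum Bochner_Integration.integrable_sum
        integrable_mult_right int continuous_intros)
  also have "\<dots> = (\<Sum>b\<in>Basis. \<Sum>b'\<in>Basis. if b' = b then (a \<bullet> b) * (a \<bullet> b) * m else 0)"
    by (intro sum.cong refl) (auto simp: m integral_ball_mixed_moment)
  also have "\<dots> = (norm a)\<^sup>2 * m"
    by (simp add: power2_norm_eq_inner euclidean_inner[of a a] sum_distrib_right)
  finally show ?thesis unfolding S by simp
qed

lemma integral_ball_norm_square_pos: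
  assumes "0 < r"
  shows "0 < (\<integral>h. indicator (cball (0::'a::euclidean_space) r) h * (norm h)\<^sup>2 \<partial>lborel)"
proof -
  let ?F = "\<lambda>h::'a. indicator (cball 0 r) h * (norm h)\<^sup>2"
  have int: "integrable lborel ?F"
    by (intro integrable_cball_continuous continuous_intros)
  have "\<not> (AE h in lborel. ?F h = 0)"
  proof
    assume "AE h in lborel. ?F h = 0"
    moreover have "AE h in lborel. h \<noteq> (0::'a)" by (rule AE_lborel_singleton)
    ultimately have "AE h in lborel. h \<notin> cball (0::'a) r"
      by eventually_elim (auto simp: indicator_def split: if_splits)
    then have "emeasure lborel (cball (0::'a) r) = 0"
      by (subst (asm) AE_iff_measurable[of "cball 0 r"]) auto
    then show False using assms unit_ball_vol_pos[of "real DIM('a)"] by (simp add: emeasure_cball)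
  qed
  then have "(\<integral>h. ?F h \<partial>lborel) \<noteq> 0"
    using integral_nonneg_eq_0_iff_AE[OF int] by auto
  moreover have "0 \<le> (\<integral>h. ?F h \<partial>lborel)" by (intro integral_nonneg_AE) auto
  ultimately show ?thesis by linarith
qed

text \<open>Brings the mean value from \<open>subharmonic_on\<close> to a ball centred at 0 and to
  \<open>lborel\<close>, where the symmetry arguments for the moments apply.\<close>

lemma integral_lebesgue_on_cball:
  fixes F :: "'a::euclidean_space \<Rightarrow> real"
  assumes "continuous_on (cball a r) F"
  shows "(\<integral>y. F y \<partial>lebesgue_on (cball a r)) = (\<integral>h. indicator (cball 0 r) h * F (a + h) \<partial>lborel)"
proof -
  have m: "(\<lambda>y. indicator (cball a r) y * F y) \<in> borel_measurable borel"
    using borel_measurable_continuous_on_indicator[OF _ assms] by simp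
  have "(\<integral>y. F y \<partial>lebesgue_on (cball a r)) = (\<integral>y. indicator (cball a r) y * F y \<partial>lebesgue)"
    by (subst integral_restrict_space) auto
  also have "\<dots> = (\<integral>y. indicator (cball a r) y * F y \<partial>lborel)"
    using m by (intro integral_completion) simp
  also have "\<dots> = (\<integral>y. indicator (cball a r) y * F y \<partial>distr lborel borel ((+) a))"
    by (simp add: lborel_distr_plus)
  also have "\<dots> = (\<integral>h. indicator (cball a r) (a + h) * F (a + h) \<partial>lborel)"
    using m by (intro integral_distr) auto
  also have "\<dots> = (\<integral>h. indicator (cball 0 r) h * F (a + h) \<partial>lborel)"
    by (intro Bochner_Integration.integral_cong) (auto simp: indicator_def dist_norm)
  finally show ?thesis .
qed

text \<open>The viscosity-type form of subharmonicity: a subharmonic function is not touched from above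
  by a quadratic-plus-odd polynomial with negative Laplacian. The trace-free term
  \<open>(p \<bullet> h)\<^sup>2 - \<bar>p\<bar>\<^sup>2 \<bar>h\<bar>\<^sup>2 / n\<close> and the odd terms have mean zero over balls.\<close>

lemma subharmonic_not_touched:
  fixes v :: "'a::euclidean_space \<Rightarrow> real"
  assumes "subharmonic_on U v" "cball a r \<subseteq> U" "0 < r" "0 < \<kappa>"
    and le: "\<And>h. norm h \<le> r \<Longrightarrow> v (a + h) \<le> v a + A * (p \<bullet> h)
      + B * ((p \<bullet> h)\<^sup>2 - (norm p)\<^sup>2 / DIM('a) * (norm h)\<^sup>2) + E * ((p \<bullet> h) * (norm h)\<^sup>2) - \<kappa> * (norm h)\<^sup>2"
  shows False
proof -
  let ?I = "\<lambda>F. \<integral>h. indicator (cball (0::'a) r) h * F h \<partial>lborel"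
  let ?V = "measure lborel (cball (0::'a) r)"
  have cont: "continuous_on (cball a r) v"
    using assms(1,2) by (auto simp: subharmonic_on_def intro: continuous_on_subset)
  have Veq: "measure lebesgue (cball a r) = ?V"
    using content_cball[of r a] content_cball[of r "0::'a"] assms(3) by simp
  have Vpos: "0 < ?V" using assms(3) by (simp add: content_cball)
  have "v a \<le> ?I (\<lambda>h. v (a + h)) / ?V"
    using assms(1,2,3) unfolding subharmonic_on_def Veq[symmetric] integral_lebesgue_on_cball[OF cont, symmetric]
    by blast
  then have 1: "v a * ?V \<le> ?I (\<lambda>h. v (a + h))"
    using Vpos by (simp add: field_simps)
  have int: "integrable lborel (\<lambda>h::'a. indicator (cball 0 r) h * F h)" if "continuous_on (cball 0 r) F" for F :: "'a \<Rightarrow> real"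
    using that by (rule integrable_cball_continuous)
  have i: "integrable lborel (\<lambda>h::'a. indicator (cball 0 r) h * c)"
      "integrable lborel (\<lambda>h. indicator (cball 0 r) h * (p \<bullet> h))"
      "integrable lborel (\<lambda>h. indicator (cball 0 r) h * (p \<bullet> h)\<^sup>2)"
      "integrable lborel (\<lambda>h::'a. indicator (cball 0 r) h * (norm h)\<^sup>2)"
      "integrable lborel (\<lambda>h. indicator (cball 0 r) h * ((p \<bullet> h) * (norm h)\<^sup>2))" for c :: real
    by (intro int continuous_intros)+
  have iv: "integrable lborel (\<lambda>h. indicator (cball 0 r) h * v (a + h))"
    by (intro int continuous_on_compose2[OF cont]) (auto intro!: continuous_intros simp: dist_norm)
  define q where "q = (norm p)\<^sup>2 / DIM('a)"
  let ?P = "\<lambda>h. indicator (cball 0 r) h * v a + A * (indicator (cball 0 r) h * (p \<bullet> h))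
      + B * (indicator (cball 0 r) h * (p \<bullet> h)\<^sup>2
             - q * (indicator (cball 0 r) h * (norm h)\<^sup>2))
      + E * (indicator (cball 0 r) h * ((p \<bullet> h) * (norm h)\<^sup>2))
      - \<kappa> * (indicator (cball 0 r) h * (norm h)\<^sup>2)"
  have "?I (\<lambda>h. v (a + h)) \<le> (\<integral>h. ?P h \<partial>lborel)"
  proof (rule integral_mono[OF iv])
    show "integrable lborel ?P"
      by (intro Bochner_Integration.integrable_add Bochner_Integration.integrable_diff
          integrable_mult_right i)
    fix h :: 'a
    show "indicator (cball 0 r) h * v (a + h) \<le> ?P h"
      using le[of h] by (auto simp: indicator_def q_def)
  qed
  also have "\<dots> = ?I (\<lambda>h. v a) + A * ?I (\<lambda>h. p \<bullet> h)
      + B * (?I (\<lambda>h. (p \<bullet> h)\<^sup>2) - q * ?I (\<lambda>h. (norm h)\<^sup>2))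
      + E * ?I (\<lambda>h. (p \<bullet> h) * (norm h)\<^sup>2) - \<kappa> * ?I (\<lambda>h. (norm h)\<^sup>2)"
    by (intro has_bochner_integral_integral_eq has_bochner_integral_add has_bochner_integral_diff
        has_bochner_integral_mult_right has_bochner_integral_integrable i)
  also have "\<dots> = v a * ?V - \<kappa> * ?I (\<lambda>h. (norm h)\<^sup>2)"
    by (simp add: integral_ball_odd integral_ball_inner_square q_def)
  finally have "\<kappa> * ?I (\<lambda>h. (norm h)\<^sup>2) \<le> 0" using 1 by simp
  with integral_ball_norm_square_pos[OF assms(3), where 'a='a] assms(4) show False
    by (simp add: mult_le_0_iff)
qed

section \<open>Bounds for the Dirichlet Green function\<close>

text \<open>Second order Taylor formula with Lagrange remainder. Continuity of the second derivative
  at \<open>T\<close> costs the extra \<open>\<eta>\<close>, and \<open>d \<le> T / 2\<close> keeps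
  the intermediate points away from the singularity at 0.\<close>

lemma powr_neg_quadratic_upper:
  fixes T k \<eta> :: real
  assumes "0 < T" "0 < k" "0 < \<eta>"
  shows "\<exists>d>0. d < T \<and> (\<forall>t. \<bar>t\<bar> < d \<longrightarrow>
    (T + t) powr (- k) \<le> T powr (- k) - k * T powr (- k - 1) * t
      + (k * (k + 1) * T powr (- k - 2) / 2 + \<eta>) * t\<^sup>2)"
proof -
  define q2 where "q2 s = k * (k + 1) * s powr (- k - 2)" for s :: real
  have "isCont q2 T" unfolding q2_def using assms by (intro continuous_intros) auto
  then obtain d0 where d0: "d0 > 0" "\<And>s. dist s T < d0 \<Longrightarrow> dist (q2 s) (q2 T) < 2 * \<eta>"
    using assms(3) unfolding continuous_at_eps_delta
    by (metis mult_pos_pos zero_less_numeral)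
  define d where "d = min d0 (T / 2)"
  have d: "d > 0" "d < T" "d \<le> d0" using d0 assms by (auto simp: d_def)
  define D where "D m s = (if m = 0 then s powr (- k) else if m = 1 then - k * s powr (- k - 1) else q2 s)"
    for m :: nat and s :: real
  have "(T + t) powr (- k) \<le> T powr (- k) - k * T powr (- k - 1) * t + (q2 T / 2 + \<eta>) * t\<^sup>2"
    if t: "\<bar>t\<bar> < d" for t
  proof (cases "t = 0")
    case False
    have "\<forall>m s. m < 2 \<and> min T (T + t) \<le> s \<and> s \<le> max T (T + t) \<longrightarrow> DERIV (D m) s :> D (Suc m) s"
    proof (intro allI impI)
      fix m :: nat and s assume ms: "m < 2 \<and> min T (T + t) \<le> s \<and> s \<le> max T (T + t)"
      then have s: "s > 0" using t d by (auto simp: min_def split: if_splits)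
      from ms have "m = 0 \<or> m = 1" by auto
      then show "DERIV (D m) s :> D (Suc m) s"
      proof
        assume m: "m = 0"
        have "DERIV (\<lambda>s. s powr (- k)) s :> - k * s powr (- k - 1)"
          using s by (auto intro!: derivative_eq_intros)
        then show ?thesis using m by (simp add: D_def[abs_def])
      next
        assume m: "m = 1"
        have "DERIV (\<lambda>s. - k * s powr (- k - 1)) s :> - k * ((- k - 1) * s powr (- k - 1 - 1))"
          using s by (intro DERIV_cmult has_real_derivative_powr)
        also have "- k * ((- k - 1) * s powr (- k - 1 - 1)) = q2 s"
          by (simp add: q2_def algebra_simps)
        finally show ?thesis using m by (simp add: D_def[abs_def])
      qed
    qed
    then obtain s where s: "if T + t < T then T + t < s \<and> s < T else T < s \<and> s < T + t"
      and eq: "(T + t) powr (- k) = (\<Sum>m<2. D m T / fact m * (T + t - T) ^ m) + D 2 s / fact 2 * (T + t - T)\<^sup>2"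
      using Taylor[of 2 D "\<lambda>s. s powr (- k)" "min T (T + t)" "max T (T + t)" T "T + t"] False
      by (auto simp: D_def[abs_def])
    have "dist s T < d0" using s t d by (auto simp: dist_real_def split: if_splits)
    then have "q2 s \<le> q2 T + 2 * \<eta>" using d0(2)[of s] by (auto simp: dist_real_def)
    then have "q2 s / 2 * t\<^sup>2 \<le> (q2 T / 2 + \<eta>) * t\<^sup>2" by (intro mult_right_mono) auto
    then show ?thesis using eq by (simp add: D_def numeral_2_eq_2)
  qed simp
  then show ?thesis using d unfolding q2_def by blast
qed

text \<open>The function is \<open>T powr (- k)\<close> with \<open>T\<close> the squared norm and
  \<open>k = (n - 2) / 2\<close>, so a one-dimensional expansion in the increment
  \<open>2 * (a \<bullet> h) + (norm h)\<^sup>2\<close> suffices. Harmonicity shows in the fact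
  that, after the trace-free quadratic part is split off, the remaining multiples of
  \<open>(norm h)\<^sup>2\<close> cancel up to \<open>\<eta>\<close>.\<close>

lemma inverse_norm_power_quadratic_upper:
  fixes a :: "'a::euclidean_space"
  assumes n: "3 \<le> DIM('a)" and a: "a \<noteq> 0" and \<eta>: "0 < \<eta>"
  shows "\<exists>r>0. \<exists>A B E. \<forall>h. norm h < r \<longrightarrow>
    1 / norm (a + h) ^ (DIM('a) - 2) \<le> 1 / norm a ^ (DIM('a) - 2) + A * (a \<bullet> h)
      + B * ((a \<bullet> h)\<^sup>2 - (norm a)\<^sup>2 / DIM('a) * (norm h)\<^sup>2) + E * ((a \<bullet> h) * (norm h)\<^sup>2) + \<eta> * (norm h)\<^sup>2"
proof -
  define N where "N = real DIM('a)"
  define k where "k = (N - 2) / 2"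
  define T where "T = (norm a)\<^sup>2"
  have N3: "3 \<le> N" using n by (simp add: N_def)
  have pos: "0 < T" "0 < k" using a N3 by (auto simp: T_def k_def)
  \<comment> \<open>Chosen so that \<open>4 * \<eta>' * (T / N) = \<eta> / 2\<close>; the other half
    of \<open>\<eta>\<close> is reserved for the quartic term.\<close>
  define \<eta>' where "\<eta>' = \<eta> * N / (8 * T)"
  have \<eta>': "0 < \<eta>'" using \<eta> N3 pos by (simp add: \<eta>'_def)
  define c where "c = k * (k + 1) * T powr (- k - 2) / 2 + \<eta>'"
  have c: "0 < c" using pos \<eta>' unfolding c_def by (intro add_pos_pos divide_pos_pos mult_pos_pos) auto
  obtain d where d: "d > 0" "d < T" "\<And>t. \<bar>t\<bar> < d \<Longrightarrow>
      (T + t) powr (- k) \<le> T powr (- k) - k * T powr (- k - 1) * t + c * t\<^sup>2"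
    using powr_neg_quadratic_upper[OF pos \<eta>'] unfolding c_def by blast
  have conv: "1 / norm y ^ (DIM('a) - 2) = ((norm y)\<^sup>2) powr (- k)" if "y \<noteq> 0" for y :: 'a
  proof -
    have "((norm y)\<^sup>2) powr (- k) = norm y powr (- (N - 2))"
      using that by (simp add: k_def powr_powr diff_divide_distrib flip: powr_numeral)
    also have "\<dots> = 1 / norm y powr (N - 2)"
      by (rule powr_minus_divide)
    also have "N - 2 = real (DIM('a) - 2)" using n by (simp add: N_def of_nat_diff)
    finally show ?thesis using that by (simp add: powr_realpow)
  qed
  \<comment> \<open>The first bound gives \<open>(norm h)\<^sup>2 \<le> norm h\<close>, the second
    brings the increment \<open>t\<close> below \<open>d\<close>, and the third makes the quartic
    term \<open>c * s * s\<close> at most \<open>\<eta> / 2 * s\<close>.\<close>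
  define r where "r = min 1 (min (d / (2 * norm a + 2)) (sqrt (\<eta> / (2 * c))))"
  have r: "r > 0" "r \<le> 1" "r \<le> d / (2 * norm a + 2)" "r \<le> sqrt (\<eta> / (2 * c))"
    using d \<eta> c by (auto simp: r_def add_nonneg_pos)
  have "1 / norm (a + h) ^ (DIM('a) - 2) \<le> 1 / norm a ^ (DIM('a) - 2) + (- 2 * k * T powr (- k - 1)) * (a \<bullet> h)
      + (4 * c) * ((a \<bullet> h)\<^sup>2 - (norm a)\<^sup>2 / N * (norm h)\<^sup>2) + (4 * c) * ((a \<bullet> h) * (norm h)\<^sup>2) + \<eta> * (norm h)\<^sup>2"
    if h: "norm h < r" for h
  proof -
    define z where "z = a \<bullet> h"
    define s where "s = (norm h)\<^sup>2"
    have s0: "0 \<le> s" by (simp add: s_def)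
    define t where "t = 2 * z + s"
    have nah: "(norm (a + h))\<^sup>2 = T + t"
      by (simp add: t_def T_def z_def s_def power2_norm_eq_inner inner_add_left inner_add_right inner_commute)
    have "\<bar>z\<bar> \<le> norm a * norm h" unfolding z_def by (rule Cauchy_Schwarz_ineq2)
    moreover have "s \<le> norm h" using h r unfolding s_def power2_eq_square
      by (intro mult_left_le_one_le) auto
    ultimately have "\<bar>t\<bar> \<le> (2 * norm a + 1) * norm h"
      using s0 unfolding t_def by (auto simp: algebra_simps)
    also have "\<dots> \<le> (2 * norm a + 2) * norm h" by (intro mult_right_mono) auto
    also have "\<dots> < (2 * norm a + 2) * (d / (2 * norm a + 2))"
      using h r by (intro mult_strict_left_mono) (auto simp: add_nonneg_pos)
    also have "\<dots> = d" by (simp add: add_nonneg_pos[THEN less_imp_neq, symmetric])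
    finally have t: "\<bar>t\<bar> < d" .
    then have "0 < T + t" using d by linarith
    then have ah: "a + h \<noteq> 0" using nah by auto
    have "s \<le> \<eta> / (2 * c)"
    proof -
      have "norm h \<le> sqrt (\<eta> / (2 * c))" using h r by linarith
      then have "(norm h)\<^sup>2 \<le> (sqrt (\<eta> / (2 * c)))\<^sup>2" by (intro power_mono) auto
      then show ?thesis using \<eta> c by (simp add: s_def)
    qed
    then have "c * s * s \<le> \<eta> / 2 * s" using c s0 by (intro mult_right_mono) (auto simp: field_simps)
    \<comment> \<open>This is harmonicity: \<open>N = 2 * (k + 1)\<close> turns the second
      derivative's share into exactly the first order coefficient that multiplies \<open>s\<close>
      with the opposite sign.\<close>
    moreover have "4 * c * (T / N) = k * T powr (- k - 1) + \<eta> / 2"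
    proof -
      have 1: "T powr (- k - 2) * T = T powr (- k - 1)"
      proof -
        have "- k - 1 = (- k - 2) + 1" by simp
        then show ?thesis using pos by (simp only: powr_add powr_one)
      qed
      have "N = 2 * (k + 1)" by (simp add: k_def field_simps)
      then have 2: "2 * k * (k + 1) * Q / N = k * Q" for Q
        using pos by (simp add: field_simps)
      have 3: "4 * \<eta>' * (T / N) = \<eta> / 2" using pos N3 by (simp add: \<eta>'_def)
      have "4 * c * (T / N) = 2 * k * (k + 1) * (T powr (- k - 2) * T) / N + 4 * \<eta>' * (T / N)"
        using N3 unfolding c_def by (simp add: field_simps)
      then show ?thesis by (simp only: 1 2 3)
    qed
    then have "4 * c * (T / N) * s = k * T powr (- k - 1) * s + \<eta> / 2 * s"
      by (simp add: distrib_right)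
    moreover have "(T + t) powr (- k) \<le> T powr (- k) - k * T powr (- k - 1) * t + c * t\<^sup>2"
      by (rule d(3)[OF t])
    moreover have "T powr (- k) - k * T powr (- k - 1) * t + c * t\<^sup>2 =
        T powr (- k) + (- 2 * k * T powr (- k - 1)) * z - k * T powr (- k - 1) * s
        + 4 * c * z\<^sup>2 + 4 * c * (z * s) + c * s * s"
      by (simp add: t_def power2_eq_square algebra_simps)
    moreover have "(4 * c) * (z\<^sup>2 - T / N * s) = 4 * c * z\<^sup>2 - 4 * c * (T / N) * s"
      by (simp add: algebra_simps)
    moreover have "\<eta> * s = \<eta> / 2 * s + \<eta> / 2 * s" by simp
    \<comment> \<open>The preceding facts are combined with every product treated as an atom, so the
      arithmetic stays linear.\<close>
    moreover have "X \<le> P + Z1 + W + Z3 + H"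
      if "S2 \<le> H2" "E = S1 + H2" "X \<le> Y" "Y = P + Z1 - S1 + Z2 + Z3 + S2" "W = Z2 - E" "H = H2 + H2"
      for X P Z1 W Z3 H S2 H2 E S1 Y Z2 :: real
      using that by linarith
    ultimately have "(T + t) powr (- k) \<le> T powr (- k) + (- 2 * k * T powr (- k - 1)) * z
        + (4 * c) * (z\<^sup>2 - T / N * s) + (4 * c) * (z * s) + \<eta> * s" by blast
    then show ?thesis
      unfolding conv[OF a] conv[OF ah] nah T_def[symmetric] z_def s_def .
  qed
  with r(1) show ?thesis unfolding N_def by blast
qed

section \<open>Comparison of subfunctions with the fundamental solution\<close>

lemma fund_sol_nonneg: "3 \<le> DIM('a) \<Longrightarrow> 0 \<le> fund_sol (z :: 'a::euclidean_space)"
  by (simp add: fund_sol_def)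

text \<open>A violation makes \<open>v - w\<close> positive somewhere. Positivity is excluded near
  the pole, where the fundamental solution exceeds the maximum of \<open>v\<close>, and on the
  frontier, by the boundary condition. The maximum is therefore interior, and there \<open>v\<close>
  would be touched from above by a function with negative Laplacian.\<close>

lemma subharmonic_le_fund_sol:
  fixes v :: "'a::euclidean_space \<Rightarrow> real"
  assumes n: "3 \<le> DIM('a)" and U: "open U" "bounded U" and x: "x \<in> U"
    and v: "continuous_on (closure U) v" "subharmonic_on U v" "\<And>z. z \<in> frontier U \<Longrightarrow> v z \<le> fund_sol (z - x)"
    and y: "y \<in> U" "y \<noteq> x"
  shows "v y \<le> fund_sol (y - x)"
proof -
  define N where "N z = 1 / norm z ^ (DIM('a) - 2)" for z :: 'a
  define c where "c = 1 / (real DIM('a) * unit_ball_vol (real DIM('a)) * (real DIM('a) - 2))"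
  have c: "c > 0" using n unfolding c_def by (intro divide_pos_pos mult_pos_pos) auto
  have fs: "fund_sol z = c * N z" for z by (simp add: fund_sol_def c_def N_def)
  have cpt: "compact (closure U)" using U(2) by simp
  have "bounded (v ` closure U)" by (intro compact_imp_bounded compact_continuous_image v cpt)
  then obtain M where M: "M > 0" "\<And>z. z \<in> closure U \<Longrightarrow> v z \<le> M"
    unfolding bounded_pos by (force simp: abs_le_iff)
  have "bounded ((\<lambda>z. z - x) ` closure U)"
    by (intro compact_imp_bounded compact_continuous_image cpt continuous_intros)
  then obtain R where R: "R > 0" "\<And>z. z \<in> closure U \<Longrightarrow> norm (z - x) \<le> R"
    unfolding bounded_pos by force
  \<comment> \<open>For \<open>norm (z - x) \<le> 1\<close> the power \<open>n - 2 \<ge> 1\<close>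
    only helps, so \<open>fund_sol (z - x)\<close> is at least \<open>c / \<rho> \<ge> M + 1\<close>
    within distance \<open>\<rho>\<close> of the pole.\<close>
  define \<rho> where "\<rho> = min 1 (c / (M + 1))"
  have \<rho>: "\<rho> > 0" using c M by (simp add: \<rho>_def)
  have near: "M < fund_sol (z - x)" if "z \<noteq> x" "norm (z - x) \<le> \<rho>" for z
  proof -
    let ?t = "norm (z - x)"
    have t: "0 < ?t" "?t \<le> 1" "?t \<le> c / (M + 1)" using that by (auto simp: \<rho>_def)
    have "?t ^ (DIM('a) - 2) \<le> ?t ^ 1" using t n by (intro power_decreasing) auto
    then have "c / ?t \<le> c * N (z - x)" using t c unfolding N_def by (simp add: frac_le)
    moreover have "M + 1 \<le> c / ?t" using t M by (simp add: field_simps)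
    ultimately show ?thesis by (simp add: fs)
  qed
  have est: "v y \<le> fund_sol (y - x) + \<eta> * R\<^sup>2" if \<eta>: "\<eta> > 0" for \<eta>
  proof (rule ccontr)
    assume neg: "\<not> ?thesis"
    \<comment> \<open>Subtracting the squared norm from \<open>R\<^sup>2\<close> keeps the
      correction nonnegative on \<open>closure U\<close>, so \<open>w\<close> still dominates the
      boundary data.\<close>
    define w where "w z = fund_sol (z - x) + \<eta> * (R\<^sup>2 - (norm (z - x))\<^sup>2)" for z
    have w_ge: "fund_sol (z - x) \<le> w z" if "z \<in> closure U" for z
      using power_mono[OF R(2)[OF that], of 2] \<eta> by (simp add: w_def)
    have "w y \<le> fund_sol (y - x) + \<eta> * R\<^sup>2" using \<eta> by (simp add: w_def)
    with neg have vy: "w y < v y" by simp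
    define S where "S = closure U - ball x \<rho>"
    have inS: "\<rho> < norm (z - x)" if "z \<in> closure U" "z \<noteq> x" "w z < v z" for z
      using near[of z] M(2)[OF that(1)] w_ge[OF that(1)] that by (force simp: not_less[symmetric])
    have yS: "y \<in> S"
      using inS[of y] y vy closure_subset[of U] by (auto simp: S_def dist_norm norm_minus_commute)
    have "compact S" unfolding S_def using cpt by (intro compact_diff) auto
    moreover have "continuous_on S (\<lambda>z. v z - w z)"
    proof -
      have "continuous_on S v" by (rule continuous_on_subset[OF v(1)]) (auto simp: S_def)
      moreover have "continuous_on S w"
        unfolding w_def fs N_def using \<rho> by (intro continuous_intros) (auto simp: S_def)
      ultimately show ?thesis by (intro continuous_intros)
    qed
    ultimately obtain a where a: "a \<in> S" "\<And>z. z \<in> S \<Longrightarrow> v z - w z \<le> v a - w a"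
      using continuous_attains_sup[of S "\<lambda>z. v z - w z"] yS by blast
    have va: "w a < v a" using a(2)[OF yS] vy by simp
    have aU: "a \<in> closure U" "a \<noteq> x" using a(1) \<rho> by (auto simp: S_def)
    have "a \<notin> frontier U" using v(3)[of a] w_ge[OF aU(1)] va by fastforce
    then have "a \<in> U" using aU(1) U(1) by (auto simp: frontier_def interior_open)
    moreover have "a \<notin> cball x \<rho>"
      using inS[OF aU va] by (auto simp: dist_norm norm_minus_commute)
    ultimately have "a \<in> U - cball x \<rho>" by simp
    moreover have "open (U - cball x \<rho>)" using U(1) by (intro open_Diff) auto
    ultimately obtain r1 where r1: "r1 > 0" "cball a r1 \<subseteq> U - cball x \<rho>"
      unfolding open_contains_cball by blast
    \<comment> \<open>After multiplication by \<open>c\<close> the expansion error is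
      \<open>\<eta> / 2\<close> times the squared norm; the correction contributes
      \<open>- \<eta>\<close>, so strict negativity \<open>- \<eta> / 2\<close> is left.\<close>
    have "0 < \<eta> / (2 * c)" using \<eta> c by simp
    from inverse_norm_power_quadratic_upper[OF n _ this, of "a - x"] aU(2)
    obtain r2 A B E where r2: "r2 > 0" "\<And>h. norm h < r2 \<Longrightarrow>
        N (a - x + h) \<le> N (a - x) + A * ((a - x) \<bullet> h)
        + B * (((a - x) \<bullet> h)\<^sup>2 - (norm (a - x))\<^sup>2 / DIM('a) * (norm h)\<^sup>2)
        + E * (((a - x) \<bullet> h) * (norm h)\<^sup>2) + \<eta> / (2 * c) * (norm h)\<^sup>2"
      unfolding N_def by auto
    define r where "r = min r1 (r2 / 2)"
    have r: "r > 0" "r < r2" "r \<le> r1" using r1 r2 by (auto simp: r_def)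
    show False
    proof (rule subharmonic_not_touched[OF v(2), of a r "\<eta> / 2"])
      show "cball a r \<subseteq> U" using r1(2) subset_cball[OF r(3), of a] by blast
      fix h :: 'a assume h: "norm h \<le> r"
      have "a + h \<in> cball a r1" using h r by (simp add: dist_norm)
      then have "a + h \<in> U" "a + h \<notin> cball x \<rho>" using r1(2) by auto
      then have "a + h \<in> S" using closure_subset[of U] by (auto simp: S_def)
      then have "v (a + h) \<le> v a + (w (a + h) - w a)" using a(2)[of "a + h"] by simp
      also have "w (a + h) - w a = c * N (a - x + h) - c * N (a - x) - \<eta> * (2 * ((a - x) \<bullet> h) + (norm h)\<^sup>2)"
      proof -
        have e: "a + h - x = a - x + h" by simp
        have nrm: "(norm (a - x + h))\<^sup>2 = (norm (a - x))\<^sup>2 + 2 * ((a - x) \<bullet> h) + (norm h)\<^sup>2"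
          by (simp add: power2_norm_eq_inner inner_add_left inner_add_right inner_diff_left
              inner_diff_right inner_commute)
        show ?thesis unfolding w_def fs e nrm by (simp add: algebra_simps)
      qed
      also have "c * N (a - x + h) \<le> c * (N (a - x) + A * ((a - x) \<bullet> h)
        + B * (((a - x) \<bullet> h)\<^sup>2 - (norm (a - x))\<^sup>2 / DIM('a) * (norm h)\<^sup>2)
        + E * (((a - x) \<bullet> h) * (norm h)\<^sup>2) + \<eta> / (2 * c) * (norm h)\<^sup>2)"
        using r2(2)[of h] h r c by (intro mult_left_mono) auto
      finally show "v (a + h) \<le> v a + (c * A - 2 * \<eta>) * ((a - x) \<bullet> h)
        + (c * B) * (((a - x) \<bullet> h)\<^sup>2 - (norm (a - x))\<^sup>2 / DIM('a) * (norm h)\<^sup>2)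
        + (c * E) * (((a - x) \<bullet> h) * (norm h)\<^sup>2) - \<eta> / 2 * (norm h)\<^sup>2"
        using c by (simp add: algebra_simps)
    qed (use r \<eta> in auto)
  qed
  show ?thesis
  proof (rule tendsto_lowerbound)
    have "((\<lambda>\<eta>. fund_sol (y - x) + \<eta> * R\<^sup>2) \<longlongrightarrow> fund_sol (y - x) + 0 * R\<^sup>2) (at_right 0)"
      by (intro tendsto_intros)
    then show "((\<lambda>\<eta>. fund_sol (y - x) + \<eta> * R\<^sup>2) \<longlongrightarrow> fund_sol (y - x)) (at_right 0)" by simp
    show "\<forall>\<^sub>F \<eta> in at_right 0. v y \<le> fund_sol (y - x) + \<eta> * R\<^sup>2"
      using eventually_at_right_less by (rule eventually_mono) (rule est)
  qed simp
qed

text \<open>The Perron family contains 0 and, off the pole, lies below the fundamental solution, so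
  the supremum is a genuine one between these two. As a supremum of continuous functions it has open
  superlevel sets in \<open>U - {x}\<close>; the pole is a single point and is treated
  separately.\<close>

lemma
  fixes U :: "'a::euclidean_space set"
  assumes n: "3 \<le> DIM('a)" and U: "open U" "bounded U" and x: "x \<in> U"
  shows green_bounds: "y \<in> U \<Longrightarrow> y \<noteq> x \<Longrightarrow> 0 \<le> green U x y \<and> green U x y \<le> fund_sol (y - x)"
    and green_measurable: "green U x \<in> borel_measurable (lebesgue_on U)"
proof -
  define \<V> where "\<V> = {v. continuous_on (closure U) v \<and> subharmonic_on U v \<and>
    (\<forall>z\<in>frontier U. v z \<le> fund_sol (z - x))}"
  define h where "h y = perron_solution U (\<lambda>z. fund_sol (z - x)) y" for y
  have h: "h y = (SUP v\<in>\<V>. v y)" for y by (simp add: h_def perron_solution_def \<V>_def)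
  have z0: "(\<lambda>_. 0) \<in> \<V>"
    using n by (auto simp: \<V>_def subharmonic_on_def fund_sol_nonneg)
  have le: "v y \<le> fund_sol (y - x)" if "v \<in> \<V>" "y \<in> U" "y \<noteq> x" for v y
    using that subharmonic_le_fund_sol[OF n U x, of v y] by (auto simp: \<V>_def)
  have bdd: "bdd_above ((\<lambda>v. v y) ` \<V>)" if "y \<in> U" "y \<noteq> x" for y
    using le that by (intro bdd_aboveI[of _ "fund_sol (y - x)"]) auto
  have h_le: "h y \<le> fund_sol (y - x)" if "y \<in> U" "y \<noteq> x" for y
    unfolding h using z0 le that by (intro cSUP_least) auto
  have h_ge: "0 \<le> h y" if "y \<in> U" "y \<noteq> x" for y
    unfolding h using cSUP_upper[OF z0 bdd[OF that]] by simp
  show "y \<in> U \<Longrightarrow> y \<noteq> x \<Longrightarrow> 0 \<le> green U x y \<and> green U x y \<le> fund_sol (y - x)"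
    using h_le[of y] h_ge[of y] by (simp add: green_def h_def)
  have open_gt: "open {y \<in> U - {x}. t < h y}" for t
  proof -
    have "{y \<in> U - {x}. t < h y} = (\<Union>v\<in>\<V>. {y \<in> U - {x}. t < v y})"
    proof -
      have "t < h y \<longleftrightarrow> (\<exists>v\<in>\<V>. t < v y)" if "y \<in> U - {x}" for y
        unfolding h using z0 bdd[of y] that by (intro less_cSUP_iff) auto
      then show ?thesis by blast
    qed
    moreover have "open {y \<in> U - {x}. t < v y}" if "v \<in> \<V>" for v
    proof -
      have "continuous_on (U - {x}) v"
        using that closure_subset[of U] by (auto simp: \<V>_def intro: continuous_on_subset)
      then have "open ((U - {x}) \<inter> v -` {t<..})"
        using U(1) by (intro continuous_open_preimage) auto
      moreover have "(U - {x}) \<inter> v -` {t<..} = {y \<in> U - {x}. t < v y}" by auto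
      ultimately show ?thesis by simp
    qed
    ultimately show ?thesis by auto
  qed
  have "h \<in> borel_measurable (lebesgue_on U)"
    unfolding borel_measurable_iff_greater
  proof
    fix t
    have "{y \<in> U - {x}. t < h y} \<in> sets borel" using open_gt by auto
    moreover have "{y \<in> {x}. t < h y} \<in> sets borel"
      by (rule borel_closed, rule finite_imp_closed, rule finite_subset[of _ "{x}"]) auto
    moreover have "{y \<in> U. t < h y} = {y \<in> U - {x}. t < h y} \<union> {y \<in> {x}. t < h y}"
      using x by auto
    ultimately have "{y \<in> U. t < h y} \<in> sets borel" by (simp only: sets.Un)
    then show "{y \<in> space (lebesgue_on U). t < h y} \<in> sets (lebesgue_on U)"
      using U(1) by (auto simp: sets_restrict_space_iff)
  qed
  moreover have "(\<lambda>y. fund_sol (y - x)) \<in> borel_measurable (lebesgue_on U)"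
    unfolding fund_sol_def
    by (intro measurable_restrict_space1 measurable_completion) measurable
  ultimately have "(\<lambda>y. fund_sol (y - x) - h y) \<in> borel_measurable (lebesgue_on U)"
    by (intro borel_measurable_diff)
  then show "green U x \<in> borel_measurable (lebesgue_on U)"
    unfolding green_def[abs_def] h_def .
qed

section \<open>The Green operator on \<open>L\<^sup>\<infinity>(U)\<close>\<close>

text \<open>Layer-cake argument in place of polar coordinates: with \<open>k = n - 2\<close>,
  \<open>1 / norm y ^ k\<close> is the integral of \<open>k / r ^ (k + 1)\<close> over
  \<open>r \<ge> norm y\<close>. After the order of integration is exchanged, the slices are balls
  of radius \<open>min r d\<close>, and the two ranges of \<open>r\<close> contribute
  \<open>k * \<alpha> * d\<^sup>2 / 2\<close> and \<open>\<alpha> * d\<^sup>2\<close>, where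
  \<open>\<alpha>\<close> is the volume of the unit ball.\<close>

lemma nn_integral_inverse_norm_power_le:
  assumes n: "3 \<le> DIM('a::euclidean_space)" and d: "0 < d"
  shows "(\<integral>\<^sup>+y. ennreal (1 / norm y ^ (DIM('a) - 2)) * indicator (cball (0::'a) d) y \<partial>lborel)
    \<le> ennreal (real DIM('a) * unit_ball_vol (real DIM('a)) * d\<^sup>2 / 2)"
proof -
  define k where "k = DIM('a) - 2"
  have k: "k \<ge> 1" "DIM('a) = k + 2" using n by (auto simp: k_def)
  define \<alpha> where "\<alpha> = unit_ball_vol (real DIM('a))"
  have \<alpha>: "\<alpha> > 0" by (simp add: \<alpha>_def)
  define f where "f r = real k / r ^ (k + 1)" for r :: real
  have fm: "f \<in> borel_measurable borel" unfolding f_def by measurable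
  have tail: "(\<integral>\<^sup>+r. ennreal (f r) * indicator {s..} r \<partial>lborel) = ennreal (1 / s ^ k)" if "s > 0" for s
  proof -
    have "(\<integral>\<^sup>+r. ennreal (f r) * indicator {s..} r \<partial>lborel) = ennreal (0 - (- (1 / s ^ k)))"
    proof (rule nn_integral_FTC_atLeast[OF fm])
      fix r assume r: "s \<le> r"
      then have "r > 0" using that by simp
      then show "0 \<le> f r" by (simp add: f_def)
      have "DERIV (\<lambda>r. - (1 / r ^ k)) r :> - (- (real k * r ^ (k - 1)) / (r ^ k * r ^ k))"
        using \<open>r > 0\<close> by (auto intro!: derivative_eq_intros)
      also have "- (- (real k * r ^ (k - 1)) / (r ^ k * r ^ k)) = f r"
      proof -
        have "r ^ k = r * r ^ (k - 1)" using k by (simp add: power_eq_if)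
        then show ?thesis using \<open>r > 0\<close> by (simp add: f_def)
      qed
      finally show "DERIV (\<lambda>r. - (1 / r ^ k)) r :> f r" .
    next
      have "((\<lambda>r::real. inverse (r ^ k)) \<longlongrightarrow> 0) at_top"
        using k by (intro tendsto_inverse_0_at_top filterlim_pow_at_top filterlim_ident) auto
      then show "((\<lambda>r::real. - (1 / r ^ k)) \<longlongrightarrow> 0) at_top"
        using tendsto_minus by (fastforce simp: inverse_eq_divide)
    qed
    then show ?thesis by simp
  qed
  define Q where "Q = {p :: 'a \<times> real. norm (fst p) \<le> min (snd p) d}"
  have Q: "Q \<in> sets (lborel \<Otimes>\<^sub>M lborel)"
  proof -
    have "{p \<in> space (lborel \<Otimes>\<^sub>M lborel). norm (fst p :: 'a) \<le> min (snd p) d} \<in> sets (lborel \<Otimes>\<^sub>M lborel)"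
      by measurable
    then show ?thesis by (simp add: Q_def space_pair_measure)
  qed
  have "(\<integral>\<^sup>+y. ennreal (1 / norm y ^ k) * indicator (cball (0::'a) d) y \<partial>lborel)
      \<le> (\<integral>\<^sup>+y. (\<integral>\<^sup>+r. ennreal (f r) * indicator Q (y, r) \<partial>lborel) \<partial>lborel)"
  proof (rule nn_integral_mono)
    fix y :: 'a
    show "ennreal (1 / norm y ^ k) * indicator (cball 0 d) y \<le> (\<integral>\<^sup>+r. ennreal (f r) * indicator Q (y, r) \<partial>lborel)"
    proof (cases "y \<noteq> 0 \<and> norm y \<le> d")
      case True
      then have "(\<integral>\<^sup>+r. ennreal (f r) * indicator Q (y, r) \<partial>lborel) =
          (\<integral>\<^sup>+r. ennreal (f r) * indicator {norm y..} r \<partial>lborel)"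
        by (intro nn_integral_cong) (auto simp: Q_def indicator_def)
      then show ?thesis using True by (simp add: tail)
    next
      \<comment> \<open>At \<open>y = 0\<close> the left side is 0, because division by zero yields
        0.\<close>
      case False
      then show ?thesis using k by (auto simp: zero_power indicator_def)
    qed
  qed
  also have "\<dots> = (\<integral>\<^sup>+r. (\<integral>\<^sup>+y. ennreal (f r) * indicator Q (y, r) \<partial>lborel) \<partial>lborel)"
  proof (rule lborel_pair.Fubini'[symmetric])
    have "f \<in> borel_measurable lborel" using fm by simp
    then have "(\<lambda>p. ennreal (f (snd p)) * indicator Q p) \<in> borel_measurable (lborel \<Otimes>\<^sub>M lborel)"
      by (intro borel_measurable_times_ennreal borel_measurable_indicator[OF Q]
          measurable_compose[OF _ measurable_ennreal] measurable_compose[OF measurable_snd])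
    then show "(\<lambda>(y, r). ennreal (f r) * indicator Q (y, r)) \<in> borel_measurable (lborel \<Otimes>\<^sub>M lborel)"
      by (simp add: case_prod_beta')
  qed
  also have "\<dots> \<le> (\<integral>\<^sup>+r. ennreal (real k * \<alpha> * r) * indicator {0..d} r
      + ennreal (\<alpha> * d ^ (k + 2)) * (ennreal (f r) * indicator {d..} r) \<partial>lborel)"
  proof (rule nn_integral_mono)
    fix r :: real
    have "(\<integral>\<^sup>+y. ennreal (f r) * indicator Q (y, r) \<partial>lborel) =
        (\<integral>\<^sup>+y. ennreal (f r) * indicator (cball (0::'a) (min r d)) y \<partial>lborel)"
      by (intro nn_integral_cong) (auto simp: Q_def indicator_def)
    also have "\<dots> = ennreal (f r) * emeasure lborel (cball (0::'a) (min r d))"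
      by (rule nn_integral_cmult_indicator) simp
    also have "\<dots> \<le> ennreal (real k * \<alpha> * r) * indicator {0..d} r
      + ennreal (\<alpha> * d ^ (k + 2)) * (ennreal (f r) * indicator {d..} r)"
    proof -
      consider "r < 0" | "r = 0" | "0 < r" "r \<le> d" | "d < r" by linarith
      then show ?thesis
      proof cases
        case 1
        then show ?thesis by simp
      next
        case 2
        then show ?thesis by (simp add: f_def)
      next
        case 3
        have "emeasure lborel (cball (0::'a) (min r d)) = ennreal (\<alpha> * r ^ (k + 2))"
          using 3 by (simp add: emeasure_cball \<alpha>_def k(2))
        moreover have "ennreal (f r) * ennreal (\<alpha> * r ^ (k + 2)) = ennreal (f r * (\<alpha> * r ^ (k + 2)))"
          using 3 by (intro ennreal_mult'[symmetric]) (simp add: f_def)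
        moreover have "f r * (\<alpha> * r ^ (k + 2)) = real k * \<alpha> * r"
          using 3 by (simp add: f_def)
        ultimately have "ennreal (f r) * emeasure lborel (cball (0::'a) (min r d)) = ennreal (real k * \<alpha> * r)"
          by (simp only:)
        then show ?thesis using 3 by simp
      next
        case 4
        then show ?thesis using d
          by (simp add: emeasure_cball min_absorb2 mult.commute \<alpha>_def k(2))
      qed
    qed
    finally show "(\<integral>\<^sup>+y. ennreal (f r) * indicator Q (y, r) \<partial>lborel) \<le>
      ennreal (real k * \<alpha> * r) * indicator {0..d} r
      + ennreal (\<alpha> * d ^ (k + 2)) * (ennreal (f r) * indicator {d..} r)" .
  qed
  also have "\<dots> = (\<integral>\<^sup>+r. ennreal (real k * \<alpha> * r) * indicator {0..d} r \<partial>lborel)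
      + ennreal (\<alpha> * d ^ (k + 2)) * (\<integral>\<^sup>+r. ennreal (f r) * indicator {d..} r \<partial>lborel)"
    using fm by (subst nn_integral_add) (auto simp: nn_integral_cmult)
  also have "(\<integral>\<^sup>+r. ennreal (real k * \<alpha> * r) * indicator {0..d} r \<partial>lborel)
      = ennreal (real k * \<alpha> * d\<^sup>2 / 2 - real k * \<alpha> * 0\<^sup>2 / 2)"
    using \<alpha> d by (intro nn_integral_FTC_Icc) (auto intro!: derivative_eq_intros)
  also have "ennreal (\<alpha> * d ^ (k + 2)) * (\<integral>\<^sup>+r. ennreal (f r) * indicator {d..} r \<partial>lborel)
      = ennreal (\<alpha> * d\<^sup>2)"
    using d \<alpha> by (simp add: tail power_add power2_eq_square flip: ennreal_mult)
  also have "ennreal (real k * \<alpha> * d\<^sup>2 / 2 - real k * \<alpha> * 0\<^sup>2 / 2) + ennreal (\<alpha> * d\<^sup>2)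
      = ennreal (real DIM('a) * \<alpha> * d\<^sup>2 / 2)"
    using \<alpha> by (simp add: k(2) field_simps flip: ennreal_plus)
  finally show ?thesis by (simp add: k_def \<alpha>_def)
qed

lemma diameter_pos:
  fixes U :: "'a::euclidean_space set"
  assumes "open U" "bounded U" "U \<noteq> {}"
  shows "0 < diameter U"
proof -
  obtain x r where xr: "x \<in> U" "r > 0" "cball x r \<subseteq> U"
    using assms unfolding open_contains_cball by blast
  obtain b :: 'a where b: "b \<in> Basis" using nonempty_Basis by blast
  have "x + r *\<^sub>R b \<in> U" using xr b by (intro subsetD[OF xr(3)]) (simp add: dist_norm)
  then have "dist (x + r *\<^sub>R b) x \<le> diameter U"
    using xr(1) by (intro diameter_bounded_bound assms)
  then show ?thesis using xr(2) b by (simp add: dist_norm)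
qed

text \<open>Seen from any of its points, \<open>U\<close> lies in a ball of radius
  \<open>diameter U\<close>. The normalising constant of the fundamental solution cancels dimension
  and unit ball volume, and exactly \<open>l0 U\<close> remains.\<close>

lemma nn_integral_fund_sol_le:
  fixes U :: "'a::euclidean_space set"
  assumes n: "3 \<le> DIM('a)" and U: "open U" "bounded U" and x: "x \<in> U"
  shows "(\<integral>\<^sup>+y. ennreal (fund_sol (y - x)) \<partial>lebesgue_on U) \<le> ennreal (l0 U)"
proof -
  define d where "d = diameter U"
  have d: "d > 0" using diameter_pos[OF U] x by (auto simp: d_def)
  define \<alpha> where "\<alpha> = unit_ball_vol (real DIM('a))"
  have \<alpha>: "\<alpha> > 0" by (simp add: \<alpha>_def)
  define c where "c = 1 / (real DIM('a) * \<alpha> * (real DIM('a) - 2))"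
  have c: "c > 0" using n \<alpha> unfolding c_def by (intro divide_pos_pos mult_pos_pos) auto
  let ?g = "\<lambda>y::'a. ennreal c * (ennreal (1 / norm y ^ (DIM('a) - 2)) * indicator (cball 0 d) y)"
  have gm: "?g \<in> borel_measurable borel"
    by (intro borel_measurable_times_ennreal borel_measurable_indicator) auto
  have "(\<integral>\<^sup>+y. ennreal (fund_sol (y - x)) \<partial>lebesgue_on U)
      = (\<integral>\<^sup>+y. ennreal (fund_sol (y - x)) * indicator U y \<partial>lebesgue)"
    using U(1) by (subst nn_integral_restrict_space) auto
  also have "\<dots> \<le> (\<integral>\<^sup>+y. ?g (y - x) \<partial>lebesgue)"
  proof (rule nn_integral_mono)
    fix y
    have "norm (y - x) \<le> d" if "y \<in> U"
      using diameter_bounded_bound[OF U(2) that x] by (simp add: d_def dist_norm)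
    then show "ennreal (fund_sol (y - x)) * indicator U y \<le> ?g (y - x)"
      using c by (auto simp: indicator_def fund_sol_def c_def \<alpha>_def simp flip: ennreal_mult')
  qed
  also have "\<dots> = (\<integral>\<^sup>+y. ?g (y - x) \<partial>lborel)"
    by (rule nn_integral_completion)
  also have "\<dots> = (\<integral>\<^sup>+y. ?g (y - x) \<partial>distr lborel borel ((+) x))"
    by (simp add: lborel_distr_plus)
  also have "\<dots> = (\<integral>\<^sup>+y. ?g (x + y - x) \<partial>lborel)"
    using gm by (intro nn_integral_distr) auto
  also have "\<dots> = ennreal c * (\<integral>\<^sup>+y. ennreal (1 / norm y ^ (DIM('a) - 2)) * indicator (cball (0::'a) d) y \<partial>lborel)"
    by (subst nn_integral_cmult[symmetric]) (auto intro!: borel_measurable_times_ennreal borel_measurable_indicator)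
  also have "\<dots> \<le> ennreal c * ennreal (real DIM('a) * \<alpha> * d\<^sup>2 / 2)"
    unfolding \<alpha>_def by (intro mult_left_mono nn_integral_inverse_norm_power_le n d) auto
  also have "\<dots> = ennreal (c * (real DIM('a) * \<alpha> * d\<^sup>2 / 2))"
    using c by (intro ennreal_mult'[symmetric]) simp
  also have "c * (real DIM('a) * \<alpha> * d\<^sup>2 / 2) = l0 U"
    using \<alpha> n by (simp add: c_def l0_def d_def field_simps)
  finally show ?thesis .
qed

lemma
  fixes U :: "'a::euclidean_space set"
  assumes n: "3 \<le> DIM('a)" and U: "open U" "bounded U" and x: "x \<in> U"
    and \<phi>: "\<phi> \<in> borel_measurable (lebesgue_on U)" "AE y in lebesgue_on U. \<bar>\<phi> y\<bar> \<le> C" and C: "0 \<le> C"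
  shows integrable_green: "integrable (lebesgue_on U) (\<lambda>y. green U x y * \<phi> y)"
    and abs_green_op_le: "\<bar>green_op U \<phi> x\<bar> \<le> l0 U * C"
proof -
  have l0: "0 \<le> l0 U" using n by (simp add: l0_def)
  have nn: "0 \<le> fund_sol (y - x)" for y by (rule fund_sol_nonneg[OF n])
  have fm: "(\<lambda>y. fund_sol (y - x)) \<in> borel_measurable (lebesgue_on U)"
    unfolding fund_sol_def
    by (intro measurable_restrict_space1 measurable_completion) measurable
  have fi: "integrable (lebesgue_on U) (\<lambda>y. fund_sol (y - x))"
    using nn_integral_fund_sol_le[OF n U x] nn fm
    by (intro integrableI_nonneg) (auto intro: le_less_trans[OF _ ennreal_less_top])
  have "(\<integral>y. fund_sol (y - x) \<partial>lebesgue_on U) = enn2real (\<integral>\<^sup>+y. ennreal (fund_sol (y - x)) \<partial>lebesgue_on U)"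
    using nn fm by (intro integral_eq_nn_integral) auto
  also have "\<dots> \<le> l0 U"
    using nn_integral_fund_sol_le[OF n U x] l0 by (intro enn2real_leI) auto
  finally have fle: "(\<integral>y. fund_sol (y - x) \<partial>lebesgue_on U) \<le> l0 U" .
  \<comment> \<open>The Green function bounds are available only off the pole.\<close>
  have "AE y in lebesgue_on U. y \<noteq> x"
  proof -
    have "AE y in lebesgue. y \<noteq> x"
      using AE_lborel_singleton[of x] by (rule AE_completion)
    then show ?thesis using U(1) by (subst AE_restrict_space_iff) auto
  qed
  then have dom: "AE y in lebesgue_on U. \<bar>green U x y * \<phi> y\<bar> \<le> C * fund_sol (y - x)"
    using \<phi>(2) AE_space
  proof eventually_elim
    case (elim y)
    have "0 \<le> green U x y" "green U x y \<le> fund_sol (y - x)"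
      using green_bounds[OF n U x, of y] elim by auto
    then have "\<bar>green U x y\<bar> * \<bar>\<phi> y\<bar> \<le> fund_sol (y - x) * C"
      using elim by (intro mult_mono) auto
    then show ?case by (simp add: abs_mult mult.commute)
  qed
  show int: "integrable (lebesgue_on U) (\<lambda>y. green U x y * \<phi> y)"
  proof (rule Bochner_Integration.integrable_bound)
    show "integrable (lebesgue_on U) (\<lambda>y. C * fund_sol (y - x))" using fi by simp
    show "(\<lambda>y. green U x y * \<phi> y) \<in> borel_measurable (lebesgue_on U)"
      using green_measurable[OF n U x] \<phi>(1) by (intro borel_measurable_times)
    show "AE y in lebesgue_on U. norm (green U x y * \<phi> y) \<le> norm (C * fund_sol (y - x))"
      using dom by eventually_elim (use nn C in auto)
  qed
  have "\<bar>green_op U \<phi> x\<bar> \<le> (\<integral>y. \<bar>green U x y * \<phi> y\<bar> \<partial>lebesgue_on U)"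
    unfolding green_op_def by (rule integral_abs_bound)
  also have "\<dots> \<le> (\<integral>y. C * fund_sol (y - x) \<partial>lebesgue_on U)"
    using int fi dom by (intro integral_mono_AE) auto
  also have "\<dots> \<le> l0 U * C" using fle C by (simp add: mult.commute mult_left_mono)
  finally show "\<bar>green_op U \<phi> x\<bar> \<le> l0 U * C" .
qed

section \<open>Continuous dependence of the solution on the potential\<close>

text \<open>Mean value theorem, with the derivative estimated at the larger endpoint;
  \<open>b = 0\<close>, where \<open>powr\<close> need not be differentiable, is handled
  directly.\<close>

lemma powr_diff_le:
  fixes a b p :: real
  assumes "0 \<le> b" "b \<le> a" "1 < p"
  shows "a powr p - b powr p \<le> p * a powr (p - 1) * (a - b)"
proof (cases "b = 0 \<or> a = b")
  case True
  have "a powr p = a powr (p - 1) * a" if "0 < a"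
    using powr_add[of a "p - 1" 1] that by simp
  moreover have "1 * (a powr (p - 1) * a) \<le> p * (a powr (p - 1) * a)"
    using assms by (intro mult_right_mono) auto
  ultimately show ?thesis using True assms by (cases "a = 0") auto
next
  case False
  then have "0 < b" "b < a" using assms by auto
  then obtain z where z: "b < z" "z < a" "a powr p - b powr p = (a - b) * (p * z powr (p - 1))"
    using MVT2[of b a "\<lambda>s. s powr p" "\<lambda>s. p * s powr (p - 1)"] has_real_derivative_powr
    by (auto simp: mult.assoc)
  have "z powr (p - 1) \<le> a powr (p - 1)"
    using z \<open>0 < b\<close> assms by (intro powr_mono2) auto
  then have "(a - b) * (p * z powr (p - 1)) \<le> (a - b) * (p * a powr (p - 1))"
    using \<open>b < a\<close> assms by (intro mult_left_mono) auto
  then show ?thesis by (simp add: z(3) mult_ac)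
qed

text \<open>For equal signs this is the bound for differences of powers. For opposite signs the
  distance is the sum of the moduli, and
  \<open>\<bar>s\<bar> powr (p - 1) \<le> R powr (p - 1)\<close> suffices.\<close>

lemma signed_powr_Lipschitz:
  fixes s t R p :: real
  assumes "\<bar>s\<bar> \<le> R" "\<bar>t\<bar> \<le> R" "1 < p"
  shows "\<bar>s * \<bar>s\<bar> powr (p - 1) - t * \<bar>t\<bar> powr (p - 1)\<bar> \<le> p * R powr (p - 1) * \<bar>s - t\<bar>"
proof -
  have pw: "a * a powr (p - 1) = a powr p" if "0 \<le> a" for a :: real
    using powr_add[of a 1 "p - 1"] that by (cases "a = 0") auto
  have same: "\<bar>a * a powr (p - 1) - b * b powr (p - 1)\<bar> \<le> p * R powr (p - 1) * \<bar>a - b\<bar>"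
    if ab: "0 \<le> b" "b \<le> a" "a \<le> R" for a b
  proof -
    have "a powr p - b powr p \<le> p * a powr (p - 1) * (a - b)"
      using ab assms by (intro powr_diff_le) auto
    also have "\<dots> \<le> p * R powr (p - 1) * (a - b)"
      using ab assms by (intro mult_right_mono mult_left_mono powr_mono2) auto
    finally have "a powr p - b powr p \<le> p * R powr (p - 1) * (a - b)" .
    moreover have "b powr p \<le> a powr p" using ab assms by (intro powr_mono2) auto
    ultimately show ?thesis using ab by (simp add: pw)
  qed
  have opp: "\<bar>a * a powr (p - 1) + b * b powr (p - 1)\<bar> \<le> p * R powr (p - 1) * \<bar>a + b\<bar>"
    if ab: "0 \<le> b" "0 \<le> a" "a \<le> R" "b \<le> R" for a b
  proof -
    have "a * a powr (p - 1) \<le> a * R powr (p - 1)" "b * b powr (p - 1) \<le> b * R powr (p - 1)"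
      using ab assms by (auto intro!: mult_left_mono powr_mono2)
    then have "a * a powr (p - 1) + b * b powr (p - 1) \<le> 1 * (R powr (p - 1) * (a + b))"
      by (simp add: algebra_simps)
    also have "\<dots> \<le> p * (R powr (p - 1) * (a + b))"
      using ab assms by (intro mult_right_mono) auto
    finally show ?thesis using ab by (simp add: mult_ac)
  qed
  consider "0 \<le> t" "t \<le> s" | "0 \<le> s" "s \<le> t" | "s \<le> 0" "t \<le> s" | "t \<le> 0" "s \<le> t"
    | "s \<le> 0" "0 \<le> t" | "t \<le> 0" "0 \<le> s" by linarith
  then show ?thesis
  proof cases
    case 1 then show ?thesis using same[of t s] assms by simp
  next
    case 2 then show ?thesis using same[of s t] assms by (simp add: abs_minus_commute)
  next
    case 3 then show ?thesis using same[of "- s" "- t"] assms by (simp add: abs_minus_commute)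
  next
    case 4 then show ?thesis using same[of "- t" "- s"] assms by (simp add: abs_minus_commute)
  next
    case 5 then show ?thesis using opp[of "- s" t] assms
      by (simp add: abs_minus_commute)
  next
    case 6 then show ?thesis using opp[of "- t" s] assms
      by (simp add: abs_minus_commute)
  qed
qed

text \<open>The splitting \<open>V u - W w = V (u - w) + (V - W) w\<close> lets the size of only one
  potential enter the coefficient of the difference. That difference stays on both sides; it is
  absorbed once the coefficient is known to be below 1.\<close>

lemma integral_solution_diff_le:
  fixes U :: "'a::euclidean_space set"
  assumes n: "3 \<le> DIM('a)" and U: "open U" "bounded U" and p: "1 < p"
    and b: "b \<in> Linf U" and g: "g \<in> Linf U"
    and V: "V \<in> borel_measurable (lebesgue_on U)" "\<And>y. y \<in> U \<Longrightarrow> \<bar>V y\<bar> \<le> v"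
    and W: "W \<in> borel_measurable (lebesgue_on U)" "\<And>y. y \<in> U \<Longrightarrow> \<bar>V y - W y\<bar> \<le> \<delta>"
    and u: "integral_solution U p b g V u" "Linf_norm U u \<le> R"
    and w: "integral_solution U p b g W w" "Linf_norm U w \<le> R"
    and nonneg: "0 \<le> v" "0 \<le> \<delta>"
  shows "Linf_norm U (\<lambda>x. u x - w x) \<le> l0 U * (\<delta> * R +
    (v + p * Linf_norm U b * R powr (p - 1)) * Linf_norm U (\<lambda>x. u x - w x))"
proof -
  define D where "D = Linf_norm U (\<lambda>x. u x - w x)"
  define C where "C = \<delta> * R + (v + p * Linf_norm U b * R powr (p - 1)) * D"
  let ?\<Phi> = "\<lambda>s::real. s * \<bar>s\<bar> powr (p - 1)"
  have uL: "u \<in> Linf U" and wL: "w \<in> Linf U"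
    using u w by (auto simp: integral_solution_def)
  then have um: "u \<in> borel_measurable (lebesgue_on U)" and wm: "w \<in> borel_measurable (lebesgue_on U)"
    by (auto simp: Linf_def)
  have bm: "b \<in> borel_measurable (lebesgue_on U)" and gm: "g \<in> borel_measurable (lebesgue_on U)"
    using b g by (auto simp: Linf_def)
  have R0: "0 \<le> R" using u(2) Linf_norm_nonneg[of U u] by simp
  have D0: "0 \<le> D" by (simp add: D_def Linf_norm_nonneg)
  have C0: "0 \<le> C" and l0: "0 \<le> l0 U"
    using R0 D0 p nonneg Linf_norm_nonneg[of U b] n by (auto simp: C_def l0_def)
  note [measurable] = um wm bm gm V(1) W(1)
  have ae_u: "AE y in lebesgue_on U. \<bar>u y\<bar> \<le> R"
    using AE_abs_le_Linf_norm[OF uL] by eventually_elim (use u(2) in auto)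
  have ae_w: "AE y in lebesgue_on U. \<bar>w y\<bar> \<le> R"
    using AE_abs_le_Linf_norm[OF wL] by eventually_elim (use w(2) in auto)
  have ae_d: "AE y in lebesgue_on U. \<bar>u y - w y\<bar> \<le> D"
    using AE_abs_le_Linf_norm[OF Linf_diff[OF uL wL]] by (simp add: D_def)
  note ae_b = AE_abs_le_Linf_norm[OF b]
  let ?B = "Linf_norm U b"
  have i1: "integrable (lebesgue_on U) (\<lambda>y. green U x y * (V y * u y))" if "x \<in> U" for x
  proof (rule integrable_green[OF n U that])
    show "AE y in lebesgue_on U. \<bar>V y * u y\<bar> \<le> v * R"
      using ae_u AE_space by eventually_elim (auto simp: abs_mult intro!: mult_mono V(2) nonneg)
  qed (use R0 nonneg in auto)
  have i2: "integrable (lebesgue_on U) (\<lambda>y. green U x y * (W y * w y))" if "x \<in> U" for x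
  proof (rule integrable_green[OF n U that])
    show "AE y in lebesgue_on U. \<bar>W y * w y\<bar> \<le> (v + \<delta>) * R"
      using ae_w AE_space
    proof eventually_elim
      case (elim y)
      then have "\<bar>W y\<bar> \<le> v + \<delta>" using V(2)[of y] W(2)[of y] by auto
      with elim show ?case using nonneg by (auto simp: abs_mult intro!: mult_mono)
    qed
  qed (use R0 nonneg in auto)
  have bd\<Phi>: "\<bar>?\<Phi> s\<bar> \<le> R * R powr (p - 1)" if "\<bar>s\<bar> \<le> R" for s
    using that p by (auto simp: abs_mult intro!: mult_mono powr_mono2)
  have i3: "integrable (lebesgue_on U) (\<lambda>y. green U x y * (b y * z y * \<bar>z y\<bar> powr (p - 1)))"
    if x: "x \<in> U" and z: "z \<in> borel_measurable (lebesgue_on U)" "AE y in lebesgue_on U. \<bar>z y\<bar> \<le> R" for x z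
  proof (rule integrable_green[OF n U x])
    show "AE y in lebesgue_on U. \<bar>b y * z y * \<bar>z y\<bar> powr (p - 1)\<bar> \<le> ?B * (R * R powr (p - 1))"
      using z(2) ae_b
    proof eventually_elim
      case (elim y)
      have "\<bar>b y\<bar> * \<bar>?\<Phi> (z y)\<bar> \<le> ?B * (R * R powr (p - 1))"
        using elim bd\<Phi>[of "z y"] Linf_norm_nonneg[of U b] by (intro mult_mono) auto
      then show ?case by (simp add: abs_mult mult.assoc)
    qed
    show "(\<lambda>y. b y * z y * \<bar>z y\<bar> powr (p - 1)) \<in> borel_measurable (lebesgue_on U)"
      using z(1) by measurable
  qed (use R0 Linf_norm_nonneg[of U b] in auto)
  \<comment> \<open>The contributions of \<open>g\<close> cancel, so \<open>u - w\<close> is the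
    Green operator applied to \<open>\<psi>\<close>; the integrability facts above justify merging
    the integrals.\<close>
  define \<psi> where "\<psi> y = b y * u y * \<bar>u y\<bar> powr (p - 1) - b y * w y * \<bar>w y\<bar> powr (p - 1) - (V y * u y - W y * w y)" for y
  have \<psi>m: "\<psi> \<in> borel_measurable (lebesgue_on U)" unfolding \<psi>_def by measurable
  have \<psi>C: "AE y in lebesgue_on U. \<bar>\<psi> y\<bar> \<le> C"
    using ae_u ae_w ae_d ae_b AE_space
  proof eventually_elim
    case (elim y)
    have yU: "y \<in> U" using elim by simp
    have "\<bar>b y\<bar> * \<bar>?\<Phi> (u y) - ?\<Phi> (w y)\<bar> \<le> ?B * (p * R powr (p - 1) * D)"
      using elim Linf_norm_nonneg[of U b] p
      by (intro mult_mono order.trans[OF signed_powr_Lipschitz[of "u y" R "w y" p]] mult_left_mono) auto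
    moreover have "\<bar>V y\<bar> * \<bar>u y - w y\<bar> \<le> v * D"
      using elim V(2)[OF yU] nonneg by (intro mult_mono) auto
    moreover have "\<bar>V y - W y\<bar> * \<bar>w y\<bar> \<le> \<delta> * R"
      using elim W(2)[OF yU] nonneg by (intro mult_mono) auto
    moreover have "\<psi> y = b y * (?\<Phi> (u y) - ?\<Phi> (w y)) - V y * (u y - w y) - (V y - W y) * w y"
      by (simp add: \<psi>_def algebra_simps)
    ultimately have "\<bar>\<psi> y\<bar> \<le> ?B * (p * R powr (p - 1) * D) + v * D + \<delta> * R"
      by (simp only: abs_mult[symmetric]) linarith
    then show ?case by (simp add: C_def algebra_simps)
  qed
  have "AE x in lebesgue_on U. \<bar>u x - w x\<bar> \<le> l0 U * C"
    using u(1)[unfolded integral_solution_def, THEN conjunct2]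
      w(1)[unfolded integral_solution_def, THEN conjunct2] AE_space
  proof eventually_elim
    case (elim x)
    then have x: "x \<in> U" by simp
    have "u x - w x = green_op U \<psi> x"
      using elim i1[OF x] i2[OF x] i3[OF x um ae_u] i3[OF x wm ae_w]
      unfolding green_op_def \<psi>_def by (simp add: right_diff_distrib)
    then show ?case using abs_green_op_le[OF n U x \<psi>m \<psi>C C0] by simp
  qed
  then have "D \<le> l0 U * C"
    unfolding D_def using l0 C0 by (intro Linf_norm_le) auto
  then show ?thesis by (simp add: C_def D_def)
qed

text \<open>The potentials are equicontinuous and uniformly bounded, so their values on a finite net of
  \<open>U\<close>, rounded to a grid, determine them uniformly up to \<open>e\<close> (the Arzela--Ascoli argument).\<close>

lemma potential_finite_cells:
  fixes f :: "'a::euclidean_space \<Rightarrow>\<^sub>C real"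
  assumes U: "open U" "bounded U" and X: "X \<in> measurable M (borel_signed_radon U)"
    and t: "0 < t" "\<And>\<omega>. \<omega> \<in> space M \<Longrightarrow> tv_norm U (X \<omega>) \<le> t" and e: "0 < e"
  shows "\<exists>c :: 'w \<Rightarrow> 'a \<Rightarrow> int. simple_function M c \<and>
    (\<forall>\<omega>\<in>space M. \<forall>\<omega>'\<in>space M. c \<omega> = c \<omega>' \<longrightarrow>
      (\<forall>y\<in>U. \<bar>potential U f (X \<omega>) y - potential U f (X \<omega>') y\<bar> \<le> e))"
proof -
  have Ub: "U \<in> sets borel" using U(1) by simp
  let ?V = "\<lambda>\<omega>. potential U f (X \<omega>)"
  \<comment> \<open>Three errors add up: moving from \<open>y\<close> to a net point for
    \<open>\<omega>\<close>, the grid rounding there, and moving back for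
    \<open>\<omega>'\<close>.\<close>
  define \<eta> where "\<eta> = e / 3"
  have \<eta>: "\<eta> > 0" using e by (simp add: \<eta>_def)
  have XS: "X \<omega> \<in> signed_radon U" if "\<omega> \<in> space M" for \<omega>
    using measurable_space[OF X that] by (simp add: space_borel_signed_radon)
  obtain d where d: "d > 0" "\<And>\<mu> x x'. \<mu> \<in> signed_radon U \<Longrightarrow> x \<in> U \<Longrightarrow> x' \<in> U \<Longrightarrow> dist x x' < d \<Longrightarrow>
      \<bar>potential U f \<mu> x - potential U f \<mu> x'\<bar> \<le> \<eta> / t * tv_norm U \<mu>"
    using potential_equicontinuous[OF Ub U(2), of "\<eta> / t" f] \<eta> t(1) by auto
  have near: "\<bar>?V \<omega> x - ?V \<omega> x'\<bar> \<le> \<eta>" if "\<omega> \<in> space M" "x \<in> U" "x' \<in> U" "dist x x' < d" for \<omega> x x'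
  proof -
    have "\<bar>?V \<omega> x - ?V \<omega> x'\<bar> \<le> \<eta> / t * tv_norm U (X \<omega>)" using d(2)[OF XS] that by blast
    also have "\<dots> \<le> \<eta> / t * t" using t \<eta> that by (intro mult_left_mono) auto
    finally show ?thesis using t by simp
  qed
  have "compact (closure U)" using U(2) by simp
  moreover have "closure U \<subseteq> (\<Union>x\<in>U. ball x d)"
    using d(1) by (auto simp: closure_approachable dist_commute)
  ultimately obtain S where S: "S \<subseteq> U" "finite S" "closure U \<subseteq> (\<Union>x\<in>S. ball x d)"
    using compactE_image[of "closure U" U "\<lambda>x. ball x d"] open_ball by metis
  define k where "k \<omega> x = \<lfloor>?V \<omega> x / \<eta>\<rfloor>" for \<omega> x
  \<comment> \<open>Restriction to the net \<open>S\<close> places the labels in a finite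
    extensional product, so that \<open>c\<close> has finite range and equal labels mean agreement
    on \<open>S\<close>.\<close>
  define c where "c \<omega> = restrict (k \<omega>) S" for \<omega>
  have Vm: "(\<lambda>\<omega>. ?V \<omega> x) \<in> borel_measurable M" for x
    using measurable_compose[OF X potential_measurable[OF Ub, of f x]] .
  define J where "J = {\<lfloor>- (norm f * t) / \<eta>\<rfloor>..\<lfloor>norm f * t / \<eta>\<rfloor>}"
  have kJ: "k \<omega> x \<in> J" if "\<omega> \<in> space M" for \<omega> x
  proof -
    have "\<bar>?V \<omega> x\<bar> \<le> norm f * tv_norm U (X \<omega>)" by (rule abs_potential_le[OF Ub XS[OF that]])
    also have "\<dots> \<le> norm f * t" using t that by (intro mult_left_mono) auto
    finally have "- (norm f * t) / \<eta> \<le> ?V \<omega> x / \<eta>" "?V \<omega> x / \<eta> \<le> norm f * t / \<eta>"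
      using \<eta> by (auto simp: abs_le_iff field_simps)
    then show ?thesis unfolding k_def J_def by (auto intro: floor_mono)
  qed
  have "simple_function M c"
    unfolding simple_function_def
  proof (intro conjI ballI)
    have "c ` space M \<subseteq> PiE S (\<lambda>_. J)" using kJ by (auto simp: c_def)
    then show "finite (c ` space M)"
      by (rule finite_subset) (auto intro!: finite_PiE simp: S J_def)
    fix q assume "q \<in> c ` space M"
    then obtain \<omega>0 where q: "q = c \<omega>0" by auto
    have "c \<omega> = c \<omega>0 \<longleftrightarrow> (\<forall>x\<in>S. k \<omega> x = k \<omega>0 x)" for \<omega>
      unfolding c_def by (metis restrict_apply' restrict_ext)
    then have "c -` {q} \<inter> space M = {\<omega> \<in> space M. \<forall>x\<in>S. k \<omega> x = k \<omega>0 x}"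
      unfolding q by auto
    also have "\<dots> \<in> sets M"
    proof (rule sets.sets_Collect_finite_All[OF _ S(2)])
      fix x
      have "(\<lambda>\<omega>. k \<omega> x) \<in> measurable M (count_space UNIV)"
        unfolding k_def using Vm[of x] by measurable
      then show "{\<omega> \<in> space M. k \<omega> x = k \<omega>0 x} \<in> sets M" by measurable
    qed
    finally show "c -` {q} \<inter> space M \<in> sets M" .
  qed
  moreover have "\<bar>?V \<omega> y - ?V \<omega>' y\<bar> \<le> e"
    if w: "\<omega> \<in> space M" "\<omega>' \<in> space M" "c \<omega> = c \<omega>'" and y: "y \<in> U" for \<omega> \<omega>' y
  proof -
    obtain x where x: "x \<in> S" "dist x y < d"
      using S(3) y closure_subset[of U] by fastforce
    then have xU: "x \<in> U" using S by auto
    have "k \<omega> x = k \<omega>' x" using fun_cong[OF w(3), of x] x by (simp add: c_def)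
    then have "\<bar>?V \<omega> x / \<eta> - ?V \<omega>' x / \<eta>\<bar> \<le> 1" unfolding k_def by linarith
    then have "\<bar>?V \<omega> x - ?V \<omega>' x\<bar> \<le> \<eta>"
      using \<eta> by (simp add: field_simps flip: diff_divide_distrib)
    moreover have "\<bar>?V \<omega> x - ?V \<omega> y\<bar> \<le> \<eta>" "\<bar>?V \<omega>' x - ?V \<omega>' y\<bar> \<le> \<eta>"
      using near w xU y x(2) by auto
    ultimately show ?thesis unfolding \<eta>_def by linarith
  qed
  ultimately show ?thesis by blast
qed

section \<open>The random solution\<close>

text \<open>Scaling by \<open>R\<close> moves both numbers into the unit ball, where the power map
  has Lipschitz constant \<open>m\<close>. Writing \<open>R ^ m / R\<close> avoids a truncated
  exponent for \<open>m = 0\<close>.\<close>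

lemma abs_power_diff_le:
  fixes s t R :: real
  assumes "\<bar>s\<bar> \<le> R" "\<bar>t\<bar> \<le> R" "0 < R"
  shows "\<bar>\<bar>s\<bar> ^ m - \<bar>t\<bar> ^ m\<bar> \<le> real m * R ^ m / R * \<bar>s - t\<bar>"
proof -
  have "norm ((\<bar>s\<bar> / R) ^ m - (\<bar>t\<bar> / R) ^ m) \<le> real m * norm (\<bar>s\<bar> / R - \<bar>t\<bar> / R)"
    using assms by (intro norm_power_diff) auto
  then have "\<bar>\<bar>s\<bar> ^ m - \<bar>t\<bar> ^ m\<bar> / R ^ m \<le> real m * (\<bar>\<bar>s\<bar> - \<bar>t\<bar>\<bar> / R)"
    using assms by (simp add: power_divide flip: diff_divide_distrib)
  also have "\<dots> \<le> real m * (\<bar>s - t\<bar> / R)"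
    using assms by (intro mult_left_mono divide_right_mono) auto
  finally show ?thesis using assms by (simp add: field_simps)
qed

lemma
  fixes U :: "'a::euclidean_space set"
  assumes "u \<in> Linf U" "Linf_norm U u \<le> R" "0 < R"
  shows Linf_abs_power: "(\<lambda>x. \<bar>u x\<bar> ^ m) \<in> Linf U"
    and Linf_norm_abs_power_le: "Linf_norm U (\<lambda>x. \<bar>u x\<bar> ^ m) \<le> R ^ m"
proof -
  have m: "(\<lambda>x. \<bar>u x\<bar> ^ m) \<in> borel_measurable (lebesgue_on U)"
    using assms(1) by (auto simp: Linf_def)
  have ae: "AE x in lebesgue_on U. \<bar>\<bar>u x\<bar> ^ m\<bar> \<le> R ^ m"
    using AE_abs_le_Linf_norm[OF assms(1)]
    by eventually_elim (use assms in \<open>auto simp: power_abs intro!: power_mono\<close>)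
  show "(\<lambda>x. \<bar>u x\<bar> ^ m) \<in> Linf U" "Linf_norm U (\<lambda>x. \<bar>u x\<bar> ^ m) \<le> R ^ m"
    using assms(3) by (auto intro: LinfI[OF m ae] Linf_norm_le[OF m ae])
qed

lemma Linf_norm_abs_power_diff_le:
  fixes U :: "'a::euclidean_space set"
  assumes "u \<in> Linf U" "Linf_norm U u \<le> R" "w \<in> Linf U" "Linf_norm U w \<le> R" "0 < R"
  shows "Linf_norm U (\<lambda>x. \<bar>u x\<bar> ^ m - \<bar>w x\<bar> ^ m) \<le> real m * R ^ m / R * Linf_norm U (\<lambda>x. u x - w x)"
proof (rule Linf_norm_le)
  show "(\<lambda>x. \<bar>u x\<bar> ^ m - \<bar>w x\<bar> ^ m) \<in> borel_measurable (lebesgue_on U)"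
    using assms(1,3) by (auto simp: Linf_def)
  show "AE x in lebesgue_on U. \<bar>\<bar>u x\<bar> ^ m - \<bar>w x\<bar> ^ m\<bar> \<le> real m * R ^ m / R * Linf_norm U (\<lambda>x. u x - w x)"
    using AE_abs_le_Linf_norm[OF assms(1)] AE_abs_le_Linf_norm[OF assms(3)]
      AE_abs_le_Linf_norm[OF Linf_diff[OF assms(1,3)]]
  proof eventually_elim
    case (elim x)
    have "\<bar>\<bar>u x\<bar> ^ m - \<bar>w x\<bar> ^ m\<bar> \<le> real m * R ^ m / R * \<bar>u x - w x\<bar>"
      using elim assms by (intro abs_power_diff_le) auto
    also have "\<dots> \<le> real m * R ^ m / R * Linf_norm U (\<lambda>x. u x - w x)"
      using elim assms(5) by (intro mult_left_mono) auto
    finally show ?case .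
  qed
qed (use assms(5) Linf_norm_nonneg[of U] in auto)

text \<open>Inserting \<open>\<epsilon> powr (p - 1)\<close> cancels \<open>2 powr p * K\<close>,
  and the smallness condition becomes \<open>(1 - c) powr p < (1 - \<tau>) powr p\<close>.\<close>

lemma admissible_tau_less:
  fixes \<tau> c p K :: real
  assumes "1 < p" "0 < K" "0 < c" "c < 1" and \<epsilon>: "\<epsilon> = ((1 - c) powr p / (2 powr p * K)) powr (1 / (p - 1))"
    and "\<tau> < 1" "2 powr p * K * \<epsilon> powr (p - 1) / (1 - \<tau>) powr (p - 1) + \<tau> < 1"
  shows "\<tau> < c"
proof -
  have \<epsilon>p: "\<epsilon> powr (p - 1) = (1 - c) powr p / (2 powr p * K)"
    unfolding \<epsilon> using assms by (simp add: powr_powr)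
  have "(1 - c) powr p / (1 - \<tau>) powr (p - 1) < 1 - \<tau>"
    using assms(2,7) unfolding \<epsilon>p by simp
  then have "(1 - c) powr p < (1 - \<tau>) * (1 - \<tau>) powr (p - 1)"
    using assms(6) by (simp add: field_simps)
  also have "\<dots> = (1 - \<tau>) powr p"
    using assms(6) powr_add[of "1 - \<tau>" 1 "p - 1"] by simp
  finally have lt: "(1 - c) powr p < (1 - \<tau>) powr p" .
  show ?thesis
  proof (rule ccontr)
    assume "\<not> \<tau> < c"
    then have "(1 - \<tau>) powr p \<le> (1 - c) powr p"
      using assms by (intro powr_mono2) auto
    with lt show False by simp
  qed
qed

theorem theorem3p5:
  fixes U :: "(real ^ 'n) set"
    and P :: "'w measure"
    and X :: "'w \<Rightarrow> (real ^ 'n) set \<Rightarrow> real"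
    and f :: "(real ^ 'n) \<Rightarrow>\<^sub>C real"
    and b g :: "real ^ 'n \<Rightarrow> real"
    and u :: "'w \<Rightarrow> real ^ 'n \<Rightarrow> real"
    and p c\<^sub>0 K \<epsilon>\<^sub>0 :: real
    and m :: nat
    and A :: "'w set"
  assumes "CARD('n) \<ge> 3" and "p > 1"
    and "open U" and "connected U" and "U \<noteq> {}" and "bounded U"
    and "prob_space P" and "complete_measure P"
    and "X \<in> measurable P (borel_signed_radon U)"
    and "f \<noteq> 0"
    and "b \<in> Linf U" and "Linf_norm U b \<noteq> 0"
    and K: "K = l0 U * p * Linf_norm U b"
    and "g \<in> Linf U"
    and "Linf_norm U g < 1 / l0 U * (1 / (2 powr p * K)) powr (1 / (p - 1))"
    and "0 < c\<^sub>0" and "c\<^sub>0 < 1"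
    and eps: "\<epsilon>\<^sub>0 = ((1 - c\<^sub>0) powr p / (2 powr p * K)) powr (1 / (p - 1))"
    and A: "A = admissible_set P X U p f K g \<epsilon>\<^sub>0"
    and u: "\<And>\<omega>. \<omega> \<in> A \<Longrightarrow> integral_solution U p b g (potential U f (X \<omega>)) (u \<omega>) \<and>
                   Linf_norm U (u \<omega>) \<le> 2 * \<epsilon>\<^sub>0 / (1 - tau U f (X \<omega>))"
    and "m \<ge> 1"
    and "(\<Sum>i. let j = Suc i in
            ennreal (fact (m + j - 1) / (fact (m - 1) * fact j) * (l0 U * norm f) ^ j) *
            (\<integral>\<^sup>+\<omega>\<in>A. ennreal (tv_norm U (X \<omega>) ^ j) \<partial>P)) < \<infinity>"
  shows "(\<exists>h \<in> Linf U. has_Linf_bochner_integral (restrict_space P A) U (\<lambda>\<omega> x. \<bar>u \<omega> x\<bar> ^ m) h) \<and>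
         set_integrable P A (\<lambda>\<omega>. Linf_norm U (\<lambda>x. \<bar>u \<omega> x\<bar> ^ m)) \<and>
         (\<exists>h \<in> Linf U. has_Linf_bochner_integral (restrict_space P A) U u h)"
proof -
  note p = \<open>p > 1\<close> and U = \<open>open U\<close> \<open>bounded U\<close> and X = \<open>X \<in> measurable P (borel_signed_radon U)\<close>
    and c0 = \<open>0 < c\<^sub>0\<close> \<open>c\<^sub>0 < 1\<close>
  interpret P: prob_space P by fact
  have n: "3 \<le> DIM(real ^ 'n)" using assms(1) by simp
  have Ub: "U \<in> sets borel" using U by simp
  have l0: "0 < l0 U"
    using diameter_pos[OF U \<open>U \<noteq> {}\<close>] n by (simp add: l0_def)
  have nf: "0 < norm f" using \<open>f \<noteq> 0\<close> by simp
  have B: "0 < Linf_norm U b"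
    using Linf_norm_nonneg[of U b] \<open>Linf_norm U b \<noteq> 0\<close> by simp
  have K0: "0 < K" using l0 B p by (simp add: K)
  have \<epsilon>0: "0 < \<epsilon>\<^sub>0" using K0 c0 unfolding eps by simp
  \<comment> \<open>The individual bound \<open>2 * \<epsilon>\<^sub>0 / (1 - \<tau>)\<close>
    increases with \<open>\<tau>\<close>, so its value at \<open>c\<^sub>0\<close> is uniform over
    \<open>A\<close>.\<close>
  define R where "R = 2 * \<epsilon>\<^sub>0 / (1 - c\<^sub>0)"
  have R: "0 < R" using \<epsilon>0 c0 by (simp add: R_def)
  have KR: "K * R powr (p - 1) = (1 - c\<^sub>0) / 2"
  proof -
    have "\<epsilon>\<^sub>0 powr (p - 1) = (1 - c\<^sub>0) powr p / (2 powr p * K)"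
      unfolding eps using p K0 c0 by (simp add: powr_powr)
    moreover have "(1 - c\<^sub>0) powr p = (1 - c\<^sub>0) powr (p - 1) * (1 - c\<^sub>0)"
      using powr_add[of "1 - c\<^sub>0" "p - 1" 1] c0 by simp
    moreover have "(2::real) powr p = 2 powr (p - 1) * 2"
      using powr_add[of 2 "p - 1" 1] by simp
    ultimately show ?thesis
      using K0 c0 \<epsilon>0 by (simp add: R_def powr_divide powr_mult)
  qed
  have AP: "A \<subseteq> space P" by (auto simp: A admissible_set_def)
  have \<tau>: "tau U f (X \<omega>) < c\<^sub>0" if "\<omega> \<in> A" for \<omega>
    using that admissible_tau_less[OF p K0 c0 eps, of "tau U f (X \<omega>)"]
    by (auto simp: A admissible_set_def)
  have [measurable]: "(\<lambda>\<omega>. tau U f (X \<omega>)) \<in> borel_measurable P"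
    unfolding tau_def using measurable_compose[OF X tv_norm_measurable[OF Ub]] by measurable
  have Aset: "A \<in> sets P"
    unfolding A admissible_set_def by measurable
  define M where "M = restrict_space P A"
  have spM: "space M = A" using AP by (auto simp: M_def space_restrict_space)
  have finM: "finite_measure M"
    unfolding M_def using P.finite_measure_axioms Aset by (intro finite_measure_restrict_space) auto
  have XM: "X \<in> measurable M (borel_signed_radon U)"
    unfolding M_def using X by (rule measurable_restrict_space1)
  have XS: "X \<omega> \<in> signed_radon U" if "\<omega> \<in> A" for \<omega>
    using measurable_space[OF XM] that by (simp add: spM space_borel_signed_radon)
  have uL: "u \<omega> \<in> Linf U" if "\<omega> \<in> A" for \<omega>
    using u[OF that] by (simp add: integral_solution_def)
  have uR: "Linf_norm U (u \<omega>) \<le> R" if "\<omega> \<in> A" for \<omega>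
  proof -
    have "2 * \<epsilon>\<^sub>0 / (1 - tau U f (X \<omega>)) \<le> R"
      unfolding R_def using \<tau>[OF that] c0 \<epsilon>0 by (intro divide_left_mono) auto
    with u[OF that] show ?thesis by linarith
  qed
  have Vm: "potential U f (X \<omega>) \<in> borel_measurable (lebesgue_on U)" if "\<omega> \<in> A" for \<omega>
    using continuous_on_potential[OF Ub U(2) XS[OF that]] Ub
    by (intro continuous_imp_measurable_on_sets_lebesgue) auto
  \<comment> \<open>Since \<open>\<tau>\<close> is \<open>l0 U * norm f\<close> times the total
    variation, admissibility bounds the total variation uniformly; this makes the family of
    potentials totally bounded.\<close>
  have tvle: "tv_norm U (X \<omega>) \<le> 1 / (l0 U * norm f)" if "\<omega> \<in> A" for \<omega>
  proof -
    have "l0 U * norm f * tv_norm U (X \<omega>) \<le> 1" using \<tau>[OF that] c0 by (simp add: tau_def)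
    then show ?thesis using l0 nf by (simp add: field_simps)
  qed
  \<comment> \<open>The coefficient of the difference is at most
    \<open>c\<^sub>0 + (1 - c\<^sub>0) / 2\<close>, so absorbing it leaves the factor
    \<open>(1 - c\<^sub>0) / 2\<close>, whose reciprocal appears in \<open>C\<close>.\<close>
  define C where "C = 2 * l0 U * R / (1 - c\<^sub>0)"
  have C: "0 < C" using l0 R c0 by (simp add: C_def)
  have Lip: "Linf_norm U (\<lambda>x. u \<omega> x - u \<omega>' x) \<le> C * \<delta>"
    if w: "\<omega> \<in> A" "\<omega>' \<in> A" and \<delta>: "0 \<le> \<delta>"
      "\<And>y. y \<in> U \<Longrightarrow> \<bar>potential U f (X \<omega>) y - potential U f (X \<omega>') y\<bar> \<le> \<delta>" for \<omega> \<omega>' \<delta>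
  proof -
    let ?D = "Linf_norm U (\<lambda>x. u \<omega> x - u \<omega>' x)"
    let ?v = "norm f * tv_norm U (X \<omega>)"
    have D0: "0 \<le> ?D" by (rule Linf_norm_nonneg)
    have bnd: "\<bar>potential U f (X \<omega>) y\<bar> \<le> ?v" for y
      by (rule abs_potential_le[OF Ub XS[OF w(1)]])
    then have v0: "0 \<le> ?v" using order_trans[OF abs_ge_zero] by blast
    have "?D \<le> l0 U * (\<delta> * R + (?v + p * Linf_norm U b * R powr (p - 1)) * ?D)"
      using u[OF w(1)] u[OF w(2)] uR w
      by (intro integral_solution_diff_le[OF n U p \<open>b \<in> Linf U\<close> \<open>g \<in> Linf U\<close> Vm[OF w(1)] bnd Vm[OF w(2)] \<delta>(2)]
          v0 \<delta>(1)) auto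
    also have "\<dots> = l0 U * R * \<delta> + (tau U f (X \<omega>) + K * R powr (p - 1)) * ?D"
      by (simp add: K tau_def algebra_simps)
    also have "\<dots> \<le> l0 U * R * \<delta> + (c\<^sub>0 + (1 - c\<^sub>0) / 2) * ?D"
      using \<tau>[OF w(1)] D0 unfolding KR by (intro add_left_mono mult_right_mono) auto
    finally have "(1 - c\<^sub>0) / 2 * ?D \<le> l0 U * R * \<delta>" by (simp add: field_simps)
    then show ?thesis using c0 by (simp add: C_def field_simps)
  qed
  text \<open>Both \<open>u\<close> and \<open>\<bar>u\<bar>\<^sup>m\<close> are uniform limits of simple functions, because they depend
    Lipschitz continuously on the potential.\<close>
  have approx: "\<exists>s. Linf_simple M U s \<and> (\<forall>\<omega>\<in>space M. Linf_norm U (\<lambda>x. F \<omega> x - s \<omega> x) \<le> e)"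
    if F: "F \<in> space M \<rightarrow> Linf U" and L: "0 < L" and FL: "\<And>\<omega> \<omega>'. \<omega> \<in> A \<Longrightarrow> \<omega>' \<in> A \<Longrightarrow>
        Linf_norm U (\<lambda>x. F \<omega> x - F \<omega>' x) \<le> L * Linf_norm U (\<lambda>x. u \<omega> x - u \<omega>' x)"
      and e: "0 < e" for F L e
  proof -
    \<comment> \<open>\<open>L * C\<close> is the Lipschitz constant of \<open>F\<close> with
      respect to the potential, so cells of width \<open>\<delta>\<close> give oscillation at most
      \<open>e\<close>.\<close>
    define \<delta> where "\<delta> = e / (L * C)"
    have \<delta>: "0 < \<delta>" using e L C by (simp add: \<delta>_def)
    obtain c :: "'w \<Rightarrow> real ^ 'n \<Rightarrow> int" where c: "simple_function M c"
      "\<And>\<omega> \<omega>' y. \<omega> \<in> A \<Longrightarrow> \<omega>' \<in> A \<Longrightarrow> c \<omega> = c \<omega>' \<Longrightarrow> y \<in> U \<Longrightarrow>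
        \<bar>potential U f (X \<omega>) y - potential U f (X \<omega>') y\<bar> \<le> \<delta>"
      using potential_finite_cells[OF U XM _ _ \<delta>, of "1 / (l0 U * norm f)" f] tvle l0 nf
      unfolding spM by (metis divide_pos_pos mult_pos_pos zero_less_one)
    show ?thesis
    proof (rule Linf_simple_approx_of_cells[OF F c(1)])
      fix \<omega> \<omega>' assume w: "\<omega> \<in> space M" "\<omega>' \<in> space M" "c \<omega> = c \<omega>'"
      have "Linf_norm U (\<lambda>x. F \<omega> x - F \<omega>' x) \<le> L * Linf_norm U (\<lambda>x. u \<omega> x - u \<omega>' x)"
        using FL w by (simp add: spM)
      also have "\<dots> \<le> L * (C * \<delta>)"
        using w \<delta> c(2) L by (intro mult_left_mono Lip) (auto simp: spM)
      also have "\<dots> = e" using L C by (simp add: \<delta>_def)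
      finally show "Linf_norm U (\<lambda>x. F \<omega> x - F \<omega>' x) \<le> e" .
    qed
  qed
  have F1: "u \<in> space M \<rightarrow> Linf U" using uL by (auto simp: spM)
  have F2: "(\<lambda>\<omega> x. \<bar>u \<omega> x\<bar> ^ m) \<in> space M \<rightarrow> Linf U"
    using Linf_abs_power[OF uL uR R] by (auto simp: spM)
  have L: "0 < real m * R ^ m / R" using \<open>m \<ge> 1\<close> R by simp
  have a1: "\<exists>s. Linf_simple M U s \<and> (\<forall>\<omega>\<in>space M. Linf_norm U (\<lambda>x. u \<omega> x - s \<omega> x) \<le> e)" if "0 < e" for e
    by (rule approx[OF F1 zero_less_one _ that]) simp
  have a2: "\<exists>s. Linf_simple M U s \<and> (\<forall>\<omega>\<in>space M. Linf_norm U (\<lambda>x. \<bar>u \<omega> x\<bar> ^ m - s \<omega> x) \<le> e)" if "0 < e" for e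
    by (rule approx[OF F2 L _ that]) (intro Linf_norm_abs_power_diff_le uL uR R)
  have "integrable M (\<lambda>\<omega>. Linf_norm U (\<lambda>x. \<bar>u \<omega> x\<bar> ^ m))"
  proof (rule finite_measure.integrable_const_bound[OF finM, of _ "R ^ m"])
    show "AE \<omega> in M. norm (Linf_norm U (\<lambda>x. \<bar>u \<omega> x\<bar> ^ m)) \<le> R ^ m"
      using Linf_norm_abs_power_le[OF uL uR R] by (intro AE_I2) (auto simp: spM Linf_norm_nonneg)
    show "(\<lambda>\<omega>. Linf_norm U (\<lambda>x. \<bar>u \<omega> x\<bar> ^ m)) \<in> borel_measurable M"
      by (rule Linf_norm_measurable_uniform_limit[OF finM F2 a2])
  qed
  then have "set_integrable P A (\<lambda>\<omega>. Linf_norm U (\<lambda>x. \<bar>u \<omega> x\<bar> ^ m))"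
    unfolding M_def set_integrable_def using Aset by (subst (asm) integrable_restrict_space) auto
  with has_Linf_bochner_integral_uniform_limit[OF finM F1 a1]
    has_Linf_bochner_integral_uniform_limit[OF finM F2 a2]
  show ?thesis unfolding M_def by blast
qed

end
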